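(* Let $m$ and $N$ be positive integers with $m\ge N$. Given $f\in H^\infty_N$ and an inner function $\theta$, the following are equivalent: (i) $f\theta^m\in H^\infty_N$. (ii) $f\theta^k\in H^\infty_N$ for all $k\in\mathbb{N}$. (iii) $f\theta^k\in \mathrm{BMOA}_N$ for all $k\in\mathbb{N}$. (iv) For some $\varepsilon\in(0,1)$, one has $$|f(z)|=O\left((1-|z|)^N\right),\qquad z\in\Omega(\theta,\varepsilon).$$
   Context: Notation: $\mathbb{N}=\{1,2,\dots\}$, $\mathbb{D}=\{z\in\mathbb{C}:|z|<1\}$, $\mathbb{T}=\partial\mathbb{D}$; $H^\infty$ is the algebra of bounded analytic functions on $\mathbb{D}$. A function $\theta\in H^\infty$ is inner if $\lim_{r\to1^-}|\theta(r\zeta)|=1$ for almost all $\zeta\in\mathbb{T}$. For $N\in\mathbb{N}$: $H^\infty_N:=\{f\in H^\infty:\ f^{(N)}\in H^\infty\}$ and $\mathrm{BMOA}_N:=\{f\in\mathrm{BMOA}:\ f^{(N)}\in\mathrm{BMOA}\}$, where $\mathrm{BMOA}$ is the analytic subspace of $\mathrm{BMO}(\mathbb{T})$, the space of functions of bounded mean oscillation on $\mathbb{T}$ (i.e., $\mathrm{BMOA}$ consists of the functions in the Hardy space $H^1$ on $\mathbb{D}$ whose boundary values lie in $\mathrm{BMO}(\mathbb{T})$). For an inner function $\theta$ and $0<\varepsilon<1$, $\Omega(\theta,\varepsilon):=\{z\in\mathbb{D}:|\theta(z)|<\varepsilon\}$. *)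

theory Defs
  imports "HOL-Complex_Analysis.Complex_Analysis"
begin

text \<open>
  Functions on the open unit disc are represented by total functions on \<open>complex\<close>; only their
  values on \<open>ball 0 1\<close> matter. Functions on the unit circle are likewise total functions
  on \<open>complex\<close>, used only through \<open>t \<mapsto> g (cis t)\<close>, and arc length on the circle is Lebesgue
  measure in \<open>t\<close>.
\<close>

definition Hinf :: "(complex \<Rightarrow> complex) set"
  where "Hinf = {f. f holomorphic_on ball 0 1 \<and> bounded (f ` ball 0 1)}"

definition Hinf_N :: "nat \<Rightarrow> (complex \<Rightarrow> complex) set"
  where "Hinf_N N = {f \<in> Hinf. (deriv ^^ N) f \<in> Hinf}"

definition inner_function :: "(complex \<Rightarrow> complex) \<Rightarrow> bool"
  where "inner_function \<theta> \<longleftrightarrow> \<theta> \<in> Hinf \<and>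
    (AE t in lebesgue_on {0..2*pi}.
      ((\<lambda>r::real. cmod (\<theta> (of_real r * cis t))) \<longlongrightarrow> 1) (at_left 1))"

definition Hardy1 :: "(complex \<Rightarrow> complex) set"
  where "Hardy1 = {f. f holomorphic_on ball 0 1 \<and>
    (\<exists>C. \<forall>r\<in>{0..<1::real}.
      1 / (2*pi) * (LINT t:{0..2*pi}|lebesgue. cmod (f (of_real r * cis t))) \<le> C)}"

text \<open>\<open>arc_mean g a b\<close> is the average of \<open>g\<close> over the arc \<open>cis ` {a..b}\<close>; the arcs of the circle
  are obtained from \<open>a < b \<le> a + 2*pi\<close>.\<close>

definition arc_mean :: "(complex \<Rightarrow> complex) \<Rightarrow> real \<Rightarrow> real \<Rightarrow> complex"
  where "arc_mean g a b = (LINT t:{a..b}|lebesgue. g (cis t)) / of_real (b - a)"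

definition BMO_circle :: "(complex \<Rightarrow> complex) set"
  where "BMO_circle = {g. set_integrable lebesgue {0..2*pi} (\<lambda>t. g (cis t)) \<and>
    (\<exists>C. \<forall>a b. a < b \<and> b \<le> a + 2*pi \<longrightarrow>
      (LINT t:{a..b}|lebesgue. cmod (g (cis t) - arc_mean g a b)) / (b - a) \<le> C)}"

definition has_boundary_values :: "(complex \<Rightarrow> complex) \<Rightarrow> (complex \<Rightarrow> complex) \<Rightarrow> bool"
  where "has_boundary_values f g \<longleftrightarrow>
    (AE t in lebesgue_on {0..2*pi}.
      ((\<lambda>r::real. f (of_real r * cis t)) \<longlongrightarrow> g (cis t)) (at_left 1))"

text \<open>Boundary values are determined only almost everywhere, hence the existential quantifier.\<close>

definition BMOA :: "(complex \<Rightarrow> complex) set"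
  where "BMOA = {f \<in> Hardy1. \<exists>g \<in> BMO_circle. has_boundary_values f g}"

definition BMOA_N :: "nat \<Rightarrow> (complex \<Rightarrow> complex) set"
  where "BMOA_N N = {f \<in> BMOA. (deriv ^^ N) f \<in> BMOA}"

definition Omega :: "(complex \<Rightarrow> complex) \<Rightarrow> real \<Rightarrow> complex set"
  where "Omega \<theta> \<epsilon> = {z \<in> ball 0 1. cmod (\<theta> z) < \<epsilon>}"

end

theory Submission
  imports Defs "HOL-Computational_Algebra.Fundamental_Theorem_Algebra"
begin

text \<open>
  Write \<open>d = 1 - cmod z\<close> and \<open>g = f * \<theta> ^ m\<close>.

  (i) or (iii) implies (iv): let \<open>M\<close> be the maximum of \<open>cmod f\<close> on \<open>cball z (d/2)\<close>. As
  \<open>f * (\<theta> - \<theta> z) ^ m\<close> vanishes to order \<open>m\<close> at \<open>z\<close>, the Taylor coefficients of \<open>g\<close> at \<open>z\<close> of order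
  \<open>j < m\<close> are \<open>O(cmod (\<theta> z) * M / d ^ j)\<close>. On the circle \<open>cmod f = cmod g\<close>, so Taylor's formula for
  \<open>g\<close>, with a remainder of order \<open>K \<le> m\<close>, and the maximum principle for \<open>f / (1 - cnj z * w) ^ K\<close> give
  \<open>M \<le> const * (cmod (\<theta> z) * M + d ^ N)\<close>, and \<open>M\<close> can be absorbed once \<open>cmod (\<theta> z) < \<epsilon>\<close> with
  \<open>\<epsilon>\<close> small. Here \<open>K = N\<close> in case (i). In case (iii) \<open>K = N + 1\<close>: functions in BMOA are Bloch
  functions, because \<open>H\<^sup>1 = H\<^sup>2 * H\<^sup>2\<close> makes them Cauchy integrals of their boundary values.

  (iv) implies (ii): it suffices to treat \<open>k = 1\<close>, as \<open>\<theta> ^ k\<close> is inner. Let \<open>D\<close> be the larger of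
  \<open>d\<close> and the distance of \<open>z\<close> to \<open>Omega \<theta> (\<epsilon>/2)\<close>. Then the derivatives of \<open>f\<close> of order \<open>N - j\<close> are
  \<open>O(D ^ j)\<close> at \<open>z\<close> by Taylor's formula, whereas those of \<open>\<theta>\<close> of order \<open>j\<close> are \<open>O(1 / D ^ j)\<close> since
  \<open>\<theta>\<close> extends by reflection to a disc of radius comparable to \<open>D\<close>.

  (ii) implies (iii) is the inclusion of \<open>Hinf\<close> in BMOA, that is, Fatou's theorem on radial limits,
  which follows from the weak type inequality for the radial maximal function.
\<close>

section \<open>Bounded analytic functions and Taylor remainders\<close>

text \<open>On the circle \<open>\<theta>\<close> is known only through almost-everywhere radial
  limits of its modulus, and this shapes the proof. Circle estimates are made for \<open>f\<close>:
  as \<open>N \<ge> 1\<close> makes \<open>f\<close> Lipschitz, it extends continuously, and a bound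
  valid almost everywhere holds everywhere. The reflection of \<open>\<theta>\<close> is carried out
  on primitives, which are continuous up to the boundary. The divisor
  \<open>(1 - cnj z * w) ^ K\<close> has no zero in the closed disc, has modulus
  \<open>cmod (w - z) ^ K\<close> on the circle and is at most \<open>(3 * d) ^ K\<close> on
  \<open>cball z (d/2)\<close>; dividing by it turns growth away from \<open>z\<close> into a local
  bound of the right size. In case (iii) a remainder of order \<open>N\<close> would cost a
  logarithm, since Bloch functions may be unbounded; one further order restores
  \<open>d ^ N\<close>. Dilates converge in mean square by Parseval's formula, but Cauchy integrals
  of boundary values need convergence in mean; two mean-square factors provide it. The same
  convergence makes \<open>f z - f (s * z)\<close> small in mean before the maximal inequality is
  applied to it.\<close>

lemma HinfE:
  assumes "f \<in> Hinf"
  obtains B where "f holomorphic_on ball 0 1" "0 < B" "\<And>z. z \<in> ball 0 1 \<Longrightarrow> cmod (f z) \<le> B"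
proof -
  have "f holomorphic_on ball 0 1" "bounded (f ` ball 0 1)" using assms by (auto simp: Hinf_def)
  then show ?thesis using that by (auto simp: bounded_pos)
qed

lemma HinfI:
  assumes "f holomorphic_on ball 0 1" "\<And>z. z \<in> ball 0 1 \<Longrightarrow> cmod (f z) \<le> B"
  shows "f \<in> Hinf"
  using assms by (auto simp: Hinf_def bounded_iff intro!: exI[of _ B])

lemma Hinf_mult:
  assumes "f \<in> Hinf" "g \<in> Hinf"
  shows "(\<lambda>z. f z * g z) \<in> Hinf"
proof -
  obtain B where B: "f holomorphic_on ball 0 1" "\<And>z. z \<in> ball 0 1 \<Longrightarrow> cmod (f z) \<le> B"
    using HinfE[OF assms(1)] by blast
  obtain C where C: "g holomorphic_on ball 0 1" "0 < C" "\<And>z. z \<in> ball 0 1 \<Longrightarrow> cmod (g z) \<le> C"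
    using HinfE[OF assms(2)] by blast
  show ?thesis
  proof (rule HinfI)
    fix z :: complex assume "z \<in> ball 0 1"
    then show "cmod (f z * g z) \<le> B * C"
      unfolding norm_mult using B(2)[of z] C by (intro mult_mono) (auto intro: order_trans[OF norm_ge_zero])
  qed (intro holomorphic_intros B C)
qed

lemma Hinf_power: "f \<in> Hinf \<Longrightarrow> (\<lambda>z. f z ^ k) \<in> Hinf"
proof (induction k)
  case 0
  show ?case by (rule HinfI[of _ 1]) auto
qed (auto intro: Hinf_mult)

lemma has_field_derivative_iterated_deriv:
  assumes "f holomorphic_on ball 0 1" "z \<in> ball 0 1"
  shows "((deriv ^^ i) f has_field_derivative (deriv ^^ Suc i) f z) (at z within S)"
  using has_field_derivative_higher_deriv[OF assms(1) open_ball assms(2)]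
  by (rule has_field_derivative_at_within)

lemma holomorphic_deriv_bound_imp_lipschitz:
  assumes "f holomorphic_on ball 0 1" "0 \<le> B" "\<And>z. z \<in> ball 0 1 \<Longrightarrow> cmod (deriv f z) \<le> B"
  shows "B-lipschitz_on (ball 0 1) f"
proof (rule lipschitz_onI)
  fix x y :: complex assume xy: "x \<in> ball 0 1" "y \<in> ball 0 1"
  show "dist (f x) (f y) \<le> B * dist x y"
    unfolding dist_norm
    by (rule field_differentiable_bound[of "ball 0 1" _ "deriv f"])
       (use assms xy has_field_derivative_iterated_deriv[OF assms(1), of _ 0] in auto)
qed (fact assms)

text \<open>Descent from order \<open>N\<close>: a bounded derivative makes the function Lipschitz,
  and a Lipschitz function on the disc is bounded.\<close>

lemma iterated_deriv_in_Hinf: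
  assumes "f \<in> Hinf_N N" "l \<le> N"
  shows "(deriv ^^ l) f \<in> Hinf"
  using \<open>l \<le> N\<close>
proof (induction l rule: inc_induct)
  case base
  then show ?case using assms by (simp add: Hinf_N_def)
next
  case (step l)
  have "f holomorphic_on ball 0 1" using assms by (simp add: Hinf_N_def Hinf_def)
  then have hol: "(deriv ^^ l) f holomorphic_on ball 0 1"
    by (intro holomorphic_higher_deriv) auto
  obtain B where B: "0 < B" "\<And>z. z \<in> ball 0 1 \<Longrightarrow> cmod ((deriv ^^ Suc l) f z) \<le> B"
    using HinfE[OF step.IH] by blast
  have lip: "B-lipschitz_on (ball 0 1) ((deriv ^^ l) f)"
    by (rule holomorphic_deriv_bound_imp_lipschitz[OF hol]) (use B in auto)
  show ?case
  proof (rule HinfI[OF hol])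
    fix z :: complex assume z: "z \<in> ball 0 1"
    have "dist ((deriv ^^ l) f z) ((deriv ^^ l) f 0) \<le> B * dist z 0"
      by (rule lipschitz_onD[OF lip z]) auto
    also have "\<dots> \<le> B * 1" using z B by (intro mult_left_mono) auto
    finally show "cmod ((deriv ^^ l) f z) \<le> cmod ((deriv ^^ l) f 0) + B"
      using norm_triangle_sub[of "(deriv ^^ l) f z" "(deriv ^^ l) f 0"] by (simp add: dist_norm)
  qed
qed

text \<open>The Lipschitz constant later yields the continuous extension of \<open>f\<close> to the
  closed disc; this is where a positive \<open>N\<close> enters.\<close>

lemma Hinf_N_lipschitz:
  assumes "f \<in> Hinf_N N" "0 < N"
  obtains L where "L-lipschitz_on (ball 0 1) f"
proof -
  have "(deriv ^^ 1) f \<in> Hinf" by (rule iterated_deriv_in_Hinf[OF assms(1)]) (use assms in auto)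
  then obtain B where B: "0 < B" "\<forall>z\<in>ball 0 1. cmod ((deriv ^^ 1) f z) \<le> B"
    by (auto simp: Hinf_def bounded_pos)
  have "f holomorphic_on ball 0 1" using assms by (simp add: Hinf_N_def Hinf_def)
  then have "B-lipschitz_on (ball 0 1) f"
    by (rule holomorphic_deriv_bound_imp_lipschitz) (use B in auto)
  then show ?thesis by (rule that)
qed

lemma taylor_remainder_bounded:
  assumes hol: "f holomorphic_on ball 0 1" and B: "\<And>z. z \<in> ball 0 1 \<Longrightarrow> cmod ((deriv ^^ K) f z) \<le> B"
    and z: "z \<in> ball 0 1" and w: "w \<in> ball 0 1"
  shows "cmod (f w - (\<Sum>j<K. (deriv ^^ j) f z / fact j * (w - z) ^ j)) \<le> B * cmod (w - z) ^ K"
proof (cases K)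
  \<comment> \<open>Order 0 occurs when the top derivative of order \<open>N\<close> is itself
    expanded, with \<open>K = N - l = 0\<close>.\<close>
  case 0
  then show ?thesis using B[OF w] by simp
next
  case (Suc n)
  have "cmod ((deriv ^^ 0) f w - (\<Sum>i\<le>n. (deriv ^^ i) f z * (w - z) ^ i / fact i))
        \<le> B * cmod (w - z) ^ Suc n / fact n"
    by (rule complex_Taylor[of "ball 0 1" n "\<lambda>i. (deriv ^^ i) f"])
       (use B has_field_derivative_iterated_deriv[OF hol] z w Suc in auto)
  also have "\<dots> \<le> B * cmod (w - z) ^ Suc n / 1"
    using order_trans[OF norm_ge_zero B[OF z]] fact_ge_1[of n, where ?'a=real]
    by (intro divide_left_mono) (auto intro!: mult_nonneg_nonneg)
  finally show ?thesis by (simp add: Suc lessThan_Suc_atMost)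
qed

text \<open>The gain of one power of \<open>1 - cmod z\<close> comes from
  \<open>1 - cmod (z + s * (w - z)) \<ge> (1 - s) * (1 - cmod z)\<close>, which is integrable against
  \<open>(1 - s) ^ (K - 1)\<close> when \<open>K \<ge> 2\<close>.\<close>

lemma taylor_remainder_bloch:
  assumes hol: "f holomorphic_on ball 0 1"
    and B: "\<And>z. z \<in> ball 0 1 \<Longrightarrow> cmod ((deriv ^^ K) f z) \<le> B / (1 - cmod z)"
    and z: "z \<in> ball 0 1" and w: "w \<in> ball 0 1" and "2 \<le> K"
  shows "cmod (f w - (\<Sum>j<K. (deriv ^^ j) f z / fact j * (w - z) ^ j))
         \<le> B * cmod (w - z) ^ K / (1 - cmod z)"
proof -
  define p where "p = (\<lambda>s::real. z + of_real s * (w - z))"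
  define d where "d = 1 - cmod z"
  have d: "0 < d" using z by (simp add: d_def)
  have B0: "0 \<le> B" using order_trans[OF norm_ge_zero B[of 0]] by simp
  have p: "(1 - s) * d \<le> 1 - cmod (p s)" "p s \<in> ball 0 1" if s: "s \<in> {0..1}" for s
  proof -
    have "p s = of_real (1 - s) * z + of_real s * w" by (simp add: p_def algebra_simps)
    then have "cmod (p s) \<le> cmod (of_real (1 - s) * z) + cmod (of_real s * w)"
      by (metis norm_triangle_ineq)
    also have "\<dots> = (1 - s) * cmod z + s * cmod w"
      using s by (simp only: norm_mult norm_of_real) auto
    finally have le: "cmod (p s) \<le> (1 - s) * cmod z + s * cmod w" .
    also have "s * cmod w \<le> s * 1" using s w by (intro mult_left_mono) auto
    finally show 1: "(1 - s) * d \<le> 1 - cmod (p s)" by (simp add: d_def algebra_simps)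
    show "p s \<in> ball 0 1"
    proof (cases "s = 1")
      case True
      then show ?thesis using w by (simp add: p_def)
    next
      case False
      then have "0 < (1 - s) * d" using s d by simp
      with 1 show ?thesis by simp
    qed
  qed
  define Df where "Df = (\<lambda>i s. (deriv ^^ i) f (p s) * (w - z) ^ i)"
  have Df: "(Df i has_vector_derivative Df (Suc i) s) (at s within {0..1})" if "0 \<le> s" "s \<le> 1" for i s
  proof -
    have "(p has_vector_derivative (w - z)) (at s within {0..1})"
      unfolding p_def by (auto intro!: derivative_eq_intros simp: scaleR_conv_of_real)
    moreover have "((deriv ^^ i) f has_field_derivative (deriv ^^ Suc i) f (p s)) (at (p s) within p ` {0..1})"
      by (rule has_field_derivative_iterated_deriv[OF hol p(2)]) (use that in auto)
    ultimately have "((deriv ^^ i) f \<circ> p has_vector_derivative (w - z) * (deriv ^^ Suc i) f (p s)) (at s within {0..1})"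
      by (rule field_vector_diff_chain_within)
    then have "((\<lambda>s. (deriv ^^ i) f (p s)) has_vector_derivative (w - z) * (deriv ^^ Suc i) f (p s)) (at s within {0..1})"
      by (simp add: o_def)
    then have "((\<lambda>s. (deriv ^^ i) f (p s) * (w - z)^i) has_vector_derivative
        ((w - z) * (deriv ^^ Suc i) f (p s)) * (w - z)^i) (at s within {0..1})"
      by (rule has_vector_derivative_mult_left)
    then show ?thesis by (simp add: Df_def mult_ac)
  qed
  have hi: "((\<lambda>x. ((1 - x) ^ (K - 1) / fact (K - 1)) *\<^sub>R Df K x) has_integral
      Df 0 1 - (\<Sum>i<K. ((1 - 0) ^ i / fact i) *\<^sub>R Df i 0)) {0..1}"
    by (rule Taylor_has_integral[where f="Df 0"]) (use Df \<open>2 \<le> K\<close> in auto)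
  have eq: "Df 0 1 - (\<Sum>i<K. ((1 - 0) ^ i / fact i) *\<^sub>R Df i 0)
       = f w - (\<Sum>j<K. (deriv ^^ j) f z / fact j * (w - z) ^ j)"
    by (simp add: Df_def p_def scaleR_conv_of_real)
  have "norm (Df 0 1 - (\<Sum>i<K. ((1 - 0) ^ i / fact i) *\<^sub>R Df i 0))
     \<le> (B * cmod (w - z) ^ K / d) * measure lborel (cbox (0::real) 1)"
  \<comment> \<open>The integrand has a constant bound except at \<open>s = 1\<close>, where the
    lower bound \<open>(1 - s) * d\<close> for the distance to the circle degenerates; a single
    point may be dropped.\<close>
  proof (rule has_integral_bound_spike_finite[of _ "{1}"])
    show "((\<lambda>x. ((1 - x) ^ (K - 1) / fact (K - 1)) *\<^sub>R Df K x) has_integral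
      Df 0 1 - (\<Sum>i<K. ((1 - 0) ^ i / fact i) *\<^sub>R Df i 0)) (cbox 0 1)" using hi by simp
    fix s :: real assume s: "s \<in> cbox 0 1 - {1}"
    then have s1: "s \<in> {0..1}" "s < 1" by auto
    have pos: "0 < (1 - s) * d" using s1 d by simp
    have "cmod ((deriv ^^ K) f (p s)) \<le> B / (1 - cmod (p s))" by (rule B[OF p(2)[OF s1(1)]])
    also have "\<dots> \<le> B / ((1 - s) * d)"
      using p[OF s1(1)] pos B0 by (intro divide_left_mono) auto
    finally have k: "cmod ((deriv ^^ K) f (p s)) \<le> B / ((1 - s) * d)" .
    have "norm (((1 - s) ^ (K - 1) / fact (K - 1)) *\<^sub>R Df K s)
       \<le> ((1 - s) ^ (K - 1) / fact (K - 1)) * (B / ((1 - s) * d) * cmod (w - z) ^ K)"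
      using s1 unfolding Df_def norm_scaleR norm_mult norm_power
      by (intro mult_mono k mult_nonneg_nonneg order_trans[OF norm_ge_zero k]) auto
    also have "\<dots> \<le> ((1 - s) / 1) * (B / ((1 - s) * d) * cmod (w - z) ^ K)"
    proof (intro mult_right_mono frac_le)
      have "(1 - s) ^ (K - 1) \<le> (1 - s) ^ 1" using s1 \<open>2 \<le> K\<close> by (intro power_decreasing) auto
      then show "(1 - s) ^ (K - 1) \<le> 1 - s" by simp
    qed (use B0 pos s1 in \<open>auto intro!: mult_nonneg_nonneg divide_nonneg_nonneg\<close>)
    also have "\<dots> = B * cmod (w - z) ^ K / d" using s1 d by (simp add: field_simps)
    finally show "norm (((1 - s) ^ (K - 1) / fact (K - 1)) *\<^sub>R Df K s) \<le> B * cmod (w - z) ^ K / d" .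
  qed (use B0 d in auto)
  then show ?thesis unfolding eq by (simp add: d_def)
qed

section \<open>Decay of f where the inner function is small\<close>

lemma AE_lebesgue_iff_negligible:
  "(AE x in lebesgue. P x) \<longleftrightarrow> negligible {x. \<not> P x}"
proof
  assume "AE x in lebesgue. P x"
  then obtain N where "N \<in> null_sets lebesgue" "{x. \<not> P x} \<subseteq> N"
    unfolding eventually_ae_filter by auto
  then show "negligible {x. \<not> P x}"
    using negligible_subset negligible_iff_null_sets by blast
next
  assume "negligible {x. \<not> P x}"
  then show "AE x in lebesgue. P x"
    unfolding eventually_ae_filter negligible_iff_null_sets by auto
qed

lemma one_minus_cnj_mult_neq_0:
  assumes "z \<in> ball 0 1" "x \<in> cball 0 1"
  shows "1 - cnj z * x \<noteq> 0"
proof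
  assume "1 - cnj z * x = 0"
  then have "cnj z * x = 1" by simp
  then have "cmod z * cmod x = 1" by (metis complex_mod_cnj norm_mult norm_one)
  moreover have "cmod z * cmod x \<le> cmod z * 1" using assms by (intro mult_left_mono) auto
  ultimately show False using assms by simp
qed

lemma cball_subset_unit_ball:
  fixes z :: complex
  assumes "cmod z + s < 1"
  shows "cball z s \<subseteq> ball 0 1"
proof
  fix x assume "x \<in> cball z s"
  then show "x \<in> ball 0 1"
    using assms norm_triangle_ineq[of z "x - z"] by (simp add: dist_norm norm_minus_commute)
qed

lemma Cauchy_bound_cball:
  assumes "f holomorphic_on S" "cball z r \<subseteq> S" "0 < r" "\<And>x. x \<in> cball z r \<Longrightarrow> cmod (f x) \<le> B"
  shows "cmod ((deriv ^^ n) f z) \<le> fact n * B / r ^ n"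
proof (rule Cauchy_inequality)
  show "f holomorphic_on ball z r"
    using assms(1,2) by (meson ball_subset_cball holomorphic_on_subset order_trans)
  show "continuous_on (cball z r) f"
    using assms(1,2) holomorphic_on_imp_continuous_on holomorphic_on_subset by blast
  show "cmod (f x) \<le> B" if "cmod (z - x) = r" for x
    by (rule assms(4)) (use that in \<open>auto simp: dist_norm\<close>)
qed fact

text \<open>One factor \<open>\<phi>\<close> is split off and Leibniz's rule applied. A term
  differentiating the rest fewer than \<open>m\<close> times vanishes by induction; the only other
  one leaves \<open>\<phi>\<close> undifferentiated, and \<open>\<phi> z = 0\<close>.\<close>

lemma higher_deriv_mult_power_eq_0:
  assumes "h holomorphic_on S" "\<phi> holomorphic_on S" "open S" "z \<in> S" "\<phi> z = 0" "j < m"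
  shows "(deriv ^^ j) (\<lambda>w. h w * \<phi> w ^ m) z = 0"
  using \<open>j < m\<close>
proof (induction m arbitrary: j)
  case (Suc m)
  have "(deriv ^^ j) (\<lambda>w. (h w * \<phi> w ^ m) * \<phi> w) z =
     (\<Sum>i = 0..j. of_nat (j choose i) * (deriv ^^ i) (\<lambda>w. h w * \<phi> w ^ m) z * (deriv ^^ (j-i)) \<phi> z)"
    by (rule higher_deriv_mult[of _ S]) (use assms in \<open>auto intro!: holomorphic_intros\<close>)
  also have "\<dots> = 0"
  proof (rule sum.neutral, safe)
    fix i assume "i \<in> {0..j}"
    then consider "i < m" | "i = j" using Suc.prems by fastforce
    then show "of_nat (j choose i) * (deriv ^^ i) (\<lambda>w. h w * \<phi> w ^ m) z * (deriv ^^ (j-i)) \<phi> z = 0"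
      by cases (auto simp: Suc.IH \<open>\<phi> z = 0\<close>)
  qed
  finally show ?case by (simp add: mult_ac)
qed auto

lemma higher_deriv_mult_power_bound:
  fixes f \<theta> :: "complex \<Rightarrow> complex"
  assumes holf: "f holomorphic_on ball 0 1" and hol\<theta>: "\<theta> holomorphic_on ball 0 1"
    and B: "\<And>w. w \<in> ball 0 1 \<Longrightarrow> cmod (\<theta> w) \<le> B"
    and z: "z \<in> ball 0 1" and s: "0 < s" "cball z s \<subseteq> ball 0 1"
    and M: "\<And>w. w \<in> cball z s \<Longrightarrow> cmod (f w) \<le> M"
    and "j < m"
  shows "cmod ((deriv ^^ j) (\<lambda>w. f w * \<theta> w ^ m) z)
         \<le> fact j * (M * cmod (\<theta> z) * (real m * (2*B)^(m-1))) / s ^ j"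
proof -
  \<comment> \<open>Below order \<open>m\<close> this has the Taylor coefficients of
    \<open>f * \<theta> ^ m\<close> at \<open>z\<close>, but it is small when
    \<open>\<theta> z\<close> is.\<close>
  define g where "g = (\<lambda>w. f w * (\<theta> w ^ m - (\<theta> w - \<theta> z) ^ m))"
  have "0 \<le> B" using B[OF z] norm_ge_zero order_trans by blast
  have holg: "g holomorphic_on ball 0 1"
    unfolding g_def by (intro holomorphic_intros holf hol\<theta>)
  have holr: "(\<lambda>w. f w * (\<theta> w - \<theta> z) ^ m) holomorphic_on ball 0 1"
    by (intro holomorphic_intros holf hol\<theta>)
  have eq: "(\<lambda>w. f w * \<theta> w ^ m) = (\<lambda>w. g w + f w * (\<theta> w - \<theta> z) ^ m)"
    by (auto simp: g_def algebra_simps)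
  have "(deriv ^^ j) (\<lambda>w. f w * \<theta> w ^ m) z
      = (deriv ^^ j) g z + (deriv ^^ j) (\<lambda>w. f w * (\<theta> w - \<theta> z) ^ m) z"
    unfolding eq by (rule higher_deriv_add[OF holg holr]) (use z in auto)
  also have "(deriv ^^ j) (\<lambda>w. f w * (\<theta> w - \<theta> z) ^ m) z = 0"
    by (rule higher_deriv_mult_power_eq_0[of _ "ball 0 1"])
       (use z holf hol\<theta> \<open>j < m\<close> in \<open>auto intro!: holomorphic_intros\<close>)
  finally have 1: "(deriv ^^ j) (\<lambda>w. f w * \<theta> w ^ m) z = (deriv ^^ j) g z" by simp
  have bd: "cmod (g w) \<le> M * cmod (\<theta> z) * (real m * (2*B)^(m-1))" if w: "w \<in> cball z s" for w
  proof -
    have w1: "w \<in> ball 0 1" using s w by auto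
    have t1: "cmod (\<theta> w) \<le> 2*B" using B[OF w1] \<open>0 \<le> B\<close> by linarith
    have t2: "cmod (\<theta> w - \<theta> z) \<le> 2*B"
      using B[OF w1] B[OF z] norm_triangle_ineq4[of "\<theta> w" "\<theta> z"] by linarith
    \<comment> \<open>In the factorization of this difference of powers the first factor is exactly
      \<open>\<theta> z\<close>; each of the \<open>m\<close> summands in the other is a product of
      \<open>m - 1\<close> terms of modulus at most \<open>2*B\<close>.\<close>
    have "\<theta> w ^ m - (\<theta> w - \<theta> z) ^ m
        = (\<theta> w - (\<theta> w - \<theta> z)) * (\<Sum>i<m. (\<theta> w - \<theta> z)^(m - Suc i) * \<theta> w^i)"
      by (rule power_diff_sumr2)
    also have "cmod \<dots> = cmod (\<theta> z) * cmod (\<Sum>i<m. (\<theta> w - \<theta> z)^(m - Suc i) * \<theta> w^i)"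
      by (simp add: norm_mult)
    also have "\<dots> \<le> cmod (\<theta> z) * (\<Sum>i<m. (2*B)^(m-1))"
    proof (intro mult_left_mono order_trans[OF norm_sum] sum_mono)
      fix i assume i: "i \<in> {..<m}"
      have "cmod ((\<theta> w - \<theta> z)^(m - Suc i) * \<theta> w^i) \<le> (2*B)^(m - Suc i) * (2*B)^i"
        unfolding norm_mult norm_power by (intro mult_mono power_mono t1 t2) (use \<open>0 \<le> B\<close> in auto)
      also have "\<dots> = (2*B)^(m - Suc i + i)" by (rule power_add[symmetric])
      also have "m - Suc i + i = m - 1" using i by auto
      finally show "cmod ((\<theta> w - \<theta> z)^(m - Suc i) * \<theta> w^i) \<le> (2*B)^(m-1)" .
    qed auto
    finally have t3: "cmod (\<theta> w ^ m - (\<theta> w - \<theta> z) ^ m) \<le> cmod (\<theta> z) * (real m * (2*B)^(m-1))"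
      by simp
    have "cmod (g w) \<le> M * (cmod (\<theta> z) * (real m * (2*B)^(m-1)))"
      unfolding g_def norm_mult
      by (intro mult_mono M[OF w] t3) (use M[OF w] norm_ge_zero order_trans in \<open>blast, auto\<close>)
    then show ?thesis by (simp add: mult_ac)
  qed
  show ?thesis unfolding 1 by (rule Cauchy_bound_cball[OF holg s(2,1) bd])
qed

section \<open>From almost-everywhere bounds on the circle to bounds in the disc\<close>

lemma AE_imp_le_on_interval:
  fixes \<phi> \<psi> :: "real \<Rightarrow> real"
  assumes ae: "AE t in lebesgue_on {a..b}. \<phi> t \<le> \<psi> t" and "a < b"
    and c: "continuous_on {a..b} \<phi>" "continuous_on {a..b} \<psi>" and t: "t \<in> {a..b}"
  shows "\<phi> t \<le> \<psi> t"
proof -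
  \<comment> \<open>The violations inside the open interval form a set that is open by continuity
    and negligible by hypothesis, hence empty; the end points follow by closure.\<close>
  define T where "T = {t \<in> {a<..<b}. \<psi> t < \<phi> t}"
  have "AE t in lebesgue. t \<in> {a..b} \<longrightarrow> \<phi> t \<le> \<psi> t"
    using ae by (subst (asm) AE_restrict_space_iff) auto
  then have N: "negligible {t. \<not> (t \<in> {a..b} \<longrightarrow> \<phi> t \<le> \<psi> t)}"
    unfolding AE_lebesgue_iff_negligible .
  have "open T"
  proof -
    have "open ({a<..<b} \<inter> {x. 0 < (\<lambda>x. \<phi> x - \<psi> x) x})"
    proof -
      have "continuous_on {a<..<b} (\<lambda>x. \<phi> x - \<psi> x)"
        by (intro continuous_intros continuous_on_subset[OF c(1)] continuous_on_subset[OF c(2)]) auto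
      from continuous_open_preimage[OF this open_greaterThanLessThan open_greaterThan[of 0]]
      show ?thesis by (simp add: vimage_def Int_def)
    qed
    also have "{a<..<b} \<inter> {x. 0 < (\<lambda>x. \<phi> x - \<psi> x) x} = T" by (auto simp: T_def)
    finally show ?thesis .
  qed
  moreover have "negligible T" by (rule negligible_subset[OF N]) (auto simp: T_def)
  ultimately have "T = {}" using open_not_negligible by blast
  then have le: "\<phi> x - \<psi> x \<le> 0" if "x \<in> {a<..<b}" for x using that by (auto simp: T_def)
  have "\<phi> t - \<psi> t \<le> 0"
  proof (rule continuous_le_on_closure[of "{a<..<b}" "\<lambda>x. \<phi> x - \<psi> x"])
    show "continuous_on (closure {a<..<b}) (\<lambda>x. \<phi> x - \<psi> x)"
      using c \<open>a < b\<close> by (auto intro!: continuous_intros)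
  qed (use le t \<open>a < b\<close> in auto)
  then show ?thesis by simp
qed

lemma at_left_1_gt_0: "eventually (\<lambda>r::real. r \<in> {0<..<1}) (at_left 1)"
  by (rule eventually_at_left_real) simp

lemma of_real_cis_in_ball: "r \<in> {0<..<1} \<Longrightarrow> of_real r * cis t \<in> ball 0 1"
  by (auto simp: norm_mult)

lemma tendsto_of_real_cis: "((\<lambda>r::real. of_real r * cis t) \<longlongrightarrow> cis t) (at_left 1)"
  by (rule tendsto_eq_intros refl tendsto_of_real)+ simp

text \<open>The majorant \<open>q\<close> may depend on the ray and only its limit matters, because
  \<theta> is controlled on the circle through radial limits. The continuous extension
  \<open>F\<close> inherits the bound, first almost everywhere and then on the whole circle, and the
  maximum principle is applied to \<open>F w / (1 - cnj z * w) ^ K\<close>.\<close>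

lemma bound_by_radial_majorant:
  fixes f :: "complex \<Rightarrow> complex"
  assumes hol: "f holomorphic_on ball 0 1" and lip: "L-lipschitz_on (ball 0 1) f"
    and z: "z \<in> ball 0 1"
    and rad: "AE t in lebesgue_on {0..2*pi}. \<exists>q. (q \<longlongrightarrow> D * cmod (cis t - z) ^ K) (at_left 1) \<and>
        (\<forall>r\<in>{0<..<1}. cmod (f (of_real r * cis t)) \<le> q r)"
    and w: "w \<in> ball 0 1"
  shows "cmod (f w) \<le> D * cmod (1 - cnj z * w) ^ K"
proof -
  obtain F where F: "L-lipschitz_on (cball 0 1) F" "\<And>x. x \<in> ball 0 1 \<Longrightarrow> F x = f x"
    using lipschitz_extend_closure[OF lip] by auto
  have contF: "continuous_on (cball 0 1) F" using F(1) by (rule lipschitz_on_continuous_on)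
  have ae: "AE t in lebesgue_on {0..2*pi}. cmod (F (cis t)) \<le> D * cmod (cis t - z) ^ K"
    using rad
  proof eventually_elim
    case (elim t)
    then obtain q where q: "(q \<longlongrightarrow> D * cmod (cis t - z) ^ K) (at_left 1)"
       "\<And>r. r \<in>{0<..<1} \<Longrightarrow> cmod (f (of_real r * cis t)) \<le> q r" by blast
    have "((\<lambda>r::real. F (of_real r * cis t)) \<longlongrightarrow> F (cis t)) (at_left 1)"
    proof (rule continuous_on_tendsto_compose[OF contF tendsto_of_real_cis])
      show "\<forall>\<^sub>F r in at_left 1. complex_of_real r * cis t \<in> cball 0 1"
        using at_left_1_gt_0 by eventually_elim (auto simp: norm_mult)
    qed auto
    then have "((\<lambda>r::real. cmod (F (of_real r * cis t))) \<longlongrightarrow> cmod (F (cis t))) (at_left 1)"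
      by (rule tendsto_norm)
    then show ?case
    proof (rule tendsto_le[OF _ q(1), rotated])
      show "\<forall>\<^sub>F r in at_left 1. cmod (F (of_real r * cis t)) \<le> q r"
        using at_left_1_gt_0 by eventually_elim (use q(2) F(2) of_real_cis_in_ball in auto)
    qed simp
  qed
  have contc: "continuous_on {0..2*pi} (\<lambda>t. cmod (F (cis t)))"
    by (intro continuous_intros continuous_on_compose2[OF contF]) auto
  have circ: "cmod (F \<zeta>) \<le> D * cmod (\<zeta> - z) ^ K" if \<zeta>: "cmod \<zeta> = 1" for \<zeta>
  proof -
    obtain t where t: "t \<in> {0..2*pi}" "\<zeta> = cis t"
    proof -
      have "\<zeta> \<in> sphere 0 1" using \<zeta> by simp
      then obtain t where "0 \<le> t" "t < 2*pi" "\<zeta> = cis t"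
        by (metis that Arg2pi_ge_0 Arg2pi_lt_2pi \<zeta> Arg2pi_eq cis_conv_exp mult_1 of_real_1)
      then show ?thesis by (intro that[of t]) auto
    qed
    show ?thesis unfolding t(2)
      by (rule AE_imp_le_on_interval[OF ae _ contc _ t(1)]) (auto intro!: continuous_intros)
  qed
  have nz: "1 - cnj z * x \<noteq> 0" if "x \<in> cball 0 1" for x
    using one_minus_cnj_mult_neq_0[OF z that] .
  have "cmod (F w / (1 - cnj z * w) ^ K) \<le> D"
  proof (rule maximum_modulus_frontier[of "\<lambda>w. F w / (1 - cnj z * w) ^ K" "cball 0 1"])
    show "(\<lambda>w. F w / (1 - cnj z * w) ^ K) holomorphic_on interior (cball 0 1)"
    proof -
      have "F holomorphic_on ball 0 1" using hol F(2) holomorphic_transform by metis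
      then show ?thesis using nz by (auto intro!: holomorphic_intros)
    qed
    show "continuous_on (closure (cball 0 1)) (\<lambda>w. F w / (1 - cnj z * w) ^ K)"
      using nz contF by (auto intro!: continuous_intros)
    fix \<zeta> :: complex assume "\<zeta> \<in> frontier (cball 0 1)"
    then have \<zeta>: "cmod \<zeta> = 1" by simp
    have "1 - cnj z * \<zeta> = \<zeta> * (cnj (\<zeta> - z))"
      using complex_norm_square[of \<zeta>] \<zeta> by (simp add: algebra_simps)
    then have "cmod (1 - cnj z * \<zeta>) = cmod (\<zeta> - z)"
      by (metis \<zeta> complex_mod_cnj mult_1 norm_mult)
    moreover have "cmod (\<zeta> - z) > 0" using \<zeta> z by auto
    ultimately show "cmod (F \<zeta> / (1 - cnj z * \<zeta>) ^ K) \<le> D"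
      using circ[OF \<zeta>] by (auto simp: norm_divide norm_power divide_le_eq)
  qed (use w in auto)
  then show ?thesis using nz[of w] w F(2)[of w] by (simp add: norm_divide norm_power divide_le_eq)
qed

text \<open>The form of the remainder hypothesis covers both applications: with \<open>K = N\<close>
  the powers of \<open>1 - cmod z\<close> cancel, as for a bounded derivative of order
  \<open>N\<close>; with \<open>K = N + 1\<close> one factor \<open>1 / (1 - cmod z)\<close> is
  left, as for a Bloch function.\<close>

theorem decay_on_sublevel_set:
  fixes f \<theta> :: "complex \<Rightarrow> complex" and K m N :: nat and A :: real
  assumes holf: "f holomorphic_on ball 0 1" and lip: "L-lipschitz_on (ball 0 1) f"
    and hol\<theta>: "\<theta> holomorphic_on ball 0 1" and B: "\<And>w. w \<in> ball 0 1 \<Longrightarrow> cmod (\<theta> w) \<le> B"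
    and rad: "AE t in lebesgue_on {0..2*pi}.
        ((\<lambda>r::real. cmod (\<theta> (of_real r * cis t))) \<longlongrightarrow> 1) (at_left 1)"
    and "K \<le> m"
    and rem: "\<And>z w. z \<in> ball 0 1 \<Longrightarrow> w \<in> ball 0 1 \<Longrightarrow>
        cmod (f w * \<theta> w ^ m - (\<Sum>j<K. (deriv ^^ j) (\<lambda>w. f w * \<theta> w ^ m) z / fact j * (w - z) ^ j))
        \<le> A * (1 - cmod z) ^ N * (cmod (w - z) / (1 - cmod z)) ^ K"
  shows "\<exists>\<epsilon>. 0 < \<epsilon> \<and> \<epsilon> < 1 \<and> (\<exists>C. \<forall>z \<in> Omega \<theta> \<epsilon>. cmod (f z) \<le> C * (1 - cmod z) ^ N)"
proof -
  have "0 \<le> B" using order_trans[OF norm_ge_zero B[of 0]] by simp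
  \<comment> \<open>The factor \<open>m * (2*B)^(m-1)\<close> comes from the difference of powers,
    \<open>K\<close> counts the Taylor terms, and \<open>2^K\<close> absorbs the passage from radius
    \<open>d/2\<close> to \<open>d\<close>.\<close>
  define c1 where "c1 = real m * (2*B)^(m-1) * (real K * 2^K)"
  have "c1 \<ge> 0" using \<open>0 \<le> B\<close> by (simp add: c1_def)
  \<comment> \<open>Chosen so that the term carrying \<open>M\<close> is at most \<open>M/2\<close>.
    The \<open>3^K\<close> comes from \<open>cmod (1 - cnj z * w) \<le> 3 * d\<close> near
    \<open>z\<close>, and \<open>c1 + 1\<close> excludes a zero denominator.\<close>
  define \<epsilon> where "\<epsilon> = min (1/2) (1 / (2 * 3^K * (c1 + 1)))"
  have eps: "0 < \<epsilon>" "\<epsilon> < 1" using \<open>c1 \<ge> 0\<close> by (auto simp: \<epsilon>_def min_def)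
  have "\<epsilon> \<le> 1 / (2 * 3^K * (c1 + 1))" by (simp add: \<epsilon>_def)
  then have eps2: "3^K * (\<epsilon> * c1) \<le> 1/2"
  proof -
    assume "\<epsilon> \<le> 1 / (2 * 3^K * (c1 + 1))"
    then have "\<epsilon> * (2 * 3^K * (c1 + 1)) \<le> 1" using \<open>c1 \<ge> 0\<close> by (simp add: pos_le_divide_eq)
    moreover have "\<epsilon> * (2 * 3^K * c1) \<le> \<epsilon> * (2 * 3^K * (c1 + 1))"
      using eps \<open>c1 \<ge> 0\<close> by (intro mult_left_mono) auto
    moreover have "3^K * (\<epsilon> * c1) = (\<epsilon> * (2 * 3^K * c1)) / 2" by simp
    ultimately show ?thesis by linarith
  qed
  have "cmod (f z) \<le> 2 * 3^K * A * (1 - cmod z) ^ N" if zO: "z \<in> Omega \<theta> \<epsilon>" for z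
  proof -
    have z: "z \<in> ball 0 1" and th: "cmod (\<theta> z) < \<epsilon>" using zO by (auto simp: Omega_def)
    define d where "d = 1 - cmod z"
    have d: "0 < d" using z by (simp add: d_def)
    have sub: "cball z (d/2) \<subseteq> ball 0 1"
      by (rule cball_subset_unit_ball) (use d in \<open>simp add: d_def field_simps\<close>)
    have "continuous_on (cball z (d/2)) (\<lambda>w. cmod (f w))"
      using holomorphic_on_imp_continuous_on[OF holf] sub
      by (auto intro!: continuous_intros elim: continuous_on_subset)
    then obtain w0 where w0: "w0 \<in> cball z (d/2)" "\<And>w. w \<in> cball z (d/2) \<Longrightarrow> cmod (f w) \<le> cmod (f w0)"
      using continuous_attains_sup[OF compact_cball] d
      by (metis cball_eq_empty less_numeral_extra(1) linorder_not_less order_less_imp_le zero_less_divide_iff zero_less_numeral)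
    define M where "M = cmod (f w0)"
    have "M \<ge> 0" by (simp add: M_def)
    define g where "g = (\<lambda>w. f w * \<theta> w ^ m)"
    define c0 where "c0 = real m * (2*B)^(m-1)"
    have "c0 \<ge> 0" using \<open>0 \<le> B\<close> by (simp add: c0_def)
    have coeff: "cmod ((deriv ^^ j) g z / fact j) \<le> M * cmod (\<theta> z) * c0 * 2^K / d^j" if "j < K" for j
    proof -
      have "cmod ((deriv ^^ j) g z) \<le> fact j * (M * cmod (\<theta> z) * (real m * (2*B)^(m-1))) / (d/2)^j"
        unfolding g_def
        by (rule higher_deriv_mult_power_bound[OF holf hol\<theta> B z _ sub])
           (use d w0(2) that \<open>K \<le> m\<close> in \<open>auto simp: M_def\<close>)
      then have "cmod ((deriv ^^ j) g z / fact j) \<le> M * cmod (\<theta> z) * c0 / (d/2)^j"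
        by (simp add: norm_divide c0_def divide_le_eq mult_ac)
      also have "\<dots> = M * cmod (\<theta> z) * c0 * 2^j / d^j" by (simp add: power_divide)
      also have "\<dots> \<le> M * cmod (\<theta> z) * c0 * 2^K / d^j"
        using that \<open>M \<ge> 0\<close> \<open>c0 \<ge> 0\<close> d
        by (intro divide_right_mono mult_left_mono power_increasing) auto
      finally show ?thesis .
    qed
    \<comment> \<open>Taylor terms and remainder in the scale-free variable \<open>x/d\<close>. On
      the circle this variable is at least 1, so there its power \<open>K\<close> dominates all
      lower ones.\<close>
    define Q where "Q = (\<lambda>x. (\<Sum>j<K. M * cmod (\<theta> z) * c0 * 2^K * (x/d)^j) + A * d^N * (x/d)^K)"
    have gQ: "cmod (g w) \<le> Q (cmod (w - z))" if "w \<in> ball 0 1" for w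
    proof -
      have "cmod (g w) \<le> cmod (\<Sum>j<K. (deriv ^^ j) g z / fact j * (w - z) ^ j)
            + cmod (g w - (\<Sum>j<K. (deriv ^^ j) g z / fact j * (w - z) ^ j))"
        by (rule norm_triangle_sub)
      also have "cmod (g w - (\<Sum>j<K. (deriv ^^ j) g z / fact j * (w - z) ^ j)) \<le> A * d^N * (cmod (w - z)/d)^K"
        unfolding g_def d_def by (rule rem[OF z that])
      also have "cmod (\<Sum>j<K. (deriv ^^ j) g z / fact j * (w - z) ^ j)
           \<le> (\<Sum>j<K. M * cmod (\<theta> z) * c0 * 2^K * (cmod (w - z)/d)^j)"
      proof (intro order_trans[OF norm_sum] sum_mono)
        fix j assume "j \<in> {..<K}"
        then have "cmod ((deriv ^^ j) g z / fact j) * cmod (w-z)^j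
            \<le> M * cmod (\<theta> z) * c0 * 2^K / d^j * cmod (w-z)^j"
          by (intro mult_right_mono coeff) auto
        then show "cmod ((deriv ^^ j) g z / fact j * (w - z) ^ j)
           \<le> M * cmod (\<theta> z) * c0 * 2^K * (cmod (w - z)/d)^j"
          unfolding norm_mult[of _ "(w - z)^j"] norm_power power_divide by simp
      qed
      finally show ?thesis by (simp add: Q_def)
    qed
    define D where "D = (M * \<epsilon> * c1 + A * d^N) / d^K"
    have main: "cmod (f w) \<le> D * cmod (1 - cnj z * w) ^ K" if w: "w \<in> ball 0 1" for w
    proof (rule bound_by_radial_majorant[OF holf lip z _ w])
      show "AE t in lebesgue_on {0..2*pi}. \<exists>q. (q \<longlongrightarrow> D * cmod (cis t - z) ^ K) (at_left 1) \<and>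
        (\<forall>r\<in>{0<..<1}. cmod (f (of_real r * cis t)) \<le> q r)"
        using rad
      proof eventually_elim
        case (elim t)
        \<comment> \<open>Zeros of \<theta> forbid the division, so there \<open>q\<close> is
          \<open>cmod f\<close> itself; on this ray they stay away from the end, where the modulus
          tends to 1. The constant added in the other branch is nonnegative and raises the limit
          from \<open>Q\<close> to the required value.\<close>
        define q where "q = (\<lambda>r. if \<theta> (of_real r * cis t) = 0 then cmod (f (of_real r * cis t)) else
            Q (cmod (of_real r * cis t - z)) / cmod (\<theta> (of_real r * cis t)) ^ m
             + (D * cmod (cis t - z) ^ K - Q (cmod (cis t - z))))"
        have ge: "d \<le> cmod (cis t - z)"
          using norm_triangle_ineq2[of "cis t" z] by (simp add: d_def)
        have QD: "Q (cmod (cis t - z)) \<le> D * cmod (cis t - z) ^ K"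
        proof -
          define y where "y = cmod (cis t - z) / d"
          have y: "1 \<le> y" using ge d by (simp add: y_def)
          have "(\<Sum>j<K. M * cmod (\<theta> z) * c0 * 2^K * y^j) \<le> (\<Sum>j<K. M * \<epsilon> * c0 * 2^K * y^K)"
            using y th \<open>M \<ge> 0\<close> \<open>c0 \<ge> 0\<close> eps
            by (intro sum_mono mult_mono power_increasing) auto
          also have "\<dots> = M * \<epsilon> * c1 * y^K" by (simp add: c1_def c0_def)
          finally have "Q (cmod (cis t - z)) \<le> (M * \<epsilon> * c1 + A * d^N) * y^K"
            by (simp add: Q_def y_def algebra_simps)
          then show ?thesis by (simp add: D_def y_def power_divide)
        qed
        have "(q \<longlongrightarrow> D * cmod (cis t - z) ^ K) (at_left 1)"
        proof -
          have ev: "\<forall>\<^sub>F r in at_left 1. \<theta> (of_real r * cis t) \<noteq> 0"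
          proof -
            have "\<forall>\<^sub>F r in at_left 1. cmod (\<theta> (of_real r * cis t)) > 0"
              by (rule order_tendstoD(1)[OF elim]) simp
            then show ?thesis by eventually_elim auto
          qed
          have "((\<lambda>r. Q (cmod (of_real r * cis t - z)) / cmod (\<theta> (of_real r * cis t)) ^ m
             + (D * cmod (cis t - z) ^ K - Q (cmod (cis t - z)))) \<longlongrightarrow>
              Q (cmod (cis t - z)) / 1^m + (D * cmod (cis t - z) ^ K - Q (cmod (cis t - z)))) (at_left 1)"
            unfolding Q_def
            by (intro tendsto_intros elim tendsto_of_real_cis) (use d in auto)
          moreover have "\<forall>\<^sub>F r in at_left 1. Q (cmod (of_real r * cis t - z)) / cmod (\<theta> (of_real r * cis t)) ^ m
             + (D * cmod (cis t - z) ^ K - Q (cmod (cis t - z))) = q r"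
            using ev by eventually_elim (simp add: q_def)
          ultimately show ?thesis
            by (auto dest: Lim_transform_eventually)
        qed
        moreover have "cmod (f (of_real r * cis t)) \<le> q r" if r: "r \<in> {0<..<1}" for r
        proof (cases "\<theta> (of_real r * cis t) = 0")
          case False
          have "cmod (f (of_real r * cis t)) * cmod (\<theta> (of_real r * cis t)) ^ m \<le> Q (cmod (of_real r * cis t - z))"
            using gQ[OF of_real_cis_in_ball[OF r, of t]] by (simp add: g_def norm_mult norm_power)
          then have "cmod (f (of_real r * cis t)) \<le> Q (cmod (of_real r * cis t - z)) / cmod (\<theta> (of_real r * cis t)) ^ m"
            using False by (simp add: pos_le_divide_eq)
          then show ?thesis using False QD by (simp add: q_def)
        qed (simp add: q_def)
        ultimately show ?case by blast
      qed
    qed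
    \<comment> \<open>Here \<open>1 - (cmod z)^2 \<le> 2 * d\<close> and a displacement from
      \<open>z\<close> of at most \<open>d/2\<close> combine to the factor
      \<open>3 * d\<close>.\<close>
    have "M \<le> 3^K * (M * \<epsilon> * c1 + A * d^N)"
    proof -
      have w0b: "w0 \<in> ball 0 1" using w0(1) sub by auto
      have "1 - cnj z * w0 = (1 - cnj z * z) - cnj z * (w0 - z)" by (simp add: algebra_simps)
      then have "cmod (1 - cnj z * w0) \<le> cmod (1 - cnj z * z) + cmod (cnj z * (w0 - z))"
        by (metis norm_triangle_ineq4)
      also have "cmod (1 - cnj z * z) = 1 - (cmod z)^2"
      proof -
        have "1 - cnj z * z = of_real (1 - (cmod z)^2)"
          using complex_norm_square[of z] by (simp add: mult.commute)
        moreover have "0 \<le> 1 - (cmod z)^2" using z by (simp add: abs_square_le_1)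
        ultimately show ?thesis by (metis abs_of_nonneg norm_of_real)
      qed
      also have "1 - (cmod z)^2 \<le> 2 * d"
      proof -
        have "0 \<le> (1 - cmod z)^2" by simp
        then show ?thesis by (simp add: d_def power2_eq_square algebra_simps)
      qed
      also have "cmod (cnj z * (w0 - z)) \<le> 1 * (d/2)"
        unfolding norm_mult
        by (intro mult_mono) (use z w0(1) d in \<open>auto simp: dist_norm norm_minus_commute\<close>)
      finally have "cmod (1 - cnj z * w0) \<le> 3 * d" using d by simp
      then have le: "cmod (1 - cnj z * w0)^K \<le> (3*d)^K" by (rule power_mono) auto
      show ?thesis
      proof (cases "D \<ge> 0")
        case True
        have "M \<le> D * (3*d)^K"
          using main[OF w0b] mult_left_mono[OF le True] by (simp add: M_def)
        then show ?thesis using d by (simp add: D_def power_mult_distrib mult_ac)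
      next
        \<comment> \<open>\<open>A\<close> may be negative, hence so may \<open>D\<close>; but then
          the bound on \<open>cmod (f w0)\<close> would be strictly negative, a
          contradiction.\<close>
        case False
        then have "D * cmod (1 - cnj z * w0) ^ K \<le> 0" by (simp add: mult_nonpos_nonneg)
        then have "M = 0" using main[OF w0b] \<open>M \<ge> 0\<close> unfolding M_def by linarith
        then have "D * cmod (1 - cnj z * w0) ^ K = 0"
          using \<open>D * cmod (1 - cnj z * w0) ^ K \<le> 0\<close> main[OF w0b] by (simp add: M_def)
        moreover have "1 - cnj z * w0 \<noteq> 0"
        proof -
          have "cmod (cnj z * w0) \<le> 1 * cmod w0"
            unfolding norm_mult by (intro mult_right_mono) (use z in auto)
          then show ?thesis using w0b by auto
        qed
        ultimately show ?thesis using False by simp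
      qed
    qed
    also have "\<dots> = M * (3^K * (\<epsilon> * c1)) + 3^K * A * d^N" by (simp add: algebra_simps)
    also have "M * (3^K * (\<epsilon> * c1)) \<le> M * (1/2)" by (intro mult_left_mono eps2 \<open>M \<ge> 0\<close>)
    finally have "M \<le> 2 * 3^K * A * d^N" by simp
    moreover have "cmod (f z) \<le> M" unfolding M_def by (rule w0(2)) (use d in auto)
    ultimately show ?thesis by (simp add: d_def)
  qed
  then show ?thesis using eps by blast
qed

section \<open>Reflection of inner functions\<close>

text \<open>Reduction modulo \<open>2*pi\<close> covers the exceptional set by countably many
  translates of a negligible one. The shift \<open>t0\<close> serves to centre the parameter at the
  argument of a given point.\<close>

lemma AE_circle_imp_AE_line:
  assumes "AE t in lebesgue_on {0..2*pi}. P (cis t)"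
  shows "AE x in lebesgue. P (cis (t0 + x))"
proof -
  define N where "N = {t \<in> {0..2*pi}. \<not> P (cis t)}"
  have "AE t in lebesgue. t \<in> {0..2*pi} \<longrightarrow> P (cis t)"
    using assms by (subst (asm) AE_restrict_space_iff) auto
  then have N: "negligible N"
    unfolding AE_lebesgue_iff_negligible N_def by (simp add: Collect_conj_eq conj_ac)
  have "{x. \<not> P (cis (t0 + x))} \<subseteq> (\<Union>n::int. (+) (2*pi*n - t0) ` N)"
  proof
    fix x assume x: "x \<in> {x. \<not> P (cis (t0 + x))}"
    define n where "n = \<lfloor>(t0 + x) / (2*pi)\<rfloor>"
    define u where "u = t0 + x - 2*pi*n"
    have "cis u = cis (t0 + x) / cis (2*pi*n)" by (simp add: u_def flip: cis_divide)
    also have "cis (2*pi*n) = 1" by (rule cis_multiple_2pi) auto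
    finally have "\<not> P (cis u)" using x by simp
    moreover have "of_int n \<le> (t0 + x) / (2*pi)" "(t0 + x) / (2*pi) < of_int n + 1"
      unfolding n_def by linarith+
    then have "0 \<le> u" "u \<le> 2*pi" by (auto simp: u_def field_simps)
    ultimately have "u \<in> N" by (simp add: N_def)
    moreover have "x = (2*pi*n - t0) + u" by (simp add: u_def)
    ultimately show "x \<in> (\<Union>n::int. (+) (2*pi*n - t0) ` N)" by blast
  qed
  moreover have "negligible (\<Union>n::int. (+) (2*pi*n - t0) ` N)"
    by (rule negligible_countable_Union) (use N negligible_translation in auto)
  ultimately show ?thesis
    unfolding AE_lebesgue_iff_negligible using negligible_subset by blast
qed

text \<open>A primitive of \<open>G\<close> extends continuously to the real segment, where it matches a primitive of
  the reflected function up to a constant; pasting and differentiating gives the extension. This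
  way only almost-everywhere radial limits of \<open>cmod G\<close> are needed.\<close>

lemma reflection_extension:
  fixes G :: "complex \<Rightarrow> complex" and \<rho> \<epsilon> B :: real
  defines "U \<equiv> ball 0 \<rho> \<inter> {s. 0 < Im s}"
  assumes hol: "G holomorphic_on U" and "0 < \<epsilon>" and rho: "0 < \<rho>"
    and lo: "\<And>s. s \<in> U \<Longrightarrow> \<epsilon> \<le> cmod (G s)" and hi: "\<And>s. s \<in> U \<Longrightarrow> cmod (G s) \<le> B"
    and ae: "AE x in lebesgue. \<bar>x\<bar> < \<rho> \<longrightarrow> ((\<lambda>y. cmod (G (Complex x y))) \<longlongrightarrow> 1) (at_right 0)"
  shows "\<exists>E. E holomorphic_on ball 0 \<rho> \<and> (\<forall>s\<in>U. E s = G s) \<and>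
             (\<forall>s\<in>ball 0 \<rho>. cmod (E s) \<le> max B (1/\<epsilon>))"
proof -
  define C where "C = max B (1/\<epsilon>)"
  have "C > 0" using \<open>0 < \<epsilon>\<close> by (simp add: C_def less_max_iff_disj)
  define W where "W = ball 0 \<rho> \<inter> {s. Im s < 0}"
  \<comment> \<open>Schwarz reflection: conjugation in the variable, inversion in the unit circle in
    the value. The inversion fixes values of modulus 1, and the lower bound
    \<open>\<epsilon>\<close> on \<open>cmod G\<close> keeps the result bounded.\<close>
  define Gm where "Gm = (\<lambda>s. 1 / cnj (G (cnj s)))"
  have openU: "open U" and openW: "open W"
    unfolding U_def W_def by (auto intro!: open_halfspace_Im_gt open_halfspace_Im_lt)
  have convU: "convex U" and convW: "convex W"
    unfolding U_def W_def by (auto intro!: convex_Int convex_halfspace_Im_gt convex_halfspace_Im_lt)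
  have cnjW: "cnj s \<in> U" if "s \<in> W" for s using that by (auto simp: U_def W_def)
  have cnjU: "cnj s \<in> W" if "s \<in> U" for s using that by (auto simp: U_def W_def)
  have nzU: "G s \<noteq> 0" if "s \<in> U" for s using lo[OF that] \<open>0 < \<epsilon>\<close> by auto
  have "cnj \<circ> G \<circ> cnj holomorphic_on W"
  proof (rule holomorphic_on_compose_cnj_cnj[OF _ openW])
    show "G holomorphic_on cnj ` W" using hol cnjW holomorphic_on_subset by blast
  qed
  then have "(\<lambda>s. cnj (G (cnj s))) holomorphic_on W" by (simp add: o_def)
  then have holm: "Gm holomorphic_on W"
    unfolding Gm_def using nzU cnjW by (intro holomorphic_intros) auto
  have bU: "cmod (G s) \<le> C" if "s \<in> U" for s using hi[OF that] by (simp add: C_def)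
  have bW: "cmod (Gm s) \<le> C" if "s \<in> W" for s
  proof -
    have "cmod (Gm s) = 1 / cmod (G (cnj s))" by (simp add: Gm_def norm_divide)
    also have "\<dots> \<le> 1 / \<epsilon>" using lo[OF cnjW[OF that]] \<open>0 < \<epsilon>\<close> by (intro frac_le) auto
    finally show ?thesis by (simp add: C_def)
  qed
  \<comment> \<open>A bounded derivative on a convex set makes the primitive Lipschitz, so it
    extends continuously to the closure even if \<open>g\<close> does not.\<close>
  have prim: "\<exists>P F. (\<forall>x\<in>S. (P has_field_derivative g x) (at x)) \<and> C-lipschitz_on (closure S) F \<and> (\<forall>x\<in>S. F x = P x)"
    if S: "open S" "convex S" "g holomorphic_on S" "\<And>s. s \<in> S \<Longrightarrow> cmod (g s) \<le> C" for S g
  proof -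
    obtain P where P: "\<And>x. x \<in> S \<Longrightarrow> (P has_field_derivative g x) (at x)"
      using holomorphic_convex_primitive'[OF S(2,1,3)] S(1) at_within_open by metis
    have "C-lipschitz_on S P"
    proof (rule lipschitz_onI)
      fix x y assume "x \<in> S" "y \<in> S"
      then show "dist (P x) (P y) \<le> C * dist x y"
        unfolding dist_norm
        by (intro field_differentiable_bound[OF S(2) has_field_derivative_at_within[OF P]] S(4))
    qed (use \<open>C > 0\<close> in auto)
    from lipschitz_extend_closure[OF this] P show ?thesis by blast
  qed
  obtain Pp Fp where p: "\<And>x. x \<in> U \<Longrightarrow> (Pp has_field_derivative G x) (at x)"
      "C-lipschitz_on (closure U) Fp" "\<And>x. x \<in> U \<Longrightarrow> Fp x = Pp x"
    using prim[OF openU convU hol bU] by blast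
  obtain Pm Fm where m: "\<And>x. x \<in> W \<Longrightarrow> (Pm has_field_derivative Gm x) (at x)"
      "C-lipschitz_on (closure W) Fm" "\<And>x. x \<in> W \<Longrightarrow> Fm x = Pm x"
    using prim[OF openW convW holm bW] by blast
  have contFp: "continuous_on (closure U) Fp" and contFm: "continuous_on (closure W) Fm"
    using p(2) m(2) by (auto intro: lipschitz_on_continuous_on)
  have evU: "eventually (\<lambda>y. s + \<i> * of_real y \<in> U) (at_right 0)" if "s \<in> ball 0 \<rho>" "0 \<le> Im s" for s
  proof -
    have "((\<lambda>y. s + \<i> * of_real y) \<longlongrightarrow> s + \<i> * of_real 0) (at_right 0)" by (intro tendsto_intros)
    then have "eventually (\<lambda>y. s + \<i> * of_real y \<in> ball 0 \<rho>) (at_right 0)"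
      by (rule topological_tendstoD) (use that in auto)
    moreover have "eventually (\<lambda>y::real. 0 < y) (at_right 0)" by (simp add: eventually_at_right_less)
    ultimately show ?thesis
      by eventually_elim (use that in \<open>auto simp: U_def\<close>)
  qed
  have clU: "s \<in> closure U" if "s \<in> ball 0 \<rho>" "0 \<le> Im s" for s
  proof (rule Lim_in_closed_set[OF closed_closure])
    show "eventually (\<lambda>y. s + \<i> * of_real y \<in> closure U) (at_right 0)"
      using evU[OF that] by eventually_elim (use closure_subset[of U] in auto)
    show "((\<lambda>y. s + \<i> * of_real y) \<longlongrightarrow> s) (at_right 0)"
      by (rule tendsto_eq_intros refl)+ simp
  qed auto
  have clW: "s \<in> closure W" if "s \<in> ball 0 \<rho>" "Im s \<le> 0" for s
  proof (rule Lim_in_closed_set[OF closed_closure])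
    have "eventually (\<lambda>y. cnj s + \<i> * of_real y \<in> U) (at_right 0)" by (rule evU) (use that in auto)
    then show "eventually (\<lambda>y. cnj (cnj s + \<i> * of_real y) \<in> closure W) (at_right 0)"
      by eventually_elim (use cnjU closure_subset in blast)
    show "((\<lambda>y. cnj (cnj s + \<i> * of_real y)) \<longlongrightarrow> s) (at_right 0)"
      by (rule tendsto_eq_intros refl)+ simp
  qed auto
  \<comment> \<open>The increment of \<open>Fp - Fm\<close> over \<open>{x1..x2}\<close> is the
    limit of integrals of \<open>G - Gm\<close> taken along the horizontal segments at heights
    \<open>y n\<close> and \<open>- y n\<close>. The integrands are bounded and tend to 0 almost
    everywhere, so the limit is 0.\<close>
  have const: "Fp (of_real x2) - Fm (of_real x2) = Fp (of_real x1) - Fm (of_real x1)"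
    if x: "-\<rho> < x1" "x1 < x2" "x2 < \<rho>" for x1 x2 :: real
  proof -
    have "eventually (\<lambda>y. of_real x1 + \<i> * of_real y \<in> U \<and> of_real x2 + \<i> * of_real y \<in> U) (at_right 0)"
      by (intro eventually_conj evU) (use x in auto)
    then obtain y0 where y0: "0 < y0" "\<And>y. 0 < y \<Longrightarrow> y < y0 \<Longrightarrow>
        of_real x1 + \<i> * of_real y \<in> U \<and> of_real x2 + \<i> * of_real y \<in> U"
      unfolding eventually_at_right_field by auto
    define y where "y = (\<lambda>n::nat. y0 / real (n + 2))"
    have y: "0 < y n" "y n < y0" for n using y0(1) by (auto simp: y_def field_simps intro: add_pos_nonneg)
    have ylim: "y \<longlonglongrightarrow> 0" unfolding y_def by real_asymp
    have inU: "of_real x + \<i> * of_real (y n) \<in> U" if "x \<in> {x1..x2}" for x n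
    proof -
      have "of_real x + \<i> * of_real (y n) \<in> closed_segment (of_real x1 + \<i> * of_real (y n)) (of_real x2 + \<i> * of_real (y n))"
      proof -
        define u where "u = (x - x1) / (x2 - x1)"
        have u: "0 \<le> u" "u \<le> 1" using that x by (auto simp: u_def)
        have "u * (x2 - x1) = x - x1" using x by (simp add: u_def)
        then have xe: "x = (1 - u) * x1 + u * x2" by (simp add: algebra_simps)
        have "of_real x + \<i> * of_real (y n) = (1 - u) *\<^sub>R (of_real x1 + \<i> * of_real (y n)) + u *\<^sub>R (of_real x2 + \<i> * of_real (y n))"
          by (subst xe) (simp add: complex_eq_iff algebra_simps)
        then show ?thesis unfolding closed_segment_def using u by blast
      qed
      also have "\<dots> \<subseteq> U" by (intro closed_segment_subset convU) (use y0(2) y in auto)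
      finally show ?thesis .
    qed
    define k where "k = (\<lambda>n x. Pp (of_real x + \<i> * of_real (y n)) - Pm (of_real x - \<i> * of_real (y n)))"
    define D where "D = (\<lambda>n x. G (of_real x + \<i> * of_real (y n)) - Gm (of_real x - \<i> * of_real (y n)))"
    have inW: "of_real x - \<i> * of_real (y n) \<in> W" if "x \<in> {x1..x2}" for x n
      using cnjU[OF inU[OF that, of n]] by simp
    have Dint: "(D n has_integral (k n x2 - k n x1)) {x1..x2}" for n
    proof (rule fundamental_theorem_of_calculus)
      fix t assume t: "t \<in> {x1..x2}"
      have vdp: "((\<lambda>x. of_real x + \<i> * of_real (y n)) has_vector_derivative 1) (at t within {x1..x2})"
        and vdm: "((\<lambda>x. of_real x - \<i> * of_real (y n)) has_vector_derivative 1) (at t within {x1..x2})"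
        by (auto intro!: derivative_eq_intros)
      have "((\<lambda>x. Pp (of_real x + \<i> * of_real (y n))) has_vector_derivative 1 * G (of_real t + \<i> * of_real (y n)))
          (at t within {x1..x2})"
        using field_vector_diff_chain_within[OF vdp has_field_derivative_at_within[OF p(1)[OF inU[OF t]]]]
        by (simp add: o_def)
      moreover have "((\<lambda>x. Pm (of_real x - \<i> * of_real (y n))) has_vector_derivative 1 * Gm (of_real t - \<i> * of_real (y n)))
          (at t within {x1..x2})"
        using field_vector_diff_chain_within[OF vdm has_field_derivative_at_within[OF m(1)[OF inW[OF t]]]]
        by (simp add: o_def)
      ultimately show "(k n has_vector_derivative D n t) (at t within {x1..x2})"
        unfolding k_def D_def by (auto intro!: derivative_eq_intros)
    qed (use x in auto)
    define Z where "Z = {x. \<not> (\<bar>x\<bar> < \<rho> \<longrightarrow> ((\<lambda>y. cmod (G (Complex x y))) \<longlongrightarrow> 1) (at_right 0))}"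
    have negZ: "negligible Z" using ae unfolding AE_lebesgue_iff_negligible Z_def .
    \<comment> \<open>Dominated convergence is used with convergence at every point, so the
      integrand is replaced by 0 on the negligible set.\<close>
    define D' where "D' = (\<lambda>n x. if x \<in> Z then 0 else D n x)"
    have D': "(D' n has_integral (k n x2 - k n x1)) {x1..x2}" for n
      by (rule has_integral_spike[OF negZ _ Dint]) (simp add: D'_def)
    have "(\<lambda>n. integral {x1..x2} (D' n)) \<longlonglongrightarrow> integral {x1..x2} (\<lambda>_. 0)"
    proof (rule dominated_convergence(2)[of _ _ "\<lambda>_. C + C"])
      show "D' n integrable_on {x1..x2}" for n using D' by blast
      fix x n assume t: "x \<in> {x1..x2}"
      have "cmod (D n x) \<le> C + C"
        unfolding D_def by (intro norm_triangle_le_diff add_mono bU bW inU inW t)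
      then show "norm (D' n x) \<le> C + C" using \<open>C > 0\<close> by (auto simp: D'_def)
    next
      fix x assume t: "x \<in> {x1..x2}"
      show "(\<lambda>n. D' n x) \<longlonglongrightarrow> 0"
      proof (cases "x \<in> Z")
        case False
        then have lim: "((\<lambda>y. cmod (G (Complex x y))) \<longlongrightarrow> 1) (at_right 0)" using t x by (auto simp: Z_def)
        have "filterlim y (at_right 0) sequentially"
          using ylim y less_imp_neq[OF y(1), symmetric] by (auto simp: filterlim_at)
        then have "(\<lambda>n. cmod (G (Complex x (y n)))) \<longlonglongrightarrow> 1"
          by (rule filterlim_compose[OF lim])
        then have "(\<lambda>n. \<bar>cmod (G (Complex x (y n)))^2 - 1\<bar> / \<epsilon>) \<longlonglongrightarrow> \<bar>1^2 - 1\<bar> / \<epsilon>"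
          using \<open>0 < \<epsilon>\<close> by (intro tendsto_intros) auto
        then have lim2: "(\<lambda>n. \<bar>cmod (G (Complex x (y n)))^2 - 1\<bar> / \<epsilon>) \<longlonglongrightarrow> 0"
          by simp
        have "cmod (D n x) \<le> \<bar>cmod (G (Complex x (y n)))^2 - 1\<bar> / \<epsilon>" for n
        proof -
          have e: "complex_of_real x + \<i> * of_real (y n) = Complex x (y n)" by (simp add: complex_eq_iff)
          have e2: "cnj (complex_of_real x - \<i> * of_real (y n)) = Complex x (y n)" by (simp add: complex_eq_iff)
          define g where "g = G (Complex x (y n))"
          have gU: "Complex x (y n) \<in> U" using inU[OF t, of n] e by simp
          have "g \<noteq> 0" "\<epsilon> \<le> cmod g" using nzU[OF gU] lo[OF gU] by (auto simp: g_def)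
          \<comment> \<open>The difference \<open>g - 1 / cnj g\<close> has modulus
            \<open>\<bar>(cmod g)^2 - 1\<bar> / cmod g\<close>, so a limit of the modulus of
            \<open>G\<close>, without its phase, makes it tend to 0.\<close>
          have "D n x = g - 1 / cnj g" by (simp add: D_def Gm_def e e2 g_def)
          also have "\<dots> = (g * cnj g - 1) / cnj g" using \<open>g \<noteq> 0\<close> by (simp add: field_simps)
          also have "g * cnj g - 1 = of_real ((cmod g)^2 - 1)" using complex_norm_square[of g] by simp
          finally have "cmod (D n x) = \<bar>(cmod g)^2 - 1\<bar> / cmod g"
            by (simp only: norm_divide norm_of_real complex_mod_cnj)
          also have "\<dots> \<le> \<bar>(cmod g)^2 - 1\<bar> / \<epsilon>"
            using \<open>\<epsilon> \<le> cmod g\<close> \<open>0 < \<epsilon>\<close> by (intro frac_le) auto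
          finally show ?thesis by (simp add: g_def)
        qed
        then have "(\<lambda>n. D n x) \<longlonglongrightarrow> 0"
          by (intro Lim_null_comparison[OF _ lim2]) (auto intro: always_eventually)
        then show ?thesis using False by (simp add: D'_def)
      qed (simp add: D'_def)
    qed auto
    then have L1: "(\<lambda>n. k n x2 - k n x1) \<longlonglongrightarrow> 0" by (simp add: integral_unique[OF D'])
    have kl: "(\<lambda>n. k n x) \<longlonglongrightarrow> Fp (of_real x) - Fm (of_real x)" if t: "x \<in> {x1..x2}" for x
    proof -
      have "of_real x \<in> closure U" "of_real x \<in> closure W" by (rule clU clW; use t x in auto)+
      then have "(\<lambda>n. Fp (of_real x + \<i> * of_real (y n)) - Fm (of_real x - \<i> * of_real (y n)))
           \<longlonglongrightarrow> Fp (of_real x) - Fm (of_real x)"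
        by (intro tendsto_diff continuous_on_tendsto_compose[OF contFp] continuous_on_tendsto_compose[OF contFm])
           (use inU[OF t] inW[OF t] closure_subset in \<open>auto intro!: always_eventually tendsto_eq_intros ylim\<close>)
      moreover have "Fp (of_real x + \<i> * of_real (y n)) - Fm (of_real x - \<i> * of_real (y n)) = k n x" for n
        using p(3)[OF inU[OF t]] m(3)[OF inW[OF t]] by (simp add: k_def)
      ultimately show ?thesis by simp
    qed
    have "(\<lambda>n. k n x2 - k n x1) \<longlonglongrightarrow> (Fp (of_real x2) - Fm (of_real x2)) - (Fp (of_real x1) - Fm (of_real x1))"
      by (intro tendsto_diff kl) (use x in auto)
    from LIMSEQ_unique[OF this L1] show ?thesis by simp
  qed
  define J where "J = Fp 0 - Fm 0"
  have J: "Fm (of_real x) + J = Fp (of_real x)" if "-\<rho> < x" "x < \<rho>" for x :: real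
  proof -
    consider "x = 0" | "x < 0" | "0 < x" by linarith
    then have "Fp (of_real x) - Fm (of_real x) = J"
      unfolding J_def using const[of x 0] const[of 0 x] that rho by cases auto
    then show ?thesis by (simp add: algebra_simps)
  qed
  \<comment> \<open>The constant \<open>J\<close> makes the two primitives agree on the real
    segment. A continuous function holomorphic on both sides of a line is holomorphic across it, and
    its derivative is \<open>G\<close> above and \<open>Gm\<close> below.\<close>
  define H where "H = (\<lambda>s. if Im s \<le> 0 then Fm s + J else Fp s)"
  have contH: "continuous_on (ball 0 \<rho>) H"
    unfolding H_def
  proof (rule continuous_on_cases_le)
    show "continuous_on {x \<in> ball 0 \<rho>. Im x \<le> 0} (\<lambda>s. Fm s + J)"
      by (intro continuous_intros continuous_on_subset[OF contFm]) (use clW in auto)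
    show "continuous_on {x \<in> ball 0 \<rho>. 0 \<le> Im x} Fp"
      by (intro continuous_on_subset[OF contFp]) (use clU in auto)
    fix x assume x: "x \<in> ball 0 \<rho>" "Im x = 0"
    then have xe: "x = of_real (Re x)" by (simp add: complex_eq_iff)
    have "\<bar>Re x\<bar> < \<rho>" using x abs_Re_le_cmod[of x] by simp
    then show "Fm x + J = Fp x" using J[of "Re x"] xe by auto
  qed (auto intro!: continuous_intros)
  have HU: "(H has_field_derivative G s) (at s)" if "s \<in> U" for s
    by (rule has_field_derivative_transform_within_open[OF p(1)[OF that] openU that])
       (use p(3) in \<open>auto simp: H_def U_def\<close>)
  have HW: "(H has_field_derivative Gm s) (at s)" if "s \<in> W" for s
  proof -
    have "((\<lambda>s. Pm s + J) has_field_derivative Gm s) (at s)"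
      using DERIV_add[OF m(1)[OF that] DERIV_const[of J]] by simp
    then show ?thesis
      by (rule has_field_derivative_transform_within_open[OF _ openW that])
         (use m(3) in \<open>auto simp: H_def W_def\<close>)
  qed
  have holH: "H holomorphic_on ball 0 \<rho>"
  proof (rule holomorphic_on_paste_across_line[of "ball 0 \<rho>" "\<i>" _ 0])
    have "H holomorphic_on W" using HW openW by (auto simp: holomorphic_on_open)
    then show "H holomorphic_on ball 0 \<rho> \<inter> {z. \<i> \<bullet> z < 0}" by (simp add: W_def inner_complex_def)
    have "H holomorphic_on U" using HU openU by (auto simp: holomorphic_on_open)
    then show "H holomorphic_on ball 0 \<rho> \<inter> {z. 0 < \<i> \<bullet> z}" by (simp add: U_def inner_complex_def)
  qed (use contH in auto)
  define E where "E = deriv H"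
  have holE: "E holomorphic_on ball 0 \<rho>" unfolding E_def by (intro holomorphic_deriv holH) auto
  have EU: "E s = G s" if "s \<in> U" for s unfolding E_def by (rule DERIV_imp_deriv[OF HU[OF that]])
  have EW: "E s = Gm s" if "s \<in> W" for s unfolding E_def by (rule DERIV_imp_deriv[OF HW[OF that]])
  have "cmod (E s) \<le> C" if s: "s \<in> ball 0 \<rho>" for s
  proof (cases "Im s < 0")
    case True
    then have "s \<in> W" using s by (simp add: W_def)
    then show ?thesis using EW bW by simp
  next
    case False
    have "((\<lambda>y. E (s + \<i> * of_real y)) \<longlongrightarrow> E s) (at_right 0)"
    proof (rule continuous_on_tendsto_compose[OF holomorphic_on_imp_continuous_on[OF holE] _ s])
      show "((\<lambda>y. s + \<i> * of_real y) \<longlongrightarrow> s) (at_right 0)" by (rule tendsto_eq_intros refl)+ simp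
      show "\<forall>\<^sub>F y in at_right 0. s + \<i> * complex_of_real y \<in> ball 0 \<rho>"
        using evU[OF s] False by (auto elim!: eventually_mono simp: U_def)
    qed
    then show ?thesis
    proof (rule Lim_norm_ubound[rotated])
      show "\<forall>\<^sub>F y in at_right 0. norm (E (s + \<i> * complex_of_real y)) \<le> C"
        using evU[OF s] False EU bU by (auto elim!: eventually_mono)
    qed auto
  qed
  then show ?thesis using holE EU unfolding C_def by blast
qed

lemma norm_exp_minus_one_le:
  fixes x :: complex
  assumes "cmod x \<le> 1/2"
  shows "cmod (exp x - 1) \<le> 2 * cmod x"
proof -
  have "cmod (exp x - exp 0) \<le> 2 * cmod (x - 0)"
  proof (rule field_differentiable_bound[of "cball 0 (1/2)" exp exp])
    fix y :: complex assume y: "y \<in> cball 0 (1/2)"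
    have "cmod (exp y) \<le> exp (cmod y)" by (rule norm_exp)
    also have "\<dots> \<le> exp (1/2)" using y by simp
    also have "\<dots> \<le> 1 + 2 * (1/2)" using exp_bound_lemma[of "1/2::real"] by simp
    finally show "cmod (exp y) \<le> 2" by simp
  qed (use assms in \<open>auto intro: DERIV_exp has_field_derivative_at_within\<close>)
  then show ?thesis by simp
qed

text \<open>The map \<open>p\<close> sends the upper half of a small disc into the unit disc and
  real numbers to the circle, so the half-plane reflection applies; \<open>q\<close> inverts
  \<open>p\<close>. Radius \<open>d/4\<close> keeps \<open>p\<close> inside \<open>ball z d\<close>,
  as \<open>2 * (d/4) + d/64 < d\<close>. Radius \<open>d/16\<close> keeps \<open>q\<close> inside
  \<open>ball 0 (d/4)\<close>, as \<open>d/16 + d/64 < d/8\<close> and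
  \<open>cmod (Ln (1 + x)) \<le> 2 * cmod x\<close> for small \<open>x\<close>.\<close>

lemma extend_across_arc:
  fixes \<theta> :: "complex \<Rightarrow> complex"
  assumes hol: "\<theta> holomorphic_on ball 0 1" and B: "\<And>w. w \<in> ball 0 1 \<Longrightarrow> cmod (\<theta> w) \<le> B"
    and rad: "AE t in lebesgue_on {0..2*pi}.
        ((\<lambda>r::real. cmod (\<theta> (of_real r * cis t))) \<longlongrightarrow> 1) (at_left 1)"
    and "0 < \<epsilon>" and z: "z \<in> ball 0 1" and d: "0 < d" "d \<le> 1" "1 - cmod z < d / 64"
    and lo: "\<And>w. w \<in> ball z d \<Longrightarrow> w \<in> ball 0 1 \<Longrightarrow> \<epsilon> \<le> cmod (\<theta> w)"
  shows "\<exists>E. E holomorphic_on ball z (d/16) \<and> (\<forall>w\<in>ball z (d/16) \<inter> ball 0 1. E w = \<theta> w) \<and>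
             (\<forall>w\<in>ball z (d/16). cmod (E w) \<le> max B (1/\<epsilon>))"
proof -
  define \<rho> where "\<rho> = d/4"
  define U where "U = ball 0 \<rho> \<inter> {s. 0 < Im s}"
  define \<tau> where "\<tau> = Arg z"
  have ze: "z = of_real (cmod z) * cis \<tau>" by (simp add: \<tau>_def flip: rcis_def rcis_cmod_Arg)
  define p where "p = (\<lambda>s. cis \<tau> * exp (\<i> * s))"
  have pb: "p s \<in> ball z d" "p s \<in> ball 0 1" if "s \<in> U" for s
  proof -
    have s: "cmod s < d/4" "0 < Im s" using that by (auto simp: U_def \<rho>_def)
    have "p s - z = cis \<tau> * ((exp (\<i> * s) - 1) + of_real (1 - cmod z))"
      by (subst ze) (simp add: p_def algebra_simps)
    then have "cmod (p s - z) = cmod ((exp (\<i> * s) - 1) + of_real (1 - cmod z))"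
      by (simp only: norm_mult norm_cis mult_1)
    also have "\<dots> \<le> cmod (exp (\<i> * s) - 1) + cmod (of_real (1 - cmod z))" by (rule norm_triangle_ineq)
    also have "cmod (of_real (1 - cmod z)) = 1 - cmod z" using z by (simp only: norm_of_real) simp
    also have "cmod (exp (\<i> * s) - 1) \<le> 2 * cmod (\<i> * s)"
      by (rule norm_exp_minus_one_le) (use s d in \<open>auto simp: norm_mult\<close>)
    finally show "p s \<in> ball z d" using s d by (simp add: dist_norm norm_minus_commute norm_mult)
    show "p s \<in> ball 0 1" using s by (simp add: p_def norm_mult)
  qed
  define G where "G = (\<lambda>s. \<theta> (p s))"
  have "\<exists>E. E holomorphic_on ball 0 \<rho> \<and> (\<forall>s\<in>U. E s = G s) \<and> (\<forall>s\<in>ball 0 \<rho>. cmod (E s) \<le> max B (1/\<epsilon>))"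
  proof (rule reflection_extension[where \<rho>=\<rho> and G=G and B=B and \<epsilon>=\<epsilon>, folded U_def])
    have "p holomorphic_on U" unfolding p_def by (intro holomorphic_intros)
    then have "\<theta> \<circ> p holomorphic_on U"
      by (rule holomorphic_on_compose_gen[OF _ hol]) (use pb in auto)
    then show "G holomorphic_on U" by (simp add: G_def o_def)
    show "AE x in lebesgue. \<bar>x\<bar> < \<rho> \<longrightarrow> ((\<lambda>y. cmod (G (Complex x y))) \<longlongrightarrow> 1) (at_right 0)"
      using AE_circle_imp_AE_line[OF rad, of \<tau>]
    proof eventually_elim
      case (elim x)
      \<comment> \<open>Vertical approach to the real point \<open>x\<close> is radial approach to
        \<open>cis (\<tau> + x)\<close>, at radius \<open>exp (- y)\<close>.\<close>
      have "filterlim (\<lambda>y::real. exp (- y)) (at_left 1) (at_right 0)" by real_asymp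
      from filterlim_compose[OF elim this]
      have "((\<lambda>y. cmod (\<theta> (of_real (exp (- y)) * cis (\<tau> + x)))) \<longlongrightarrow> 1) (at_right 0)" .
      moreover have "of_real (exp (- y)) * cis (\<tau> + x) = p (Complex x y)" for y
        by (simp add: p_def exp_of_real[symmetric] cis_conv_exp Complex_eq exp_add[symmetric] algebra_simps)
      ultimately show ?case by (simp add: G_def)
    qed
  qed (use pb lo B d \<open>0 < \<epsilon>\<close> in \<open>auto simp: G_def \<rho>_def\<close>)
  then obtain E where E: "E holomorphic_on ball 0 \<rho>" "\<And>s. s \<in> U \<Longrightarrow> E s = G s"
      "\<And>s. s \<in> ball 0 \<rho> \<Longrightarrow> cmod (E s) \<le> max B (1/\<epsilon>)" by blast
  define q where "q = (\<lambda>w. - \<i> * Ln (w * cis (-\<tau>)))"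
  have small: "cmod (w * cis (-\<tau>) - 1) < d/8" if "w \<in> ball z (d/16)" for w
  proof -
    have "w * cis (-\<tau>) - 1 = (w - z) * cis (-\<tau>) - of_real (1 - cmod z)"
    proof -
      have "z * cis (-\<tau>) = of_real (cmod z)" by (subst ze) (simp add: mult.assoc cis_mult)
      then show ?thesis by (simp add: algebra_simps)
    qed
    then have "cmod (w * cis (-\<tau>) - 1) \<le> cmod ((w - z) * cis (-\<tau>)) + cmod (of_real (1 - cmod z))"
      by (metis norm_triangle_ineq4)
    also have "cmod (of_real (1 - cmod z)) = 1 - cmod z" using z by (simp only: norm_of_real) simp
    also have "cmod ((w - z) * cis (-\<tau>)) = cmod (w - z)" by (simp add: norm_mult)
    finally show ?thesis using that d by (simp add: dist_norm norm_minus_commute)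
  qed
  have nn: "w * cis (-\<tau>) \<notin> \<real>\<^sub>\<le>\<^sub>0" if "w \<in> ball z (d/16)" for w
  proof
    assume "w * cis (-\<tau>) \<in> \<real>\<^sub>\<le>\<^sub>0"
    then have "Re (w * cis (-\<tau>)) \<le> 0" by (auto simp: complex_nonpos_Reals_iff)
    then have "1 \<le> \<bar>Re (w * cis (-\<tau>) - 1)\<bar>" by simp
    also have "\<dots> \<le> cmod (w * cis (-\<tau>) - 1)" by (rule abs_Re_le_cmod)
    finally show False using small[OF that] d by simp
  qed
  have qb: "q w \<in> ball 0 \<rho>" if "w \<in> ball z (d/16)" for w
  proof -
    have "cmod (Ln (1 + (w * cis (-\<tau>) - 1))) \<le> 2 * cmod (w * cis (-\<tau>) - 1)"
      by (rule norm_Ln_le) (use small[OF that] d in linarith)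
    then show ?thesis using small[OF that] by (simp add: q_def norm_mult \<rho>_def)
  qed
  have pq: "p (q w) = w" if "w \<in> ball z (d/16)" for w
  proof -
    have "w * cis (-\<tau>) \<noteq> 0" using nn[OF that] by auto
    then have "p (q w) = cis \<tau> * (w * cis (-\<tau>))" by (simp add: p_def q_def flip: mult.assoc)
    also have "\<dots> = w * (cis \<tau> * cis (-\<tau>))" by (simp only: mult_ac)
    finally show ?thesis by (simp add: cis_mult)
  qed
  have "q holomorphic_on ball z (d/16)"
    unfolding q_def using nn by (intro holomorphic_intros) auto
  then have "E \<circ> q holomorphic_on ball z (d/16)"
    by (rule holomorphic_on_compose_gen[OF _ E(1)]) (use qb in auto)
  moreover have "(E \<circ> q) w = \<theta> w" if w: "w \<in> ball z (d/16)" "w \<in> ball 0 1" for w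
  proof -
    have "w * cis (-\<tau>) \<noteq> 0" using nn[OF w(1)] by auto
    then have "Im (q w) = - ln (cmod w)" by (simp add: q_def norm_mult)
    moreover have "w \<noteq> 0" using nn[OF w(1)] by auto
    ultimately have "0 < Im (q w)" using w(2) by simp
    then have "q w \<in> U" using qb[OF w(1)] by (simp add: U_def)
    then show ?thesis using E(2) pq[OF w(1)] by (simp add: G_def)
  qed
  ultimately show ?thesis using E(3) qb by (intro exI[of _ "E \<circ> q"]) auto
qed

text \<open>If \<open>z\<close> has distance at least \<open>d/64\<close> from the circle, Cauchy's
  estimate works inside the disc; otherwise it is applied to the extension across the arc. Both use
  radius \<open>d/128\<close>. The alternative \<open>1 - cmod z = d\<close> belongs to the first
  case, so in the second the lower bound for \<theta> is available.\<close>

lemma inner_iterated_deriv_bound: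
  fixes \<theta> :: "complex \<Rightarrow> complex"
  assumes hol: "\<theta> holomorphic_on ball 0 1" and B: "\<And>w. w \<in> ball 0 1 \<Longrightarrow> cmod (\<theta> w) \<le> B"
    and rad: "AE t in lebesgue_on {0..2*pi}.
        ((\<lambda>r::real. cmod (\<theta> (of_real r * cis t))) \<longlongrightarrow> 1) (at_left 1)"
    and "0 < \<epsilon>" and z: "z \<in> ball 0 1" and d: "0 < d" "d \<le> 1"
    and lo: "1 - cmod z = d \<or> (\<forall>w\<in>ball z d \<inter> ball 0 1. \<epsilon> \<le> cmod (\<theta> w))"
  shows "cmod ((deriv ^^ j) \<theta> z) \<le> fact j * max B (1/\<epsilon>) * 128 ^ j / d ^ j"
proof (cases "d / 64 \<le> 1 - cmod z")
  case True
  define s where "s = d / 128"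
  have "0 < s" using d by (simp add: s_def)
  have "cmod ((deriv ^^ j) \<theta> z) \<le> fact j * max B (1/\<epsilon>) / s ^ j"
  proof (rule Cauchy_bound_cball[OF hol _ \<open>0 < s\<close>])
    show sub: "cball z s \<subseteq> ball 0 1"
      by (rule cball_subset_unit_ball) (use True d in \<open>simp add: s_def field_simps\<close>)
    show "cmod (\<theta> x) \<le> max B (1/\<epsilon>)" if "x \<in> cball z s" for x
      using B[of x] sub that by auto
  qed
  then show ?thesis by (simp add: s_def power_divide)
next
  case False
  then have lt: "1 - cmod z < d / 64" by simp
  have "\<exists>E. E holomorphic_on ball z (d/16) \<and> (\<forall>w\<in>ball z (d/16) \<inter> ball 0 1. E w = \<theta> w) \<and>
             (\<forall>w\<in>ball z (d/16). cmod (E w) \<le> max B (1/\<epsilon>))"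
    by (rule extend_across_arc[OF hol B rad \<open>0 < \<epsilon>\<close> z d lt]) (use lo lt d in auto)
  then obtain E where E: "E holomorphic_on ball z (d/16)" "\<And>w. w\<in>ball z (d/16) \<Longrightarrow> w \<in> ball 0 1 \<Longrightarrow> E w = \<theta> w"
      "\<And>w. w\<in>ball z (d/16) \<Longrightarrow> cmod (E w) \<le> max B (1/\<epsilon>)" by blast
  have "(deriv ^^ j) E z = (deriv ^^ j) \<theta> z"
    by (rule higher_deriv_transform_within_open[of _ "ball z (d/16) \<inter> ball 0 1"])
       (use E z d hol in \<open>auto elim: holomorphic_on_subset\<close>)
  moreover have "cmod ((deriv ^^ j) E z) \<le> fact j * max B (1/\<epsilon>) / (d/128) ^ j"
    by (rule Cauchy_bound_cball[OF E(1)]) (use d in \<open>auto intro!: E(3)\<close>)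
  ultimately show ?thesis by (simp add: power_divide)
qed

section \<open>Products with inner functions\<close>

text \<open>Around a point of the smaller sublevel set, a disc of radius proportional to
  \<open>1 - cmod a\<close> stays in the larger one, because the derivative of \<theta> is
  \<open>O(1 / (1 - cmod a))\<close> there. Cauchy's estimate for \<open>f\<close> on this disc
  gives the decay of its derivatives.\<close>

lemma iterated_deriv_decay_on_sublevel:
  fixes f \<theta> :: "complex \<Rightarrow> complex"
  assumes holf: "f holomorphic_on ball 0 1" and hol: "\<theta> holomorphic_on ball 0 1"
    and B: "0 < B" "\<And>w. w \<in> ball 0 1 \<Longrightarrow> cmod (\<theta> w) \<le> B" and "0 < \<epsilon>"
    and dec: "\<And>z. z \<in> Omega \<theta> \<epsilon> \<Longrightarrow> cmod (f z) \<le> C * (1 - cmod z) ^ N"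
  shows "\<exists>C1\<ge>0. \<forall>a\<in>Omega \<theta> (\<epsilon>/2). \<forall>l\<le>N. cmod ((deriv ^^ l) f a) \<le> C1 * (1 - cmod a) ^ (N - l)"
proof -
  \<comment> \<open>The \<open>1/2\<close> keeps the disc in \<open>cball a (\<delta>/2)\<close>,
    where \<open>4 * B / \<delta>\<close> bounds the derivative of \<theta>; the other value lets
    \<theta> change by at most \<open>\<epsilon>/4\<close>.\<close>
  define c where "c = min (1/2) (\<epsilon> / (16 * B))"
  have c: "0 < c" "c \<le> 1/2" "4 * B * c \<le> \<epsilon> / 4"
    using \<open>0 < \<epsilon>\<close> B(1) by (auto simp: c_def min_def field_simps)
  define C1 where "C1 = (\<Sum>l\<le>N. fact l * \<bar>C\<bar> * 2 ^ N / c ^ l)"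
  have "cmod ((deriv ^^ l) f a) \<le> C1 * (1 - cmod a) ^ (N - l)"
    if a: "a \<in> Omega \<theta> (\<epsilon>/2)" and l: "l \<le> N" for a l
  proof -
    have a1: "a \<in> ball 0 1" "cmod (\<theta> a) < \<epsilon>/2" using a by (auto simp: Omega_def)
    define \<delta> where "\<delta> = 1 - cmod a"
    have \<delta>: "0 < \<delta>" using a1 by (simp add: \<delta>_def)
    have cd: "c * \<delta> \<le> \<delta> / 2" using c \<delta> by simp
    have bd: "cmod (f w) \<le> \<bar>C\<bar> * (2 * \<delta>) ^ N" if w: "w \<in> cball a (c * \<delta>)" for w
    proof -
      have wa: "cmod (w - a) \<le> c * \<delta>" using w by (simp add: dist_norm norm_minus_commute)
      have w2: "w \<in> cball a (\<delta>/2)" using w cd by auto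
      have sub: "cball a (\<delta>/2) \<subseteq> ball 0 1"
        by (rule cball_subset_unit_ball) (use \<delta> in \<open>simp add: \<delta>_def field_simps\<close>)
      have "cmod (\<theta> w - \<theta> a) \<le> (4 * B / \<delta>) * cmod (w - a)"
      proof (rule field_differentiable_bound[of "cball a (\<delta>/2)" \<theta> "deriv \<theta>"])
        fix x assume x: "x \<in> cball a (\<delta>/2)"
        show "(\<theta> has_field_derivative deriv \<theta> x) (at x within cball a (\<delta>/2))"
          using has_field_derivative_iterated_deriv[OF hol, of x 0] sub x by auto
        have "cball x (\<delta>/4) \<subseteq> ball 0 1"
        proof (rule cball_subset_unit_ball)
          have "cmod x \<le> cmod a + \<delta>/2"
            using x norm_triangle_sub[of x a] by (simp add: dist_norm norm_minus_commute)
          moreover have "cmod a = 1 - \<delta>" by (simp add: \<delta>_def)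
          ultimately show "cmod x + \<delta>/4 < 1" using \<delta> by simp
        qed
        then have "cmod ((deriv ^^ 1) \<theta> x) \<le> fact 1 * B / (\<delta>/4) ^ 1"
          by (intro Cauchy_bound_cball[OF hol]) (use \<delta> B(2) in auto)
        then show "cmod (deriv \<theta> x) \<le> 4 * B / \<delta>" by (simp add: mult.commute)
      qed (use w2 \<delta> in auto)
      also have "\<dots> \<le> (4 * B / \<delta>) * (c * \<delta>)" using wa B(1) \<delta> by (intro mult_left_mono) auto
      also have "\<dots> \<le> \<epsilon> / 4" using c(3) \<delta> by simp
      finally have "cmod (\<theta> w) < \<epsilon>"
        using norm_triangle_sub[of "\<theta> w" "\<theta> a"] a1(2) \<open>0 < \<epsilon>\<close> by linarith
      then have "cmod (f w) \<le> C * (1 - cmod w) ^ N"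
        using w2 sub by (intro dec) (auto simp: Omega_def)
      also have "\<dots> \<le> \<bar>C\<bar> * (2 * \<delta>) ^ N"
      proof (intro mult_mono power_mono)
        show "1 - cmod w \<le> 2 * \<delta>"

        proof -
          have "cmod (w - a) \<le> \<delta> / 2" using wa cd by linarith
          moreover have "cmod a = 1 - \<delta>" by (simp add: \<delta>_def)
          ultimately show ?thesis
            using norm_triangle_sub[of a w] \<delta> by (simp add: norm_minus_commute)
        qed
      qed (use w2 sub in auto)
      finally show ?thesis .
    qed
    have "cmod ((deriv ^^ l) f a) \<le> fact l * (\<bar>C\<bar> * (2 * \<delta>) ^ N) / (c * \<delta>) ^ l"
    proof (rule Cauchy_bound_cball[OF holf _ _ bd])
      show "cball a (c * \<delta>) \<subseteq> ball 0 1"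
        by (rule cball_subset_unit_ball) (use cd \<delta> in \<open>simp add: \<delta>_def field_simps\<close>)
    qed (use c \<delta> in auto)
    also have "\<dots> = (fact l * \<bar>C\<bar> * 2 ^ N / c ^ l) * \<delta> ^ (N - l)"
      using \<delta> c l by (simp add: power_mult_distrib power_diff)
    also have "\<dots> \<le> C1 * \<delta> ^ (N - l)"
      unfolding C1_def using \<delta> c l
      by (intro mult_right_mono member_le_sum[of l "{..N}" "\<lambda>l. fact l * \<bar>C\<bar> * 2 ^ N / c ^ l"]) auto
    finally show ?thesis by (simp add: \<delta>_def)
  qed
  moreover have "C1 \<ge> 0" unfolding C1_def using c by (intro sum_nonneg) auto
  ultimately show ?thesis by blast
qed

text \<open>Taylor expansion of \<open>(deriv ^^ l) f\<close> about a nearby point \<open>a\<close>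
  of the set, where \<open>1 - cmod a \<le> 3 * D\<close>: the term of order \<open>j\<close> is
  \<open>O(D ^ (N - l - j) * D ^ j)\<close> and the remainder \<open>O(D ^ (N - l))\<close>. At
  scale \<open>D = 1\<close> boundedness of the derivatives gives the claim.\<close>

lemma iterated_deriv_decay_near_sublevel:
  fixes f :: "complex \<Rightarrow> complex"
  assumes f: "f \<in> Hinf_N N" and "0 \<le> C1" and \<Omega>: "\<Omega> \<subseteq> ball 0 1"
    and dec: "\<And>a l. a \<in> \<Omega> \<Longrightarrow> l \<le> N \<Longrightarrow> cmod ((deriv ^^ l) f a) \<le> C1 * (1 - cmod a) ^ (N - l)"
  shows "\<exists>C2\<ge>0. \<forall>z\<in>ball 0 1. \<forall>D. 0 < D \<longrightarrow> D \<le> 1 \<longrightarrow> 1 - cmod z \<le> D \<longrightarrow>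
     (D = 1 \<or> (\<exists>a\<in>\<Omega>. cmod (z - a) \<le> 2 * D)) \<longrightarrow> (\<forall>l\<le>N. cmod ((deriv ^^ l) f z) \<le> C2 * D ^ (N - l))"
proof -
  have holf: "f holomorphic_on ball 0 1" using f by (simp add: Hinf_N_def Hinf_def)
  have "\<forall>l\<in>{..N}. \<exists>b. \<forall>z\<in>ball 0 1. cmod ((deriv ^^ l) f z) \<le> b"
    using iterated_deriv_in_Hinf[OF f] by (auto simp: Hinf_def bounded_iff)
  then obtain b where b: "\<And>l z. l \<le> N \<Longrightarrow> z \<in> ball 0 1 \<Longrightarrow> cmod ((deriv ^^ l) f z) \<le> b l"
    by (metis bchoice atMost_iff)
  define M where "M = (\<Sum>l\<le>N. \<bar>b l\<bar>)"
  have M: "cmod ((deriv ^^ l) f z) \<le> M" if "l \<le> N" "z \<in> ball 0 1" for l z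
  proof -
    have "\<bar>b l\<bar> \<le> M" unfolding M_def using that by (intro member_le_sum) auto
    then show ?thesis using b[OF that] by linarith
  qed
  have "M \<ge> 0" unfolding M_def by (intro sum_nonneg) auto
  define C2 where "C2 = real N * (C1 * 3 ^ N) + M * 2 ^ N"
  have "cmod ((deriv ^^ l) f z) \<le> C2 * D ^ (N - l)"
    if z: "z \<in> ball 0 1" and D: "0 < D" "D \<le> 1" "1 - cmod z \<le> D"
      "D = 1 \<or> (\<exists>a\<in>\<Omega>. cmod (z - a) \<le> 2 * D)" and l: "l \<le> N" for z D l
    using D(4)
  proof
    assume "D = 1"
    have "M * 1 \<le> M * 2 ^ N" using \<open>M \<ge> 0\<close> by (intro mult_left_mono) auto
    moreover have "0 \<le> real N * (C1 * 3 ^ N)" using \<open>0 \<le> C1\<close> by simp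
    ultimately have "M \<le> C2" unfolding C2_def by linarith
    then show ?thesis using M[OF l z] \<open>D = 1\<close> by simp
  next
    assume "\<exists>a\<in>\<Omega>. cmod (z - a) \<le> 2 * D"
    then obtain a where a: "a \<in> \<Omega>" "cmod (z - a) \<le> 2 * D" by blast
    have a1: "a \<in> ball 0 1" using a \<Omega> by auto
    define g where "g = (deriv ^^ l) f"
    have gj: "(deriv ^^ j) g = (deriv ^^ (l + j)) f" for j
      unfolding g_def by (metis add.commute comp_apply funpow_add)
    define S where "S = (\<Sum>j<N-l. (deriv ^^ j) g a / fact j * (z - a) ^ j)"
    have "cmod (g z - S) \<le> M * cmod (z - a) ^ (N - l)"
      unfolding S_def
    proof (rule taylor_remainder_bounded[OF _ _ a1 z])
      show "g holomorphic_on ball 0 1" unfolding g_def by (intro holomorphic_higher_deriv holf) auto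
      show "cmod ((deriv ^^ (N - l)) g z) \<le> M" if "z \<in> ball 0 1" for z
        unfolding gj using M[of N z] that l by simp
    qed
    also have "\<dots> \<le> M * (2 * D) ^ (N - l)" using a(2) \<open>M \<ge> 0\<close> by (intro mult_left_mono power_mono) auto
    also have "\<dots> = M * 2 ^ (N - l) * D ^ (N - l)" by (simp add: power_mult_distrib)
    also have "\<dots> \<le> M * 2 ^ N * D ^ (N - l)"
      using D \<open>M \<ge> 0\<close> by (intro mult_right_mono mult_left_mono power_increasing) auto
    finally have 1: "cmod (g z - S) \<le> M * 2 ^ N * D ^ (N - l)" .
    have "cmod S \<le> (\<Sum>j<N-l. C1 * 3 ^ N * D ^ (N - l))"
      unfolding S_def
    proof (intro order_trans[OF norm_sum] sum_mono)
      fix j assume j: "j \<in> {..<N-l}"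
      have "cmod ((deriv ^^ j) g a / fact j) \<le> cmod ((deriv ^^ j) g a) / 1"
        unfolding norm_divide norm_fact by (intro divide_left_mono fact_ge_1) auto
      also have "\<dots> \<le> C1 * (1 - cmod a) ^ (N - (l + j))"
        unfolding gj using dec[OF a(1), of "l + j"] j by simp
      also have "\<dots> \<le> C1 * (3 * D) ^ (N - (l + j))"
      proof (intro mult_left_mono power_mono)
        show "1 - cmod a \<le> 3 * D" using norm_triangle_sub[of z a] a(2) D(3) by linarith
      qed (use a1 \<open>0 \<le> C1\<close> in auto)
      finally have "cmod ((deriv ^^ j) g a / fact j * (z - a) ^ j) \<le> C1 * (3 * D) ^ (N - (l + j)) * (3 * D) ^ j"
        unfolding norm_mult norm_power using a(2) D \<open>0 \<le> C1\<close> by (intro mult_mono power_mono) auto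
      also have "\<dots> = C1 * (3 * D) ^ (N - (l + j) + j)" by (simp add: power_add)
      also have "N - (l + j) + j = N - l" using j by auto
      also have "C1 * (3 * D) ^ (N - l) = C1 * 3 ^ (N - l) * D ^ (N - l)" by (simp add: power_mult_distrib)
      also have "\<dots> \<le> C1 * 3 ^ N * D ^ (N - l)"
        using D \<open>0 \<le> C1\<close> by (intro mult_right_mono mult_left_mono power_increasing) auto
      finally show "cmod ((deriv ^^ j) g a / fact j * (z - a) ^ j) \<le> C1 * 3 ^ N * D ^ (N - l)" .
    qed
    also have "\<dots> = real (N - l) * (C1 * 3 ^ N * D ^ (N - l))" by simp
    also have "\<dots> \<le> real N * (C1 * 3 ^ N * D ^ (N - l))"
      using D \<open>0 \<le> C1\<close> by (intro mult_right_mono) auto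
    finally have 2: "cmod S \<le> real N * (C1 * 3 ^ N * D ^ (N - l))" .
    have "cmod (g z) \<le> cmod S + cmod (g z - S)" by (rule norm_triangle_sub)
    then show ?thesis using 1 2 by (simp add: g_def C2_def algebra_simps)
  qed
  moreover have "C2 \<ge> 0" using \<open>0 \<le> C1\<close> \<open>M \<ge> 0\<close> by (simp add: C2_def)
  ultimately show ?thesis by blast
qed

text \<open>Each alternative serves one factor of the product. The first yields derivatives of
  \<theta> of size \<open>1 / D ^ j\<close>, either well inside the disc or because \<theta> is
  bounded below on \<open>ball z D\<close>; the second makes those of \<open>f\<close> small. The
  scale is capped at 1, the value taken when the set is empty or far away.\<close>

lemma scale_at_distance:
  fixes z :: complex
  assumes z: "z \<in> ball 0 1"
  shows "\<exists>D. 0 < D \<and> D \<le> 1 \<and> 1 - cmod z \<le> D \<and>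
    (1 - cmod z = D \<or> (\<forall>w\<in>ball z D. w \<notin> \<Omega>)) \<and> (D = 1 \<or> (\<exists>a\<in>\<Omega>. cmod (z - a) \<le> 2 * D))"
proof (cases "\<Omega> = {} \<or> infdist z \<Omega> \<ge> 1")
  case True
  have "w \<notin> \<Omega>" if "w \<in> ball z 1" for w
    using True infdist_le[of w \<Omega> z] that by auto
  then show ?thesis by (intro exI[of _ 1]) auto
next
  case False
  then have ne: "\<Omega> \<noteq> {}" and lt: "infdist z \<Omega> < 1" by auto
  define D where "D = max (1 - cmod z) (infdist z \<Omega>)"
  have D: "0 < D" "D \<le> 1" using z lt by (auto simp: D_def)
  have "\<exists>a\<in>\<Omega>. dist z a < 2 * D"
  proof -
    have "infdist z \<Omega> \<le> D" by (simp add: D_def)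
    then have "(INF a\<in>\<Omega>. dist z a) < 2 * D"
      using D(1) by (simp flip: infdist_notempty[OF ne])
    then show ?thesis by (subst (asm) cINF_less_iff) (use ne in auto)
  qed
  then have "\<exists>a\<in>\<Omega>. cmod (z - a) \<le> 2 * D" by (auto simp: dist_norm intro: less_imp_le)
  moreover have "w \<notin> \<Omega>" if "w \<in> ball z D" "1 - cmod z \<noteq> D" for w
  proof -
    have "D = infdist z \<Omega>" using that(2) by (auto simp: D_def max_def split: if_splits)
    then show ?thesis using infdist_le[of w \<Omega> z] that(1) by auto
  qed
  moreover have "1 - cmod z \<le> D" by (simp add: D_def)
  ultimately show ?thesis using D by blast
qed

theorem decay_imp_mult_inner_in_Hinf_N:
  fixes f \<theta> :: "complex \<Rightarrow> complex"
  assumes f: "f \<in> Hinf_N N" and "inner_function \<theta>" and "0 < \<epsilon>"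
    and dec: "\<And>z. z \<in> Omega \<theta> \<epsilon> \<Longrightarrow> cmod (f z) \<le> C * (1 - cmod z) ^ N"
  shows "(\<lambda>z. f z * \<theta> z) \<in> Hinf_N N"
proof -
  have \<theta>: "\<theta> \<in> Hinf" and rad: "AE t in lebesgue_on {0..2*pi}.
        ((\<lambda>r::real. cmod (\<theta> (of_real r * cis t))) \<longlongrightarrow> 1) (at_left 1)"
    using \<open>inner_function \<theta>\<close> by (auto simp: inner_function_def)
  then have hol: "\<theta> holomorphic_on ball 0 1" by (simp add: Hinf_def)
  obtain B where B: "0 < B" "\<forall>w\<in>ball 0 1. cmod (\<theta> w) \<le> B"
    using \<theta> by (auto simp: Hinf_def bounded_pos)
  have fH: "f \<in> Hinf" and holf: "f holomorphic_on ball 0 1" using f by (auto simp: Hinf_N_def Hinf_def)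
  have "\<exists>C1\<ge>0. \<forall>a\<in>Omega \<theta> (\<epsilon>/2). \<forall>l\<le>N. cmod ((deriv ^^ l) f a) \<le> C1 * (1 - cmod a) ^ (N - l)"
    by (rule iterated_deriv_decay_on_sublevel[OF holf hol B(1) _ \<open>0 < \<epsilon>\<close> dec]) (use B in auto)
  then obtain C1 where C1: "0 \<le> C1"
      "\<And>a l. a\<in>Omega \<theta> (\<epsilon>/2) \<Longrightarrow> l\<le>N \<Longrightarrow> cmod ((deriv ^^ l) f a) \<le> C1 * (1 - cmod a) ^ (N - l)"
    by blast
  have "Omega \<theta> (\<epsilon>/2) \<subseteq> ball 0 1" by (auto simp: Omega_def)
  from iterated_deriv_decay_near_sublevel[OF f C1(1) this C1(2)]
  obtain C2 where C2: "0 \<le> C2" "\<And>z D l. z\<in>ball 0 1 \<Longrightarrow> 0 < D \<Longrightarrow> D \<le> 1 \<Longrightarrow> 1 - cmod z \<le> D \<Longrightarrow>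
     D = 1 \<or> (\<exists>a\<in>Omega \<theta> (\<epsilon>/2). cmod (z - a) \<le> 2 * D) \<Longrightarrow> l\<le>N \<Longrightarrow> cmod ((deriv ^^ l) f z) \<le> C2 * D ^ (N - l)"
    by blast
  \<comment> \<open>Half the threshold: the derivatives of \<open>f\<close> are controlled on
    \<open>Omega \<theta> (\<epsilon>/2)\<close>, and off this set \<open>\<epsilon>/2\<close> is
    the lower bound for \<theta>.\<close>
  define K where "K = max B (1 / (\<epsilon>/2))"
  have "0 < K" using B by (simp add: K_def less_max_iff_disj)
  have "(\<lambda>z. f z * \<theta> z) \<in> Hinf" by (rule Hinf_mult[OF fH \<theta>])
  moreover have "(deriv ^^ N) (\<lambda>z. f z * \<theta> z) \<in> Hinf"
  proof (rule HinfI)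
    show "(deriv ^^ N) (\<lambda>z. f z * \<theta> z) holomorphic_on ball 0 1"
      by (intro holomorphic_higher_deriv holomorphic_intros holf hol) auto
    fix z :: complex assume z: "z \<in> ball 0 1"
    obtain D where D: "0 < D" "D \<le> 1" "1 - cmod z \<le> D"
      "1 - cmod z = D \<or> (\<forall>w\<in>ball z D. w \<notin> Omega \<theta> (\<epsilon>/2))"
      "D = 1 \<or> (\<exists>a\<in>Omega \<theta> (\<epsilon>/2). cmod (z - a) \<le> 2 * D)"
      using scale_at_distance[OF z] by blast
    have th: "cmod ((deriv ^^ j) \<theta> z) \<le> fact j * K * 128 ^ j / D ^ j" for j
      unfolding K_def
      by (rule inner_iterated_deriv_bound[OF hol _ rad _ z D(1,2)])
         (use B \<open>0 < \<epsilon>\<close> D(4) in \<open>auto simp: Omega_def not_less\<close>)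
    have "(deriv ^^ N) (\<lambda>z. f z * \<theta> z) z =
       (\<Sum>i = 0..N. of_nat (N choose i) * (deriv ^^ i) f z * (deriv ^^ (N-i)) \<theta> z)"
      by (rule higher_deriv_mult[OF holf hol open_ball z])
    also have "cmod \<dots> \<le> (\<Sum>i = 0..N. real (N choose i) * C2 * (fact (N - i) * K * 128 ^ (N - i)))"
    proof (intro order_trans[OF norm_sum] sum_mono)
      fix i assume i: "i \<in> {0..N}"
      have "cmod (of_nat (N choose i) * (deriv ^^ i) f z * (deriv ^^ (N-i)) \<theta> z)
         \<le> real (N choose i) * (C2 * D ^ (N - i)) * (fact (N - i) * K * 128 ^ (N - i) / D ^ (N - i))"
        unfolding norm_mult norm_of_nat
        by (intro mult_mono th C2(2)[OF z D(1-3,5)]) (use i C2(1) D(1) in auto)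
      also have "\<dots> = real (N choose i) * C2 * (fact (N - i) * K * 128 ^ (N - i))"
        using D(1) by simp
      finally show "cmod (of_nat (N choose i) * (deriv ^^ i) f z * (deriv ^^ (N-i)) \<theta> z)
         \<le> real (N choose i) * C2 * (fact (N - i) * K * 128 ^ (N - i))" .
    qed
    finally show "cmod ((deriv ^^ N) (\<lambda>z. f z * \<theta> z) z)
       \<le> (\<Sum>i = 0..N. real (N choose i) * C2 * (fact (N - i) * K * 128 ^ (N - i)))" .
  qed
  ultimately show ?thesis by (simp add: Hinf_N_def)
qed

section \<open>Analytic functions on circles and their energy\<close>

lemma has_integral_period:
  fixes f :: "real \<Rightarrow> 'a::banach"
  assumes per: "\<And>t. f (t + 2*pi) = f t" and I: "(f has_integral I) {0..2*pi}"
  shows "(f has_integral I) {a..a + 2*pi}"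
proof -
  have pern: "f (t + 2*pi*real n) = f t" for t n
  proof (induction n)
    case (Suc n)
    have "f (t + 2*pi*real (Suc n)) = f ((t + 2*pi*real n) + 2*pi)" by (simp add: algebra_simps)
    then show ?case using per Suc by simp
  qed simp
  have peri: "f (t - 2*pi * of_int k) = f t" for t k
  proof (cases "k \<ge> 0")
    case True
    then show ?thesis using pern[of "t - 2*pi * of_int k" "nat k"] by simp
  next
    case False
    then show ?thesis using pern[of t "nat (-k)"] by simp
  qed
  \<comment> \<open>\<open>b\<close> is \<open>a\<close> reduced modulo the period. Cutting
    \<open>{0..2*pi}\<close> at \<open>b\<close> and moving the first piece one period to the right
    gives \<open>{b..b + 2*pi}\<close>.\<close>
  define n where "n = \<lfloor>a / (2*pi)\<rfloor>"
  define b where "b = a - 2*pi * of_int n"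
  have "of_int n \<le> a / (2*pi)" "a / (2*pi) < of_int n + 1" unfolding n_def by linarith+
  then have b: "0 \<le> b" "b \<le> 2*pi" by (auto simp: b_def field_simps)
  have int: "f integrable_on {0..2*pi}" using I by blast
  obtain i where i: "(f has_integral i) {0..b}"
    using integrable_on_subinterval[OF int, of 0 b] b by (auto simp: integrable_on_def)
  obtain j where j: "(f has_integral j) {b..2*pi}"
    using integrable_on_subinterval[OF int, of b "2*pi"] b by (auto simp: integrable_on_def)
  have ij: "i + j = I" using has_integral_combine[OF b i j] I has_integral_unique by blast
  have "((\<lambda>x. f (x - 2*pi)) has_integral i) {2*pi..b + 2*pi}"
    using has_integral_shift_real_ivl[OF i, of "-2*pi"] by simp
  then have "(f has_integral i) {2*pi..b + 2*pi}" using peri[of _ 1] by simp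
  from has_integral_combine[OF _ _ j this] b have "(f has_integral I) {b..b + 2*pi}"
    using ij by (simp add: add.commute)
  from has_integral_shift_real_ivl[OF this, of "-2*pi * of_int n"]
  have "((\<lambda>x. f (x - 2*pi * of_int n)) has_integral I) {a..a + 2*pi}"
    by (simp add: b_def algebra_simps)
  then show ?thesis using peri by simp
qed

text \<open>Cauchy's formula in the parameter \<open>t\<close>: order 0 gives values, order 1 the
  derivative, and \<open>w = 0\<close> the Taylor coefficients.\<close>

lemma Cauchy_circle:
  fixes h :: "complex \<Rightarrow> complex"
  assumes contf: "continuous_on (cball 0 r) h" and holf: "h holomorphic_on ball 0 r"
    and w: "w \<in> ball 0 r"
  shows "((\<lambda>t. h (of_real r * cis t) * (of_real r * cis t) / (of_real r * cis t - w) ^ Suc k)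
     has_integral (2*pi / fact k * (deriv ^^ k) h w)) {0..2*pi}"
proof -
  have "((\<lambda>u. h u / (u-w) ^ (Suc k)) has_contour_integral ((2 * pi * \<i>) / (fact k) * (deriv ^^ k) h w))
           (part_circlepath 0 r 0 (2*pi))"
    using Cauchy_has_contour_integral_higher_derivative_circlepath[OF contf holf w, of k]
    by (simp add: circlepath_def)
  then have "((\<lambda>t. h (0 + r * cis t) / ((0 + r * cis t) - w) ^ Suc k * r * \<i> * cis t) has_integral
      ((2 * pi * \<i>) / (fact k) * (deriv ^^ k) h w)) {0..2*pi}"
    by (subst (asm) has_contour_integral_part_circlepath_iff) auto
  from has_integral_mult_right[OF this, of "- \<i>"]
  show ?thesis by (simp add: mult_ac)
qed

lemma continuous_on_circle:
  fixes h :: "complex \<Rightarrow> complex"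
  assumes "h holomorphic_on ball 0 1" "0 \<le> r" "r < 1"
  shows "continuous_on A (\<lambda>t. h (of_real r * cis t))"
proof -
  have "continuous_on (ball 0 1) h" using assms(1) by (rule holomorphic_on_imp_continuous_on)
  then show ?thesis
    by (rule continuous_on_compose2) (use assms in \<open>auto intro!: continuous_intros simp: norm_mult\<close>)
qed

lemma mean_value_bound:
  fixes h :: "complex \<Rightarrow> complex"
  assumes hol: "h holomorphic_on ball 0 1" and r: "0 < r" "r < 1" and w: "cmod w < r"
  shows "cmod (h w) \<le> 1 / (r - cmod w) * integral {0..2*pi} (\<lambda>t. cmod (h (of_real r * cis t)))"
proof -
  have sub: "cball 0 r \<subseteq> ball 0 1" using r by auto
  have contf: "continuous_on (cball 0 r) h"
    using hol sub holomorphic_on_imp_continuous_on holomorphic_on_subset by blast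
  have "((\<lambda>t. h (of_real r * cis t) * (of_real r * cis t) / (of_real r * cis t - w) ^ Suc 0)
     has_integral (2*pi / fact 0 * (deriv ^^ 0) h w)) {0..2*pi}"
    by (rule Cauchy_circle[OF contf]) (use hol sub w ball_subset_cball in \<open>auto elim!: holomorphic_on_subset\<close>)
  then have I: "((\<lambda>t. h (of_real r * cis t) * (of_real r * cis t) / (of_real r * cis t - w))
     has_integral (2*pi * h w)) {0..2*pi}" by simp
  have cont: "continuous_on {0..2*pi} (\<lambda>t. cmod (h (of_real r * cis t)))"
    by (intro continuous_intros continuous_on_circle[OF hol]) (use r in auto)
  have "norm (2*pi * h w) \<le> integral {0..2*pi} (\<lambda>t. 1 / (r - cmod w) * cmod (h (of_real r * cis t)))"
    unfolding integral_unique[OF I, symmetric]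
  proof (rule integral_norm_bound_integral)
    show "(\<lambda>t. h (of_real r * cis t) * (of_real r * cis t) / (of_real r * cis t - w)) integrable_on {0..2*pi}"
      using I by blast
    show "(\<lambda>t. 1 / (r - cmod w) * cmod (h (of_real r * cis t))) integrable_on {0..2*pi}"
      by (intro integrable_continuous_real continuous_intros cont)
    fix t :: real
    have "r - cmod w \<le> cmod (of_real r * cis t - w)"
      using norm_triangle_ineq2[of "of_real r * cis t" w] r by (simp add: norm_mult)
    then have "1 / cmod (of_real r * cis t - w) \<le> 1 / (r - cmod w)" by (intro frac_le) (use w in auto)
    then have "(r * cmod (h (of_real r * cis t))) * (1 / cmod (of_real r * cis t - w))
       \<le> (1 * cmod (h (of_real r * cis t))) * (1 / (r - cmod w))"
      using r w by (intro mult_mono mult_right_mono) auto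
    then show "norm (h (of_real r * cis t) * (of_real r * cis t) / (of_real r * cis t - w))
         \<le> 1 / (r - cmod w) * cmod (h (of_real r * cis t))"
      using r by (simp add: norm_mult norm_divide mult_ac)
  qed
  also have "\<dots> = 1 / (r - cmod w) * integral {0..2*pi} (\<lambda>t. cmod (h (of_real r * cis t)))"
    by (rule integral_mult_right)
  finally have "2*pi * cmod (h w) \<le> 1 / (r - cmod w) * integral {0..2*pi} (\<lambda>t. cmod (h (of_real r * cis t)))"
    by (simp add: norm_mult)
  moreover have "1 * cmod (h w) \<le> 2*pi * cmod (h w)"
    using pi_gt3 by (intro mult_right_mono) auto
  ultimately show ?thesis by linarith
qed

lemma circle_coefficient:
  fixes u :: "complex \<Rightarrow> complex"
  assumes hol: "u holomorphic_on ball 0 1" and r: "0 < r" "r < 1"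
  shows "((\<lambda>t. u (of_real r * cis t) * cis (- (real n * t)))
     has_integral (2*pi * ((deriv ^^ n) u 0 / fact n) * of_real r ^ n)) {0..2*pi}"
proof -
  have sub: "cball 0 r \<subseteq> ball 0 1" using r by auto
  have contf: "continuous_on (cball 0 r) u"
    using hol sub holomorphic_on_imp_continuous_on holomorphic_on_subset by blast
  have I: "((\<lambda>t. u (of_real r * cis t) * (of_real r * cis t) / (of_real r * cis t - 0) ^ Suc n)
     has_integral (2*pi / fact n * (deriv ^^ n) u 0)) {0..2*pi}"
    by (rule Cauchy_circle[OF contf]) (use hol sub r ball_subset_cball in \<open>auto elim!: holomorphic_on_subset\<close>)
  have eq: "u (of_real r * cis t) * (of_real r * cis t) / (of_real r * cis t - 0) ^ Suc n * of_real r ^ n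
      = u (of_real r * cis t) * cis (- (real n * t))" for t
  proof -
    have "cis t ^ n = cis (real n * t)" by (rule Complex.DeMoivre)
    then show ?thesis using r by (simp add: power_mult_distrib field_simps flip: cis_inverse)
  qed
  from has_integral_mult_left[OF I, of "of_real r ^ n"] show ?thesis
    unfolding eq by (simp add: mult_ac)
qed

text \<open>Parseval's formula with two radii, so that differences of dilates can be measured. Only
  the conjugated factor is expanded; its series converges absolutely on the circle, so it may be
  integrated term by term, and each term picks out a Taylor coefficient of the other factor.\<close>

lemma circle_inner_product_sums:
  fixes u :: "complex \<Rightarrow> complex"
  assumes hol: "u holomorphic_on ball 0 1" and r: "0 < r" "r < 1" and s: "0 < s" "s < 1"
  shows "(\<lambda>n. of_real (2*pi * (cmod ((deriv ^^ n) u 0 / fact n))\<^sup>2 * (r * s) ^ n))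
     sums integral {0..2*pi} (\<lambda>t. u (of_real r * cis t) * cnj (u (of_real s * cis t)))"
proof -
  define a where "a = (\<lambda>n. (deriv ^^ n) u 0 / fact n)"
  have cu: "continuous_on {0..2*pi} (\<lambda>t. u (of_real r * cis t))"
    by (rule continuous_on_circle[OF hol]) (use r in auto)
  have ser: "(\<lambda>n. a n * (of_real s * cis t) ^ n) sums u (of_real s * cis t)" for t
    using holomorphic_power_series[OF hol, of "of_real s * cis t"] s by (simp add: a_def norm_mult)
  have abs: "summable (\<lambda>n. cmod (a n) * s ^ n)"
  proof -
    define s' where "s' = (s + 1) / 2"
    have s': "s < s'" "0 < s'" "s' < 1" using s by (auto simp: s'_def)
    have "summable (\<lambda>n. a n * of_real s' ^ n)"
      using holomorphic_power_series[OF hol, of "of_real s'"] s' by (auto simp: a_def sums_iff)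
    then have "summable (\<lambda>n. cmod (a n * of_real s ^ n))"
      by (rule powser_insidea) (use s s' in auto)
    then show ?thesis using s by (simp add: norm_mult norm_power)
  qed
  define S where "S = (\<Sum>n. cmod (a n) * s ^ n)"
  define P where "P = (\<lambda>N t. \<Sum>n<N. u (of_real r * cis t) * cnj (a n * (of_real s * cis t) ^ n))"
  have trm: "((\<lambda>t. u (of_real r * cis t) * cnj (a n * (of_real s * cis t) ^ n)) has_integral
      of_real (2*pi * (cmod (a n))\<^sup>2 * (r * s) ^ n)) {0..2*pi}" for n
  proof -
    have I: "((\<lambda>t. u (of_real r * cis t) * cis (- (real n * t)) * (cnj (a n) * of_real s ^ n)) has_integral
       (2*pi * a n * of_real r ^ n) * (cnj (a n) * of_real s ^ n)) {0..2*pi}"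
      using has_integral_mult_left[OF circle_coefficient[OF hol r, of n], of "cnj (a n) * of_real s ^ n"]
      by (simp only: a_def)
    have e1: "u (of_real r * cis t) * cis (- (real n * t)) * (cnj (a n) * of_real s ^ n)
       = u (of_real r * cis t) * cnj (a n * (of_real s * cis t) ^ n)" for t
      by (simp add: power_mult_distrib Complex.DeMoivre cis_cnj mult_ac)
    have e2: "(2*pi * a n * of_real r ^ n) * (cnj (a n) * of_real s ^ n) = of_real (2*pi * (cmod (a n))\<^sup>2 * (r * s) ^ n)"
    proof -
      have "complex_of_real (2*pi * (cmod (a n))\<^sup>2 * (r * s) ^ n)
          = of_real (2*pi) * of_real ((cmod (a n))\<^sup>2) * of_real ((r * s) ^ n)" by (simp only: of_real_mult)
      moreover have "complex_of_real ((cmod (a n))\<^sup>2) = a n * cnj (a n)" by (rule complex_norm_square)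
      ultimately show ?thesis by (simp only: of_real_power of_real_mult power_mult_distrib of_real_numeral) (simp add: mult_ac)
    qed
    show ?thesis using I unfolding e1 e2 .
  qed
  have Pint: "(P N has_integral (\<Sum>n<N. of_real (2*pi * (cmod (a n))\<^sup>2 * (r * s) ^ n))) {0..2*pi}" for N
    unfolding P_def by (rule has_integral_sum) (use trm in auto)
  have "(\<lambda>N. integral {0..2*pi} (P N)) \<longlonglongrightarrow> integral {0..2*pi} (\<lambda>t. u (of_real r * cis t) * cnj (u (of_real s * cis t)))"
  proof (rule dominated_convergence(2)[of _ _ "\<lambda>t. cmod (u (of_real r * cis t)) * S"])
    show "P N integrable_on {0..2*pi}" for N using Pint by blast
    show "(\<lambda>t. cmod (u (of_real r * cis t)) * S) integrable_on {0..2*pi}"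
      by (intro integrable_continuous_real continuous_intros cu)
    fix N and t :: real
    have "P N t = u (of_real r * cis t) * cnj (\<Sum>n<N. a n * (of_real s * cis t) ^ n)"
      by (simp add: P_def sum_distrib_left)
    moreover have "cmod (\<Sum>n<N. a n * (of_real s * cis t) ^ n) \<le> S"
    proof -
      have "cmod (\<Sum>n<N. a n * (of_real s * cis t) ^ n) \<le> (\<Sum>n<N. cmod (a n) * s ^ n)"
        by (rule order_trans[OF norm_sum]) (use s in \<open>simp add: norm_mult norm_power\<close>)
      also have "\<dots> \<le> S" unfolding S_def by (rule sum_le_suminf[OF abs]) (use s in auto)
      finally show ?thesis .
    qed
    ultimately show "norm (P N t) \<le> cmod (u (of_real r * cis t)) * S"
      by (simp only: norm_mult complex_mod_cnj) (simp add: mult_left_mono)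
  next
    fix t :: real
    have "(\<lambda>N. u (of_real r * cis t) * cnj (\<Sum>n<N. a n * (of_real s * cis t) ^ n)) \<longlonglongrightarrow> u (of_real r * cis t) * cnj (u (of_real s * cis t))"
      using ser[of t] unfolding sums_def by (intro tendsto_intros)
    then show "(\<lambda>N. P N t) \<longlonglongrightarrow> u (of_real r * cis t) * cnj (u (of_real s * cis t))"
      by (simp add: P_def sum_distrib_left)
  qed
  then show ?thesis unfolding sums_def integral_unique[OF Pint] by (simp add: a_def)
qed

text \<open>\<open>energy u x\<close> is the squared \<open>L\<^sup>2\<close> norm of \<open>u\<close> on the circle of radius \<open>sqrt x\<close>.\<close>

definition energy :: "(complex \<Rightarrow> complex) \<Rightarrow> real \<Rightarrow> real"
  where "energy u x = (\<Sum>n. 2*pi * (cmod ((deriv ^^ n) u 0 / fact n))\<^sup>2 * x ^ n)"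

lemma energy_summable:
  fixes u :: "complex \<Rightarrow> complex"
  assumes hol: "u holomorphic_on ball 0 1" and x: "0 < x" "x < 1"
  shows "summable (\<lambda>n. 2*pi * (cmod ((deriv ^^ n) u 0 / fact n))\<^sup>2 * x ^ n)"
proof -
  have "0 < sqrt x" "sqrt x < 1" using x by auto
  from sums_summable[OF circle_inner_product_sums[OF hol this this]]
  have "summable (\<lambda>n. 2*pi * (cmod ((deriv ^^ n) u 0 / fact n))\<^sup>2 * (sqrt x * sqrt x) ^ n)"
    by (simp only: summable_complex_of_real)
  then show ?thesis using x by simp
qed

lemma circle_inner_product:
  fixes u :: "complex \<Rightarrow> complex"
  assumes hol: "u holomorphic_on ball 0 1" and r: "0 < r" "r < 1" and s: "0 < s" "s < 1"
  shows "integral {0..2*pi} (\<lambda>t. u (of_real r * cis t) * cnj (u (of_real s * cis t))) = of_real (energy u (r * s))"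
proof -
  have "0 < r * s" "r * s < 1"
    using r s by (auto simp: mult_less_le_imp_less[of r 1 s 1, simplified])
  from energy_summable[OF hol this]
  have "(\<lambda>n. of_real (2*pi * (cmod ((deriv ^^ n) u 0 / fact n))\<^sup>2 * (r * s) ^ n)) sums complex_of_real (energy u (r * s))"
    unfolding energy_def by (intro sums_of_real summable_sums)
  with circle_inner_product_sums[OF assms] show ?thesis using sums_unique2 by blast
qed

lemma integral_norm_square_circle:
  fixes u :: "complex \<Rightarrow> complex"
  assumes hol: "u holomorphic_on ball 0 1" and r: "0 < r" "r < 1"
  shows "((\<lambda>t. (cmod (u (of_real r * cis t)))\<^sup>2) has_integral energy u (r\<^sup>2)) {0..2*pi}"
proof -
  have "continuous_on {0..2*pi} (\<lambda>t. (cmod (u (of_real r * cis t)))\<^sup>2)"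
    by (intro continuous_intros continuous_on_circle[OF hol]) (use r in auto)
  then have "((\<lambda>t. (cmod (u (of_real r * cis t)))\<^sup>2) has_integral
        integral {0..2*pi} (\<lambda>t. (cmod (u (of_real r * cis t)))\<^sup>2)) {0..2*pi}"
    using integrable_continuous_real by blast
  then have "((\<lambda>t. complex_of_real ((cmod (u (of_real r * cis t)))\<^sup>2)) has_integral
        of_real (integral {0..2*pi} (\<lambda>t. (cmod (u (of_real r * cis t)))\<^sup>2))) {0..2*pi}"
    by (rule has_integral_of_real)
  then have "complex_of_real (integral {0..2*pi} (\<lambda>t. (cmod (u (of_real r * cis t)))\<^sup>2)) = of_real (energy u (r * r))"
    using circle_inner_product[OF hol r r] by (simp add: complex_norm_square integral_unique del: of_real_power)
  then show ?thesis
    using \<open>((\<lambda>t. (cmod (u (of_real r * cis t)))\<^sup>2) has_integral _) _\<close> by (simp add: power2_eq_square)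
qed

lemma energy_mono:
  assumes hol: "u holomorphic_on ball 0 1" and "0 < x" "x \<le> y" "y < 1"
  shows "energy u x \<le> energy u y"
  unfolding energy_def
  by (rule suminf_le) (use assms energy_summable[OF hol] in \<open>auto intro!: mult_left_mono power_mono\<close>)

lemma integral_norm_square_diff_circle:
  fixes u :: "complex \<Rightarrow> complex"
  assumes hol: "u holomorphic_on ball 0 1" and r: "0 < r" "r < 1" and s: "0 < s" "s < 1"
  shows "((\<lambda>t. (cmod (u (of_real r * cis t) - u (of_real s * cis t)))\<^sup>2) has_integral
      energy u (r\<^sup>2) + energy u (s\<^sup>2) - 2 * energy u (r * s)) {0..2*pi}"
proof -
  have "continuous_on {0..2*pi} (\<lambda>t. u (of_real r * cis t) * cnj (u (of_real s * cis t)))"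
    by (intro continuous_intros continuous_on_circle[OF hol]) (use r s in auto)
  then have "((\<lambda>t. u (of_real r * cis t) * cnj (u (of_real s * cis t))) has_integral of_real (energy u (r * s))) {0..2*pi}"
    using integrable_continuous_real circle_inner_product[OF assms] by (metis integrable_integral)
  from has_integral_linear[OF this bounded_linear_Re]
  have I: "((\<lambda>t. Re (u (of_real r * cis t) * cnj (u (of_real s * cis t)))) has_integral energy u (r * s)) {0..2*pi}"
    by (simp add: o_def)
  have eq: "(cmod (p - q))\<^sup>2 = (cmod p)\<^sup>2 + (cmod q)\<^sup>2 - 2 * Re (p * cnj q)" for p q
    by (simp only: cmod_power2) (simp add: power2_eq_square algebra_simps)
  show ?thesis unfolding eq
    by (intro has_integral_diff has_integral_add has_integral_mult_right I
         integral_norm_square_circle[OF hol] r s)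
qed

text \<open>The energy increases to its supremum \<open>L\<close>. Once it exceeds
  \<open>L - e/2\<close>, the expression for the squared difference is at most
  \<open>L + L - 2 * (L - e/2) = e\<close>.\<close>

lemma energy_bounded_imp_L2_Cauchy:
  fixes u :: "complex \<Rightarrow> complex"
  assumes hol: "u holomorphic_on ball 0 1" and C: "\<And>x. 0 < x \<Longrightarrow> x < 1 \<Longrightarrow> energy u x \<le> C" and "0 < e"
  shows "\<exists>r0. 0 < r0 \<and> r0 < 1 \<and> (\<forall>r s. r0 < r \<longrightarrow> r < 1 \<longrightarrow> r0 < s \<longrightarrow> s < 1 \<longrightarrow>
     integral {0..2*pi} (\<lambda>t. (cmod (u (of_real r * cis t) - u (of_real s * cis t)))\<^sup>2) \<le> e)"
proof -
  define L where "L = (SUP x\<in>{0<..<1::real}. energy u x)"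
  have bdd: "bdd_above (energy u ` {0<..<1})" by (rule bdd_aboveI[of _ C]) (use C in auto)
  have le: "energy u x \<le> L" if "0 < x" "x < 1" for x
    unfolding L_def by (rule cSUP_upper[OF _ bdd]) (use that in auto)
  have "\<exists>x\<in>{0<..<1}. L - e/2 < energy u x"
    unfolding L_def[symmetric] using \<open>0 < e\<close>
    by (subst less_cSUP_iff[OF _ bdd, symmetric]) (auto simp: L_def)
  then obtain x0 where x0: "0 < x0" "x0 < 1" "L - e/2 < energy u x0" by auto
  define r0 where "r0 = sqrt x0"
  have r0: "0 < r0" "r0 < 1" "r0 * r0 = x0" using x0 by (auto simp: r0_def)
  have "integral {0..2*pi} (\<lambda>t. (cmod (u (of_real r * cis t) - u (of_real s * cis t)))\<^sup>2) \<le> e"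
    if r: "r0 < r" "r < 1" and s: "r0 < s" "s < 1" for r s
  proof -
    have pos: "0 < r" "0 < s" using r s r0 by auto
    have lt: "r\<^sup>2 < 1" "s\<^sup>2 < 1" "r * s < 1"
      using pos r s mult_strict_mono[of r 1 s 1] by (auto simp: power_less_one_iff)
    have "x0 \<le> r * s" using mult_mono[of r0 r r0 s] r s r0 by simp
    then have "L - e/2 < energy u (r * s)" using x0 energy_mono[OF hol x0(1) _ lt(3)] by fastforce
    moreover have "energy u (r\<^sup>2) \<le> L" "energy u (s\<^sup>2) \<le> L" by (rule le; use pos lt in auto)+
    ultimately show ?thesis
      unfolding integral_unique[OF integral_norm_square_diff_circle[OF hol pos(1) r(2) pos(2) s(2)]] by linarith
  qed
  then show ?thesis using r0 by blast
qed

section \<open>Factorization in the Hardy space\<close>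

text \<open>The zeros of \<open>p\<close> in the open disc are collected in a finite Blaschke product \<open>B\<close>.\<close>

lemma polynomial_Blaschke_factorization:
  fixes p :: "complex poly"
  assumes "p \<noteq> 0"
  shows "\<exists>B q. B holomorphic_on ball 0 1 \<and> (\<forall>z\<in>ball 0 1. cmod (B z) \<le> 1) \<and>
    (\<forall>z\<in>ball 0 1. poly p z = B z * poly q z) \<and> (\<forall>z\<in>ball 0 1. poly q z \<noteq> 0) \<and>
    (\<forall>z. cmod z = 1 \<longrightarrow> cmod (poly q z) = cmod (poly p z))"
  using assms
proof (induction "degree p" arbitrary: p rule: less_induct)
  case less
  show ?case
  proof (cases "degree p = 0")
    case True
    then obtain c where "p = [:c:]" by (rule degree_eq_zeroE)
    then show ?thesis using less.prems by (intro exI[of _ "\<lambda>_. 1"] exI[of _ p]) auto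
  next
    case False
    then obtain a where a: "poly p a = 0"
      using Fundamental_Theorem_Algebra.fundamental_theorem_of_algebra[of p] by (auto simp: constant_degree)
    then obtain p' where p': "p = [:-a, 1:] * p'" by (auto simp: poly_eq_0_iff_dvd elim: dvdE)
    have "p' \<noteq> 0" using p' less.prems by auto
    then have "degree p' < degree p" unfolding p' by (subst degree_mult_eq) auto
    from less.hyps[OF this \<open>p' \<noteq> 0\<close>] obtain B q where Bq:
      "B holomorphic_on ball 0 1" "\<And>z. z\<in>ball 0 1 \<Longrightarrow> cmod (B z) \<le> 1"
      "\<And>z. z\<in>ball 0 1 \<Longrightarrow> poly p' z = B z * poly q z" "\<And>z. z\<in>ball 0 1 \<Longrightarrow> poly q z \<noteq> 0"
      "\<And>z. cmod z = 1 \<Longrightarrow> cmod (poly q z) = cmod (poly p' z)" by blast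
    have pz: "poly p z = (z - a) * poly p' z" for z by (simp add: p' algebra_simps)
    show ?thesis
    proof (cases "a \<in> ball 0 1")
      \<comment> \<open>A root in the open disc moves into the Blaschke factor
        \<open>(z - a) / (1 - cnj a * z)\<close>. It leaves \<open>1 - cnj a * z\<close> in
        \<open>q\<close>, which is zero-free in the disc and has the modulus of \<open>z - a\<close>
        on the circle.\<close>
      case True
      have nz: "1 - cnj a * z \<noteq> 0" if "z \<in> ball 0 1" for z
      proof -
        have "cmod (cnj a * z) \<le> 1 * cmod z" unfolding norm_mult using True by (intro mult_right_mono) auto
        then show ?thesis using that by auto
      qed
      have pq: "poly ([:1, - cnj a:] * q) z = (1 - cnj a * z) * poly q z" for z by (simp add: algebra_simps)
      define B' where "B' = (\<lambda>z. B z * ((z - a) / (1 - cnj a * z)))"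
      have "B' holomorphic_on ball 0 1" unfolding B'_def using nz by (intro holomorphic_intros Bq) auto
      moreover have "cmod (B' z) \<le> 1" if z: "z \<in> ball 0 1" for z
      proof -
        have "cmod (z - a) \<le> cmod (1 - cnj a * z)"
        proof (rule power2_le_imp_le)
          have "(cmod (1 - cnj a * z))\<^sup>2 - (cmod (z - a))\<^sup>2 = (1 - (cmod a)\<^sup>2) * (1 - (cmod z)\<^sup>2)"
            by (simp only: cmod_power2) (simp add: power2_eq_square algebra_simps)
          also have "\<dots> \<ge> 0" using True z by (intro mult_nonneg_nonneg) (auto simp: abs_square_le_1)
          finally show "(cmod (z - a))\<^sup>2 \<le> (cmod (1 - cnj a * z))\<^sup>2" by simp
        qed auto
        then have "cmod ((z - a) / (1 - cnj a * z)) \<le> 1"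
          using nz[OF z] by (simp add: norm_divide divide_le_eq)
        then have "cmod (B z) * cmod ((z - a) / (1 - cnj a * z)) \<le> 1 * 1"
          by (intro mult_mono Bq(2)[OF z]) auto
        then show ?thesis by (simp only: B'_def norm_mult)
      qed
      moreover have "poly p z = B' z * poly ([:1, - cnj a:] * q) z" if z: "z \<in> ball 0 1" for z
        unfolding pq B'_def pz Bq(3)[OF z] using nz[OF z] by (simp add: mult_ac)
      moreover have "poly ([:1, - cnj a:] * q) z \<noteq> 0" if z: "z \<in> ball 0 1" for z
        unfolding pq using nz[OF z] Bq(4)[OF z] by simp
      moreover have "cmod (poly ([:1, - cnj a:] * q) z) = cmod (poly p z)" if z: "cmod z = 1" for z
      proof -
        have "1 - cnj a * z = z * cnj (z - a)"
          using complex_norm_square[of z] z by (simp add: algebra_simps)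
        then have "cmod (1 - cnj a * z) = cmod (z - a)" by (metis z complex_mod_cnj mult_1 norm_mult)
        then show ?thesis unfolding pq pz norm_mult using Bq(5)[OF z] by simp
      qed
      ultimately show ?thesis by blast
    next
      \<comment> \<open>A root outside the open disc, possibly on the circle, stays in
        \<open>q\<close>, which has to be zero-free only in the open disc.\<close>
      case False
      have pq: "poly ([:-a, 1:] * q) z = (z - a) * poly q z" for z by (simp add: algebra_simps)
      have "poly p z = B z * poly ([:-a, 1:] * q) z" if "z \<in> ball 0 1" for z
        using Bq(3)[OF that] by (simp add: pz algebra_simps)
      moreover have "poly ([:-a, 1:] * q) z \<noteq> 0" if "z \<in> ball 0 1" for z
        using Bq(4)[OF that] False that by auto
      moreover have "cmod (poly ([:-a, 1:] * q) z) = cmod (poly p z)" if "cmod z = 1" for z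
        unfolding pq pz norm_mult using Bq(5)[OF that] by simp
      ultimately show ?thesis using Bq(1,2) by blast
    qed
  qed
qed

text \<open>The zero-free factor \<open>q\<close> has a holomorphic square root \<open>s\<close>;
  the factors are \<open>B * s\<close> and \<open>s\<close>. As \<open>s\<close> lives only in the
  open disc, its increasing energy is compared with the integral of \<open>cmod p\<close> over the
  circle by letting the radius tend to 1 in the integral of \<open>cmod q\<close>, which equals
  \<open>(cmod s)^2\<close> inside.\<close>

lemma polynomial_H2_factorization:
  fixes p :: "complex poly"
  assumes le: "integral {0..2*pi} (\<lambda>t. cmod (poly p (cis t))) \<le> C"
  shows "\<exists>u v. u holomorphic_on ball 0 1 \<and> v holomorphic_on ball 0 1 \<and>
     (\<forall>z\<in>ball 0 1. poly p z = u z * v z) \<and>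
     (\<forall>r\<in>{0<..<1}. integral {0..2*pi} (\<lambda>t. (cmod (u (of_real r * cis t)))\<^sup>2) \<le> C) \<and>
     (\<forall>r\<in>{0<..<1}. integral {0..2*pi} (\<lambda>t. (cmod (v (of_real r * cis t)))\<^sup>2) \<le> C)"
proof (cases "p = 0")
  case True
  then show ?thesis using le by (intro exI[of _ "\<lambda>_. 0"]) auto
next
  case False
  then obtain B q where Bq:
      "B holomorphic_on ball 0 1" "\<And>z. z\<in>ball 0 1 \<Longrightarrow> cmod (B z) \<le> 1"
      "\<And>z. z\<in>ball 0 1 \<Longrightarrow> poly p z = B z * poly q z" "\<And>z. z\<in>ball 0 1 \<Longrightarrow> poly q z \<noteq> 0"
      "\<And>z. cmod z = 1 \<Longrightarrow> cmod (poly q z) = cmod (poly p z)"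
    using polynomial_Blaschke_factorization by blast
  have "poly q holomorphic_on ball 0 1" by (intro holomorphic_intros)
  then obtain s where s: "s holomorphic_on ball 0 1" "\<And>z. z \<in> ball 0 1 \<Longrightarrow> poly q z = s z ^ 2"
    using contractible_imp_holomorphic_sqrt[of "poly q" "ball 0 1"] Bq(4)
    by (metis convex_ball convex_imp_contractible)
  have sq: "(cmod (s (of_real r * cis t)))\<^sup>2 = cmod (poly q (of_real r * cis t))" if "0 < r" "r < 1" for r t
    using s(2)[of "of_real r * cis t"] that by (simp add: norm_mult norm_power)
  have contI: "continuous_on {0..1} (\<lambda>r. integral (cbox 0 (2*pi)) (\<lambda>t. cmod (poly q (of_real r * cis t))))"
    by (rule integral_continuous_on_param) (auto simp: case_prod_unfold intro!: continuous_intros)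
  have sb: "integral {0..2*pi} (\<lambda>t. (cmod (s (of_real r * cis t)))\<^sup>2) \<le> C" if r: "r \<in> {0<..<1}" for r
  proof -
    have "energy s (r\<^sup>2) \<le> integral {0..2*pi} (\<lambda>t. cmod (poly q (cis t)))"
    proof (rule tendsto_lowerbound)
      have "((\<lambda>\<rho>. integral (cbox 0 (2*pi)) (\<lambda>t. cmod (poly q (of_real \<rho> * cis t)))) \<longlongrightarrow>
         integral (cbox 0 (2*pi)) (\<lambda>t. cmod (poly q (of_real 1 * cis t)))) (at 1 within {0..1})"
        by (rule continuous_on_def[THEN iffD1, rule_format, OF contI]) simp
      then show "((\<lambda>\<rho>. integral {0..2*pi} (\<lambda>t. cmod (poly q (of_real \<rho> * cis t)))) \<longlongrightarrow>
         integral {0..2*pi} (\<lambda>t. cmod (poly q (cis t)))) (at_left 1)"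
        by (simp add: at_within_Icc_at_left)
      have "eventually (\<lambda>\<rho>. \<rho> \<in> {r<..<1}) (at_left 1)" by (rule eventually_at_left_real) (use r in auto)
      then show "\<forall>\<^sub>F \<rho> in at_left 1. energy s (r\<^sup>2) \<le> integral {0..2*pi} (\<lambda>t. cmod (poly q (of_real \<rho> * cis t)))"
      proof eventually_elim
        case (elim \<rho>)
        then have \<rho>: "0 < \<rho>" "\<rho> < 1" "r < \<rho>" using r by auto
        have "energy s (r\<^sup>2) \<le> energy s (\<rho>\<^sup>2)"
          by (rule energy_mono[OF s(1)]) (use r \<rho> in \<open>auto simp: power_less_one_iff intro!: power_mono\<close>)
        also have "\<dots> = integral {0..2*pi} (\<lambda>t. (cmod (s (of_real \<rho> * cis t)))\<^sup>2)"
          by (rule integral_unique[OF integral_norm_square_circle[OF s(1) \<rho>(1,2)], symmetric])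
        finally show ?case using sq[OF \<rho>(1,2)] by simp
      qed
    qed simp
    also have "\<dots> = integral {0..2*pi} (\<lambda>t. cmod (poly p (cis t)))" by (simp add: Bq(5))
    also have "\<dots> \<le> C" by (rule le)
    also have "energy s (r\<^sup>2) = integral {0..2*pi} (\<lambda>t. (cmod (s (of_real r * cis t)))\<^sup>2)"
      by (rule integral_unique[OF integral_norm_square_circle[OF s(1)], symmetric]) (use r in auto)
    finally show ?thesis .
  qed
  define u where "u = (\<lambda>z. B z * s z)"
  have holu: "u holomorphic_on ball 0 1" unfolding u_def by (intro holomorphic_intros Bq s)
  have "integral {0..2*pi} (\<lambda>t. (cmod (u (of_real r * cis t)))\<^sup>2) \<le> C" if r: "r \<in> {0<..<1}" for r
  proof -
    have "integral {0..2*pi} (\<lambda>t. (cmod (u (of_real r * cis t)))\<^sup>2) \<le> integral {0..2*pi} (\<lambda>t. (cmod (s (of_real r * cis t)))\<^sup>2)"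
    proof (rule integral_le)
      show "(\<lambda>t. (cmod (u (of_real r * cis t)))\<^sup>2) integrable_on {0..2*pi}"
           "(\<lambda>t. (cmod (s (of_real r * cis t)))\<^sup>2) integrable_on {0..2*pi}"
        using integral_norm_square_circle[OF holu, of r] integral_norm_square_circle[OF s(1), of r] r by auto
      fix t :: real
      have "cmod (B (of_real r * cis t)) * cmod (s (of_real r * cis t)) \<le> 1 * cmod (s (of_real r * cis t))"
        by (intro mult_right_mono Bq(2)) (use r in \<open>auto simp: norm_mult\<close>)
      then show "(cmod (u (of_real r * cis t)))\<^sup>2 \<le> (cmod (s (of_real r * cis t)))\<^sup>2"
        by (intro power_mono) (auto simp: u_def norm_mult)
    qed
    then show ?thesis using sb[OF r] by linarith
  qed
  moreover have "poly p z = u z * s z" if "z \<in> ball 0 1" for z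
    using Bq(3)[OF that] s(2)[OF that] by (simp add: u_def power2_eq_square)
  ultimately show ?thesis using holu s(1) sb by blast
qed

text \<open>Gives the locally uniform bounds for Montel's theorem. The mean value estimate is
  applied to \<open>u ^ 2\<close>, and \<open>x \<le> 1 + x^2\<close> stands in for a square
  root.\<close>

lemma L2_bound_imp_pointwise:
  fixes u :: "complex \<Rightarrow> complex"
  assumes hol: "u holomorphic_on ball 0 1"
    and C: "\<And>r. r\<in>{0<..<1} \<Longrightarrow> integral {0..2*pi} (\<lambda>t. (cmod (u (of_real r * cis t)))\<^sup>2) \<le> C"
    and z: "cmod z \<le> k" and k: "0 \<le> k" "k < 1"
  shows "cmod (u z) \<le> 1 + 2 * \<bar>C\<bar> / (1 - k)"
proof -
  define r where "r = (1 + k) / 2"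
  have r: "0 < r" "r < 1" "k < r" "r - k = (1 - k) / 2" using k by (auto simp: r_def field_simps)
  have "(\<lambda>z. u z ^ 2) holomorphic_on ball 0 1" by (intro holomorphic_intros hol)
  from mean_value_bound[OF this r(1,2)] z r
  have "cmod (u z ^ 2) \<le> 1 / (r - cmod z) * integral {0..2*pi} (\<lambda>t. (cmod (u (of_real r * cis t)))\<^sup>2)"
    by (simp add: norm_power)
  also have "\<dots> \<le> 1 / (r - cmod z) * \<bar>C\<bar>"
    using C[of r] r z by (intro mult_left_mono) auto
  also have "\<dots> \<le> 1 / ((1 - k) / 2) * \<bar>C\<bar>"
    using r z k by (intro mult_right_mono frac_le) auto
  finally have "(cmod (u z))\<^sup>2 \<le> 2 * \<bar>C\<bar> / (1 - k)" by (simp add: norm_power)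
  moreover have "cmod (u z) \<le> 1 + (cmod (u z))\<^sup>2"
  proof -
    have "0 \<le> (cmod (u z) - 1)\<^sup>2 + cmod (u z)" by (intro add_nonneg_nonneg) auto
    then show ?thesis by (simp add: power2_eq_square algebra_simps)
  qed
  ultimately show ?thesis by linarith
qed

lemma polynomial_approximation_of_dilation:
  fixes f :: "complex \<Rightarrow> complex"
  assumes hol: "f holomorphic_on ball 0 1" and r: "0 < r" "r < 1" and "0 < e"
  shows "\<exists>p :: complex poly. \<forall>z\<in>cball 0 1. cmod (poly p z - f (of_real r * z)) \<le> e"
proof -
  define a where "a = (\<lambda>n. (deriv ^^ n) f 0 / fact n)"
  have ser: "(\<lambda>n. a n * w ^ n) sums f w" if "w \<in> ball 0 1" for w
    using holomorphic_power_series[OF hol that] by (simp add: a_def)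
  have abs: "summable (\<lambda>n. cmod (a n) * r ^ n)"
  proof -
    define s' where "s' = (r + 1) / 2"
    have s': "r < s'" "0 < s'" "s' < 1" using r by (auto simp: s'_def)
    have "summable (\<lambda>n. a n * of_real s' ^ n)"
      using ser[of "of_real s'"] s' by (auto simp: sums_iff)
    then have "summable (\<lambda>n. cmod (a n * of_real r ^ n))"
      by (rule powser_insidea) (use r s' in auto)
    then show ?thesis using r by (simp add: norm_mult norm_power)
  qed
  have "(\<lambda>n. \<Sum>k. cmod (a (k + n)) * r ^ (k + n)) \<longlonglongrightarrow> 0" by (rule suminf_exist_split2[OF abs])
  then have "eventually (\<lambda>n. (\<Sum>k. cmod (a (k + n)) * r ^ (k + n)) < e) sequentially"
    by (rule order_tendstoD) (fact \<open>0 < e\<close>)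
  then obtain n where n: "(\<Sum>k. cmod (a (k + n)) * r ^ (k + n)) < e"
    by (meson eventually_sequentially order_refl)
  define p where "p = (\<Sum>k<n. monom (a k * of_real r ^ k) k)"
  have "cmod (poly p z - f (of_real r * z)) \<le> e" if z: "z \<in> cball 0 1" for z
  proof -
    have rz: "of_real r * z \<in> ball 0 1"
    proof -
      have "r * cmod z \<le> r * 1" using z r by (intro mult_left_mono) auto
      then have "r * cmod z < 1" using r by linarith
      then show ?thesis using r by (simp add: norm_mult)
    qed
    have "poly p z = (\<Sum>k<n. a k * (of_real r * z) ^ k)"
      by (simp add: p_def poly_sum poly_monom power_mult_distrib mult_ac)
    moreover have "f (of_real r * z) = (\<Sum>k. a k * (of_real r * z) ^ k)"
      using ser[OF rz] by (simp add: sums_iff)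
    moreover have "(\<Sum>k. a k * (of_real r * z) ^ k) = (\<Sum>k. a (k + n) * (of_real r * z) ^ (k + n)) + (\<Sum>k<n. a k * (of_real r * z) ^ k)"
      by (rule suminf_split_initial_segment) (use ser[OF rz] in \<open>auto simp: sums_iff\<close>)
    ultimately have "cmod (poly p z - f (of_real r * z)) = cmod (\<Sum>k. a (k + n) * (of_real r * z) ^ (k + n))"
      by (simp add: norm_minus_commute)
    also have "\<dots> \<le> (\<Sum>k. cmod (a (k + n)) * r ^ (k + n))"
    proof (rule norm_suminf_le)
      fix k
      have "cmod (of_real r * z) ^ (k + n) \<le> r ^ (k + n)"
        by (rule power_mono) (use z r mult_left_mono[of "cmod z" 1 r] in \<open>auto simp: norm_mult\<close>)
      then show "cmod (a (k + n) * (of_real r * z) ^ (k + n)) \<le> cmod (a (k + n)) * r ^ (k + n)"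
        unfolding norm_mult[of "a (k + n)"] norm_power by (rule mult_left_mono) auto
    qed (use summable_ignore_initial_segment[OF abs] in auto)
    finally show ?thesis using n by linarith
  qed
  then show ?thesis by blast
qed

text \<open>Through polynomials only finite Blaschke products occur. Polynomials close to dilates of
  \<open>f\<close> are factored; the factors have uniformly bounded mean squares, hence form a
  normal family, and their limits along a common subsequence factor \<open>f\<close>. The additional
  \<open>2*pi\<close> pays for an approximation error of at most 1 on the circle.\<close>

theorem H1_factorization:
  fixes f :: "complex \<Rightarrow> complex"
  assumes hol: "f holomorphic_on ball 0 1"
    and C: "\<And>r. r\<in>{0<..<1} \<Longrightarrow> integral {0..2*pi} (\<lambda>t. cmod (f (of_real r * cis t))) \<le> C"
  obtains u v where "u holomorphic_on ball 0 1" "v holomorphic_on ball 0 1"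
     "\<And>z. z\<in>ball 0 1 \<Longrightarrow> f z = u z * v z"
     "\<And>r. r\<in>{0<..<1} \<Longrightarrow> integral {0..2*pi} (\<lambda>t. (cmod (u (of_real r * cis t)))\<^sup>2) \<le> C + 2*pi"
     "\<And>r. r\<in>{0<..<1} \<Longrightarrow> integral {0..2*pi} (\<lambda>t. (cmod (v (of_real r * cis t)))\<^sup>2) \<le> C + 2*pi"
proof -
  define K where "K = C + 2*pi"
  define H where "H = {u. u holomorphic_on ball 0 1 \<and>
     (\<forall>r\<in>{0<..<1}. integral {0..2*pi} (\<lambda>t. (cmod (u (of_real r * cis t)))\<^sup>2) \<le> K)}"
  define \<rho> where "\<rho> = (\<lambda>n::nat. 1 - 1 / (real n + 2))"
  have \<rho>: "0 < \<rho> n" "\<rho> n < 1" for n by (auto simp: \<rho>_def)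
  have \<rho>lim: "\<rho> \<longlonglongrightarrow> 1" unfolding \<rho>_def by real_asymp
  define e where "e = (\<lambda>n::nat. 1 / (real n + 1))"
  have e: "0 < e n" "e n \<le> 1" for n by (auto simp: e_def)
  have elim: "e \<longlonglongrightarrow> 0" unfolding e_def by real_asymp
  have "\<exists>p :: complex poly. \<forall>z\<in>cball 0 1. cmod (poly p z - f (of_real (\<rho> n) * z)) \<le> e n" for n
    by (rule polynomial_approximation_of_dilation[OF hol \<rho> e(1)])
  then obtain p :: "nat \<Rightarrow> complex poly"
    where p: "\<And>n z. z\<in>cball 0 1 \<Longrightarrow> cmod (poly (p n) z - f (of_real (\<rho> n) * z)) \<le> e n" by metis
  have "\<exists>u\<in>H. \<exists>v\<in>H. \<forall>z\<in>ball 0 1. poly (p n) z = u z * v z" for n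
  proof -
    have "integral {0..2*pi} (\<lambda>t. cmod (poly (p n) (cis t))) \<le> integral {0..2*pi} (\<lambda>t. cmod (f (of_real (\<rho> n) * cis t)) + 1)"
    proof (rule integral_le)
      show "(\<lambda>t. cmod (poly (p n) (cis t))) integrable_on {0..2*pi}"
        by (intro integrable_continuous_real continuous_intros)
      show "(\<lambda>t. cmod (f (of_real (\<rho> n) * cis t)) + 1) integrable_on {0..2*pi}"
        by (intro integrable_continuous_real continuous_intros continuous_on_circle[OF hol]) (use \<rho>[of n] in auto)
      fix t :: real
      show "cmod (poly (p n) (cis t)) \<le> cmod (f (of_real (\<rho> n) * cis t)) + 1"
        using p[of "cis t" n] e(2)[of n] norm_triangle_sub[of "poly (p n) (cis t)" "f (of_real (\<rho> n) * cis t)"] by simp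
    qed
    also have "\<dots> = integral {0..2*pi} (\<lambda>t. cmod (f (of_real (\<rho> n) * cis t))) + 2*pi"
    proof -
      have "(\<lambda>t. cmod (f (of_real (\<rho> n) * cis t))) integrable_on {0..2*pi}"
        by (intro integrable_continuous_real continuous_intros continuous_on_circle[OF hol]) (use \<rho>[of n] in auto)
      then show ?thesis by (subst integral_add) auto
    qed
    also have "\<dots> \<le> K" using C[of "\<rho> n"] \<rho>[of n] by (simp add: K_def)
    finally show ?thesis using polynomial_H2_factorization[of "p n" K] unfolding H_def by blast
  qed
  then obtain u v where uv: "\<And>n. u n \<in> H" "\<And>n. v n \<in> H" "\<And>n z. z\<in>ball 0 1 \<Longrightarrow> poly (p n) z = u n z * v n z"
    by metis
  have Hbd: "\<exists>B. \<forall>h\<in>H. \<forall>z\<in>X. cmod (h z) \<le> B" if X: "compact X" "X \<subseteq> ball 0 1" for X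
  proof -
    have "\<exists>k. 0 \<le> k \<and> k < 1 \<and> (\<forall>z\<in>X. cmod z \<le> k)"
    proof (cases "X = {}")
      case False
      then obtain x where "x \<in> X" "\<And>y. y \<in> X \<Longrightarrow> cmod y \<le> cmod x"
        using continuous_attains_sup[OF X(1), of cmod] by (auto intro: continuous_intros)
      then show ?thesis using X(2) by (intro exI[of _ "cmod x"]) auto
    qed auto
    then obtain k where "0 \<le> k" "k < 1" "\<And>z. z \<in> X \<Longrightarrow> cmod z \<le> k" by auto
    then have "cmod (h z) \<le> 1 + 2 * \<bar>K\<bar> / (1 - k)" if "h \<in> H" "z \<in> X" for h z
      using that by (intro L2_bound_imp_pointwise) (auto simp: H_def)
    then show ?thesis by blast
  qed
  have Hhol: "h holomorphic_on ball 0 1" if "h \<in> H" for h using that by (simp add: H_def)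
  have range1: "range u \<subseteq> H" using uv by auto
  obtain U s where U: "U holomorphic_on ball 0 1" "strict_mono (s :: nat \<Rightarrow> nat)"
      "\<And>x. x \<in> ball 0 1 \<Longrightarrow> (\<lambda>n. u (s n) x) \<longlonglongrightarrow> U x"
      "\<And>K. compact K \<Longrightarrow> K \<subseteq> ball 0 1 \<Longrightarrow> uniform_limit K (u \<circ> s) U sequentially"
    using Montel[OF open_ball Hhol Hbd range1] by blast
  have range2: "range (v \<circ> s) \<subseteq> H" using uv by auto
  obtain V s' where V: "V holomorphic_on ball 0 1" "strict_mono (s' :: nat \<Rightarrow> nat)"
      "\<And>x. x \<in> ball 0 1 \<Longrightarrow> (\<lambda>n. (v \<circ> s) (s' n) x) \<longlonglongrightarrow> V x"
      "\<And>K. compact K \<Longrightarrow> K \<subseteq> ball 0 1 \<Longrightarrow> uniform_limit K ((v \<circ> s) \<circ> s') V sequentially"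
    using Montel[OF open_ball Hhol Hbd range2] by blast
  define \<sigma> where "\<sigma> = s \<circ> s'"
  have \<sigma>: "filterlim \<sigma> at_top sequentially"
    unfolding \<sigma>_def by (intro filterlim_subseq strict_mono_o U V)
  have ptU: "(\<lambda>n. u (\<sigma> n) x) \<longlonglongrightarrow> U x" if "x \<in> ball 0 1" for x
    using LIMSEQ_subseq_LIMSEQ[OF U(3)[OF that] V(2)] by (simp add: \<sigma>_def o_def)
  have ptV: "(\<lambda>n. v (\<sigma> n) x) \<longlonglongrightarrow> V x" if "x \<in> ball 0 1" for x
    using V(3)[OF that] by (simp add: \<sigma>_def o_def)
  have L2: "integral {0..2*pi} (\<lambda>t. (cmod (W (of_real r * cis t)))\<^sup>2) \<le> K"
    if w: "\<And>n. w n \<in> H" and W: "W holomorphic_on ball 0 1" "\<And>x. x \<in> ball 0 1 \<Longrightarrow> (\<lambda>n. w n x) \<longlonglongrightarrow> W x"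
      and r: "r \<in> {0<..<1}" for w :: "nat \<Rightarrow> complex \<Rightarrow> complex" and W r
  proof -
    have "sphere 0 r \<subseteq> ball 0 1" using r by auto
    then have "\<exists>B. \<forall>h\<in>H. \<forall>z\<in>sphere 0 r. cmod (h z) \<le> B" by (intro Hbd) auto
    then obtain B where B: "\<And>h z. h \<in> H \<Longrightarrow> z \<in> sphere 0 r \<Longrightarrow> cmod (h z) \<le> B"
      by blast
    have "(\<lambda>n. integral {0..2*pi} (\<lambda>t. (cmod (w n (of_real r * cis t)))\<^sup>2)) \<longlonglongrightarrow>
       integral {0..2*pi} (\<lambda>t. (cmod (W (of_real r * cis t)))\<^sup>2)"
    proof (rule dominated_convergence(2)[of _ _ "\<lambda>_. B\<^sup>2"])
      show "(\<lambda>t. (cmod (w n (of_real r * cis t)))\<^sup>2) integrable_on {0..2*pi}" for n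
        using integral_norm_square_circle[OF Hhol[OF w], of r] r by auto
      show "norm ((cmod (w n (of_real r * cis t)))\<^sup>2) \<le> B\<^sup>2" for n t
        using B[OF w, of "of_real r * cis t" n] r by (auto simp: norm_mult intro!: power_mono)
      show "(\<lambda>n. (cmod (w n (of_real r * cis t)))\<^sup>2) \<longlonglongrightarrow> (cmod (W (of_real r * cis t)))\<^sup>2" for t
        by (intro tendsto_intros W(2)) (use r in \<open>auto simp: norm_mult\<close>)
    qed auto
    then show ?thesis
      by (rule LIMSEQ_le_const2) (use w r in \<open>auto simp: H_def\<close>)
  qed
  have "f z = U z * V z" if z: "z \<in> ball 0 1" for z
  proof -
    have "(\<lambda>n. poly (p (\<sigma> n)) z) \<longlonglongrightarrow> f z"
    proof -
      have "(\<lambda>n. f (of_real (\<rho> n) * z)) \<longlonglongrightarrow> f z"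
      proof (rule continuous_on_tendsto_compose[OF holomorphic_on_imp_continuous_on[OF hol] _ z])
        show "(\<lambda>n. of_real (\<rho> n) * z) \<longlonglongrightarrow> z"
          by (rule tendsto_eq_intros tendsto_of_real \<rho>lim refl)+ simp
        have "of_real (\<rho> n) * z \<in> ball 0 1" for n
          using z \<rho>[of n] mult_mono[of "\<rho> n" 1 "cmod z" "cmod z"] by (simp add: norm_mult)
        then show "\<forall>\<^sub>F n in sequentially. of_real (\<rho> n) * z \<in> ball 0 1" by simp
      qed
      moreover have "(\<lambda>n. poly (p n) z - f (of_real (\<rho> n) * z)) \<longlonglongrightarrow> 0"
        by (rule Lim_null_comparison[OF _ elim]) (use p z in \<open>auto intro!: always_eventually\<close>)
      ultimately have "(\<lambda>n. poly (p n) z) \<longlonglongrightarrow> f z" by (rule Lim_transform)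
      then show ?thesis using \<sigma> by (rule filterlim_compose)
    qed
    moreover have "(\<lambda>n. poly (p (\<sigma> n)) z) \<longlonglongrightarrow> U z * V z"
      unfolding uv(3)[OF z] by (intro tendsto_mult ptU ptV z)
    ultimately show ?thesis using LIMSEQ_unique by blast
  qed
  moreover have "integral {0..2*pi} (\<lambda>t. (cmod (U (of_real r * cis t)))\<^sup>2) \<le> K" if "r \<in> {0<..<1}" for r
    by (rule L2[OF _ U(1) ptU that]) (use uv in auto)
  moreover have "integral {0..2*pi} (\<lambda>t. (cmod (V (of_real r * cis t)))\<^sup>2) \<le> K" if "r \<in> {0<..<1}" for r
    by (rule L2[OF _ V(1) ptV that]) (use uv in auto)
  ultimately show ?thesis using that U(1) V(1) unfolding K_def by blast
qed

section \<open>BMOA functions are Bloch functions\<close>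

lemma L2_bound_imp_energy_bound:
  fixes u :: "complex \<Rightarrow> complex"
  assumes hol: "u holomorphic_on ball 0 1"
    and C: "\<And>r. r\<in>{0<..<1} \<Longrightarrow> integral {0..2*pi} (\<lambda>t. (cmod (u (of_real r * cis t)))\<^sup>2) \<le> C"
    and x: "0 < x" "x < 1"
  shows "energy u x \<le> C"
proof -
  have s: "0 < sqrt x" "sqrt x < 1" using x by auto
  from C[of "sqrt x"] s x show ?thesis
    using integral_unique[OF integral_norm_square_circle[OF hol s]] by simp
qed

text \<open>A difference of products splits as \<open>u p * (v p - v q) + v q * (u p - u q)\<close>.
  Each summand pairs a factor bounded in mean square with one that is small in mean square; a
  weighted arithmetic-geometric mean inequality takes the place of Cauchy-Schwarz.\<close>

lemma H1_imp_L1_Cauchy: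
  fixes f :: "complex \<Rightarrow> complex"
  assumes hol: "f holomorphic_on ball 0 1"
    and C: "\<And>r. r\<in>{0<..<1} \<Longrightarrow> integral {0..2*pi} (\<lambda>t. cmod (f (of_real r * cis t))) \<le> C"
    and "0 < e"
  shows "\<exists>r0. 0 < r0 \<and> r0 < 1 \<and> (\<forall>r s. r0 < r \<longrightarrow> r < 1 \<longrightarrow> r0 < s \<longrightarrow> s < 1 \<longrightarrow>
     integral {0..2*pi} (\<lambda>t. cmod (f (of_real r * cis t) - f (of_real s * cis t))) \<le> e)"
proof -
  obtain u v where hu: "u holomorphic_on ball 0 1" and hv: "v holomorphic_on ball 0 1"
     and fuv: "\<And>z. z\<in>ball 0 1 \<Longrightarrow> f z = u z * v z"
     and bu: "\<And>r. r\<in>{0<..<1} \<Longrightarrow> integral {0..2*pi} (\<lambda>t. (cmod (u (of_real r * cis t)))\<^sup>2) \<le> C + 2*pi"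
     and bv: "\<And>r. r\<in>{0<..<1} \<Longrightarrow> integral {0..2*pi} (\<lambda>t. (cmod (v (of_real r * cis t)))\<^sup>2) \<le> C + 2*pi"
    using H1_factorization[OF hol C] by blast
  define K where "K = C + 2*pi"
  have K: "0 \<le> K"
  proof -
    have "0 \<le> integral {0..2*pi} (\<lambda>t. (cmod (u (of_real (1/2) * cis t)))\<^sup>2)"
      by (rule integral_nonneg) (use integral_norm_square_circle[OF hu, of "1/2"] in auto)
    then show ?thesis using bu[of "1/2"] by (simp add: K_def)
  qed
  \<comment> \<open>The final bound is \<open>2 * (\<eta> / 2 * K + e' / (2 * \<eta>))\<close>: this
    \<open>\<eta>\<close> makes the first part at most \<open>e/2\<close>, and
    \<open>e' = e * \<eta> / 2\<close> makes the second equal to \<open>e/2\<close>.\<close>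
  define \<eta> where "\<eta> = e / (2 * (K + 1))"
  have \<eta>: "0 < \<eta>" "\<eta> * K \<le> e / 2"
    using K \<open>0 < e\<close> by (auto simp: \<eta>_def field_simps)
  define e' where "e' = e * \<eta> / 2"
  have "0 < e'" using \<eta> \<open>0 < e\<close> by (simp add: e'_def)
  obtain r1 where r1: "0 < r1" "r1 < 1" "\<And>r s. r1 < r \<Longrightarrow> r < 1 \<Longrightarrow> r1 < s \<Longrightarrow> s < 1 \<Longrightarrow>
     integral {0..2*pi} (\<lambda>t. (cmod (u (of_real r * cis t) - u (of_real s * cis t)))\<^sup>2) \<le> e'"
    using energy_bounded_imp_L2_Cauchy[OF hu L2_bound_imp_energy_bound[OF hu bu] \<open>0 < e'\<close>] by blast
  obtain r2 where r2: "0 < r2" "r2 < 1" "\<And>r s. r2 < r \<Longrightarrow> r < 1 \<Longrightarrow> r2 < s \<Longrightarrow> s < 1 \<Longrightarrow>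
     integral {0..2*pi} (\<lambda>t. (cmod (v (of_real r * cis t) - v (of_real s * cis t)))\<^sup>2) \<le> e'"
    using energy_bounded_imp_L2_Cauchy[OF hv L2_bound_imp_energy_bound[OF hv bv] \<open>0 < e'\<close>] by blast
  have am_gm: "x * y \<le> \<eta> / 2 * x\<^sup>2 + 1 / (2 * \<eta>) * y\<^sup>2" for x y
  proof -
    have "0 \<le> (\<eta> * x - y)\<^sup>2 / (2 * \<eta>)" using \<eta> by simp
    also have "\<dots> = \<eta> / 2 * x\<^sup>2 + 1 / (2 * \<eta>) * y\<^sup>2 - x * y"
      using \<eta> by (simp add: power2_eq_square field_simps)
    finally show ?thesis by simp
  qed
  have "integral {0..2*pi} (\<lambda>t. cmod (f (of_real r * cis t) - f (of_real s * cis t))) \<le> e"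
    if r: "max r1 r2 < r" "r < 1" and s: "max r1 r2 < s" "s < 1" for r s
  proof -
    have pos: "0 < r" "0 < s" using r s r1 r2 by auto
    note int = integral_norm_square_circle[OF hu pos(1) r(2)] integral_norm_square_circle[OF hv pos(2) s(2)]
      integral_norm_square_diff_circle[OF hu pos(1) r(2) pos(2) s(2)]
      integral_norm_square_diff_circle[OF hv pos(1) r(2) pos(2) s(2)]
    define R where "R = (\<lambda>t. (\<eta> / 2 * (cmod (u (of_real r * cis t)))\<^sup>2
          + 1 / (2 * \<eta>) * (cmod (v (of_real r * cis t) - v (of_real s * cis t)))\<^sup>2)
        + (\<eta> / 2 * (cmod (v (of_real s * cis t)))\<^sup>2
          + 1 / (2 * \<eta>) * (cmod (u (of_real r * cis t) - u (of_real s * cis t)))\<^sup>2))"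
    have R: "(R has_integral (\<eta> / 2 * energy u (r\<^sup>2)
          + 1 / (2 * \<eta>) * (energy v (r\<^sup>2) + energy v (s\<^sup>2) - 2 * energy v (r * s)))
        + (\<eta> / 2 * energy v (s\<^sup>2)
          + 1 / (2 * \<eta>) * (energy u (r\<^sup>2) + energy u (s\<^sup>2) - 2 * energy u (r * s)))) {0..2*pi}"
      unfolding R_def by (intro has_integral_add has_integral_mult_right int)
    have "integral {0..2*pi} (\<lambda>t. cmod (f (of_real r * cis t) - f (of_real s * cis t))) \<le> integral {0..2*pi} R"
    proof (rule integral_le)
      show "R integrable_on {0..2*pi}" using R by blast
      show "(\<lambda>t. cmod (f (of_real r * cis t) - f (of_real s * cis t))) integrable_on {0..2*pi}"
        by (intro integrable_continuous_real continuous_intros continuous_on_circle[OF hol]) (use pos r s in auto)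
      fix t :: real
      define p q where "p = of_real r * cis t" and "q = of_real s * cis t"
      have "p \<in> ball 0 1" "q \<in> ball 0 1" using pos r s by (auto simp: p_def q_def norm_mult)
      then have "f p - f q = u p * (v p - v q) + v q * (u p - u q)" by (simp add: fuv algebra_simps)
      then have "cmod (f p - f q) \<le> cmod (u p) * cmod (v p - v q) + cmod (v q) * cmod (u p - u q)"
        by (metis norm_mult norm_triangle_ineq)
      then show "cmod (f (of_real r * cis t) - f (of_real s * cis t)) \<le> R t"
        using am_gm[of "cmod (u p)" "cmod (v p - v q)"] am_gm[of "cmod (v q)" "cmod (u p - u q)"]
        unfolding R_def p_def q_def by linarith
    qed
    also have "\<dots> \<le> (\<eta> / 2 * K + 1 / (2 * \<eta>) * e') + (\<eta> / 2 * K + 1 / (2 * \<eta>) * e')"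
    proof -
      have "energy u (r\<^sup>2) \<le> K" using bu[of r] pos r integral_unique[OF int(1)] by (simp add: K_def)
      moreover have "energy v (s\<^sup>2) \<le> K" using bv[of s] pos s integral_unique[OF int(2)] by (simp add: K_def)
      moreover have "energy u (r\<^sup>2) + energy u (s\<^sup>2) - 2 * energy u (r * s) \<le> e'"
        using r1(3)[of r s] r s integral_unique[OF int(3)] by simp
      moreover have "energy v (r\<^sup>2) + energy v (s\<^sup>2) - 2 * energy v (r * s) \<le> e'"
        using r2(3)[of r s] r s integral_unique[OF int(4)] by simp
      ultimately show ?thesis
        unfolding integral_unique[OF R] using \<eta> by (intro add_mono mult_left_mono) auto
    qed
    also have "\<dots> = \<eta> * K + e / 2" using \<eta> by (simp add: e'_def field_simps)
    also have "\<dots> \<le> e" using \<eta>(2) by simp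
    finally show ?thesis .
  qed
  then show ?thesis using r1 r2 by (intro exI[of _ "max r1 r2"]) auto
qed

text \<open>For a fixed \<open>r\<close>, the second radius of the mean Cauchy condition tends to 1,
  in the manner of Fatou's lemma.\<close>

lemma H1_L1_convergence:
  fixes f g :: "complex \<Rightarrow> complex"
  assumes hol: "f holomorphic_on ball 0 1"
    and C: "\<And>r. r\<in>{0<..<1} \<Longrightarrow> integral {0..2*pi} (\<lambda>t. cmod (f (of_real r * cis t))) \<le> C"
    and g: "(\<lambda>t. g (cis t)) absolutely_integrable_on {0..2*pi}"
    and bv: "AE t in lebesgue. ((\<lambda>r::real. f (of_real r * cis t)) \<longlongrightarrow> g (cis t)) (at_left 1)"
    and "0 < e"
  shows "\<exists>r0. 0 < r0 \<and> r0 < 1 \<and> (\<forall>r. r0 < r \<longrightarrow> r < 1 \<longrightarrow>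
     integral {0..2*pi} (\<lambda>t. cmod (f (of_real r * cis t) - g (cis t))) \<le> e)"
proof -
  obtain r0 where r0: "0 < r0" "r0 < 1" "\<And>r s. r0 < r \<Longrightarrow> r < 1 \<Longrightarrow> r0 < s \<Longrightarrow> s < 1 \<Longrightarrow>
     integral {0..2*pi} (\<lambda>t. cmod (f (of_real r * cis t) - f (of_real s * cis t))) \<le> e"
    using H1_imp_L1_Cauchy[OF hol C \<open>0 < e\<close>] by blast
  define Z where "Z = {t. \<not> ((\<lambda>r::real. f (of_real r * cis t)) \<longlongrightarrow> g (cis t)) (at_left 1)}"
  have negZ: "negligible Z" using bv unfolding Z_def AE_lebesgue_iff_negligible .
  define s where "s = (\<lambda>n::nat. 1 - (1 - r0) / (real n + 2))"
  have s: "r0 < s n" "s n < 1" for n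
  proof -
    have "(1 - r0) / (real n + 2) < 1 - r0" using r0 by (simp add: divide_less_eq)
    then show "r0 < s n" by (simp add: s_def)
    show "s n < 1" using r0 by (simp add: s_def)
  qed
  have "s \<longlonglongrightarrow> 1" unfolding s_def by real_asymp
  then have slim: "filterlim s (at_left 1) sequentially"
    using s less_imp_neq[OF s(2)] by (auto simp: filterlim_at)
  have "integral {0..2*pi} (\<lambda>t. cmod (f (of_real r * cis t) - g (cis t))) \<le> e" if r: "r0 < r" "r < 1" for r
  proof -
    have "(\<lambda>t. f (of_real r * cis t)) absolutely_integrable_on {0..2*pi}"
      by (intro absolutely_integrable_continuous_real continuous_on_circle[OF hol]) (use r r0 in auto)
    from set_integral_diff(1)[OF this g]
    have abs: "(\<lambda>t. cmod (f (of_real r * cis t) - g (cis t))) absolutely_integrable_on {0..2*pi}"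
      using absolutely_integrable_norm by (fastforce simp: o_def)
    \<comment> \<open>Truncation by the expected limit supplies an integrable dominating function;
      the minimum still converges to that limit, and its integral is still at most
      \<open>e\<close>.\<close>
    define F where "F = (\<lambda>n t. min (cmod (f (of_real r * cis t) - f (of_real (s n) * cis t))) (cmod (f (of_real r * cis t) - g (cis t))))"
    have abs2: "(\<lambda>t. cmod (f (of_real r * cis t) - f (of_real (s n) * cis t))) absolutely_integrable_on {0..2*pi}" for n
      by (intro absolutely_integrable_continuous_real continuous_intros continuous_on_circle[OF hol])
         (use r r0 s[of n] in auto)
    have Fint: "F n integrable_on {0..2*pi}" for n
      unfolding F_def using absolutely_integrable_min[OF abs2 abs] set_lebesgue_integral_eq_integral(1) by fastforce
    have Fle: "integral {0..2*pi} (F n) \<le> e" for n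
    proof -
      have "integral {0..2*pi} (F n) \<le> integral {0..2*pi} (\<lambda>t. cmod (f (of_real r * cis t) - f (of_real (s n) * cis t)))"
        by (rule integral_le[OF Fint set_lebesgue_integral_eq_integral(1)[OF abs2]]) (simp add: F_def)
      also have "\<dots> \<le> e" by (rule r0(3)[OF r s])
      finally show ?thesis .
    qed
    define F' where "F' = (\<lambda>n t. if t \<in> Z then cmod (f (of_real r * cis t) - g (cis t)) else F n t)"
    have F'eq: "integral {0..2*pi} (F' n) = integral {0..2*pi} (F n)" for n
      by (rule integral_spike[OF negZ]) (simp add: F'_def)
    have "(\<lambda>n. integral {0..2*pi} (F' n)) \<longlonglongrightarrow> integral {0..2*pi} (\<lambda>t. cmod (f (of_real r * cis t) - g (cis t)))"
    proof (rule dominated_convergence(2))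
      show "F' n integrable_on {0..2*pi}" for n
        by (rule integrable_spike[OF Fint negZ]) (simp add: F'_def)
      show "(\<lambda>t. cmod (f (of_real r * cis t) - g (cis t))) integrable_on {0..2*pi}"
        by (rule set_lebesgue_integral_eq_integral(1)[OF abs])
      show "norm (F' n t) \<le> cmod (f (of_real r * cis t) - g (cis t))" for n t
        by (auto simp: F'_def F_def)
      show "(\<lambda>n. F' n t) \<longlonglongrightarrow> cmod (f (of_real r * cis t) - g (cis t))" for t
      proof (cases "t \<in> Z")
        case False
        then have "((\<lambda>r::real. f (of_real r * cis t)) \<longlongrightarrow> g (cis t)) (at_left 1)" by (simp add: Z_def)
        from filterlim_compose[OF this slim]
        have "(\<lambda>n. min (cmod (f (of_real r * cis t) - f (of_real (s n) * cis t))) (cmod (f (of_real r * cis t) - g (cis t))))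
           \<longlonglongrightarrow> min (cmod (f (of_real r * cis t) - g (cis t))) (cmod (f (of_real r * cis t) - g (cis t)))"
          by (intro tendsto_intros)
        then show ?thesis using False by (simp add: F'_def F_def)
      qed (simp add: F'_def)
    qed
    then show ?thesis by (rule LIMSEQ_le_const2) (use F'eq Fle in auto)
  qed
  then show ?thesis using r0(1,2) by blast
qed

lemma norm_cis_minus_ge:
  assumes z: "z \<in> ball 0 1"
  shows "1 - cmod z \<le> cmod (cis t - z)"
  using norm_triangle_ineq2[of "cis t" z] by simp

lemma absolutely_integrable_kernel_mult:
  fixes \<phi> :: "real \<Rightarrow> real"
  assumes \<phi>: "\<phi> absolutely_integrable_on {a..b}" and z: "z \<in> ball 0 1"
  shows "(\<lambda>t. \<phi> t / (cmod (cis t - z))\<^sup>2) absolutely_integrable_on {a..b}"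
proof -
  have nz: "cmod (cis t - z) \<noteq> 0" for t using norm_cis_minus_ge[OF z, of t] z by auto
  have cont: "continuous_on {a..b} (\<lambda>t. 1 / (cmod (cis t - z))\<^sup>2)"
    using nz by (intro continuous_intros) auto
  have "(\<lambda>t. 1 / (cmod (cis t - z))\<^sup>2 * \<phi> t) absolutely_integrable_on {a..b}"
  proof (rule absolutely_integrable_bounded_measurable_product_real[OF _ _ _ \<phi>])
    show "(\<lambda>t. 1 / (cmod (cis t - z))\<^sup>2) \<in> borel_measurable (lebesgue_on {a..b})"
      by (rule continuous_imp_measurable_on_sets_lebesgue[OF cont]) auto
    show "bounded ((\<lambda>t. 1 / (cmod (cis t - z))\<^sup>2) ` {a..b})"
      by (intro compact_imp_bounded compact_continuous_image cont) auto
  qed auto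
  then show ?thesis by simp
qed

text \<open>Cauchy's formula for the derivative of \<open>f - c\<close> on a circle of radius near
  1, after which \<open>f\<close> is replaced by its boundary values at the cost of a small mean
  error. The free constant \<open>c\<close> allows an average of \<open>g\<close> to be
  subtracted.\<close>

lemma H1_deriv_bound:
  fixes f g :: "complex \<Rightarrow> complex"
  assumes hol: "f holomorphic_on ball 0 1"
    and C: "\<And>r. r\<in>{0<..<1} \<Longrightarrow> integral {0..2*pi} (\<lambda>t. cmod (f (of_real r * cis t))) \<le> C"
    and g: "(\<lambda>t. g (cis t)) absolutely_integrable_on {0..2*pi}"
    and bv: "AE t in lebesgue. ((\<lambda>r::real. f (of_real r * cis t)) \<longlongrightarrow> g (cis t)) (at_left 1)"
    and z: "z \<in> ball 0 1"
  shows "cmod (deriv f z) \<le> 4 * integral {0..2*pi} (\<lambda>t. cmod (g (cis t) - c) / (cmod (cis t - z))\<^sup>2)"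
proof -
  define d where "d = 1 - cmod z"
  have d: "0 < d" using z by (simp add: d_def)
  have dle: "d \<le> cmod (cis t - z)" for t using norm_cis_minus_ge[OF z] by (simp add: d_def)
  have absg: "(\<lambda>t. cmod (g (cis t) - c)) absolutely_integrable_on {0..2*pi}"
    using absolutely_integrable_norm[OF set_integral_diff(1)[OF g, of "\<lambda>_. c"]] by (auto simp: o_def)
  define I where "I = integral {0..2*pi} (\<lambda>t. cmod (g (cis t) - c) / (cmod (cis t - z))\<^sup>2)"
  have gint: "(\<lambda>t. cmod (g (cis t) - c) / (cmod (cis t - z))\<^sup>2) integrable_on {0..2*pi}"
    by (rule set_lebesgue_integral_eq_integral(1)[OF absolutely_integrable_kernel_mult[OF absg z]])
  have le: "cmod (deriv f z) \<le> 4 * I + 4 / d\<^sup>2 * e" if e: "0 < e" for e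
  proof -
    obtain r0 where r0: "0 < r0" "r0 < 1" "\<And>r. r0 < r \<Longrightarrow> r < 1 \<Longrightarrow>
       integral {0..2*pi} (\<lambda>t. cmod (f (of_real r * cis t) - g (cis t))) \<le> e"
      using H1_L1_convergence[OF hol C g bv e] by blast
    \<comment> \<open>With \<open>1 - r \<le> d/2\<close>, the point \<open>r * cis t\<close> is at
      least half as far from \<open>z\<close> as \<open>cis t\<close>; squared in the kernel, this
      gives the factor 4.\<close>
    define r where "r = max ((1 + r0) / 2) (1 - d / 2)"
    have "(1 + r0) / 2 \<le> r" "1 - d / 2 \<le> r" by (auto simp: r_def)
    moreover have "r < 1" using r0(2) d by (simp add: r_def)
    ultimately have r: "r0 < r" "0 < r" "r < 1" "1 - r \<le> d / 2" using r0(1,2) by (simp_all add: field_simps)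
    have zr: "cmod z < r" using r d by (simp add: d_def)
    have sub: "cball 0 r \<subseteq> ball 0 1" using r by auto
    define h where "h = (\<lambda>w. f w - c)"
    have holh: "h holomorphic_on ball 0 1" unfolding h_def by (intro holomorphic_intros hol)
    have "continuous_on (cball 0 r) h"
      using holh sub holomorphic_on_imp_continuous_on holomorphic_on_subset by blast
    then have "((\<lambda>t. h (of_real r * cis t) * (of_real r * cis t) / (of_real r * cis t - z) ^ Suc 1)
       has_integral (2*pi / fact 1 * (deriv ^^ 1) h z)) {0..2*pi}"
      by (rule Cauchy_circle) (use holh sub zr ball_subset_cball in \<open>auto elim!: holomorphic_on_subset\<close>)
    moreover have "deriv h z = deriv f z"
    proof -
      have "f field_differentiable at z" using hol z holomorphic_on_imp_differentiable_at by blast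
      then show ?thesis unfolding h_def by (subst deriv_diff) auto
    qed
    ultimately have CI: "((\<lambda>t. h (of_real r * cis t) * (of_real r * cis t) / (of_real r * cis t - z) ^ 2)
       has_integral (2*pi * deriv f z)) {0..2*pi}" by (simp add: power2_eq_square)
    have absf: "(\<lambda>t. cmod (f (of_real r * cis t) - g (cis t))) absolutely_integrable_on {0..2*pi}"
    proof -
      have "(\<lambda>t. f (of_real r * cis t)) absolutely_integrable_on {0..2*pi}"
        by (intro absolutely_integrable_continuous_real continuous_on_circle[OF hol]) (use r r0 in auto)
      from set_integral_diff(1)[OF this g] show ?thesis
        using absolutely_integrable_norm by (fastforce simp: o_def)
    qed
    then have fint: "(\<lambda>t. cmod (f (of_real r * cis t) - g (cis t))) integrable_on {0..2*pi}"
      by (rule set_lebesgue_integral_eq_integral(1))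
    define R where "R = (\<lambda>t. 4 * (cmod (g (cis t) - c) / (cmod (cis t - z))\<^sup>2) + 4 / d\<^sup>2 * cmod (f (of_real r * cis t) - g (cis t)))"
    have "norm (2*pi * deriv f z) \<le> integral {0..2*pi} R"
      unfolding integral_unique[OF CI, symmetric]
    proof (rule integral_norm_bound_integral)
      show "(\<lambda>t. h (of_real r * cis t) * (of_real r * cis t) / (of_real r * cis t - z) ^ 2) integrable_on {0..2*pi}"
        using CI by blast
      show "R integrable_on {0..2*pi}" unfolding R_def
        by (intro integrable_add integrable_on_mult_right gint fint)
      fix t :: real
      define D where "D = cmod (cis t - z)"
      have D: "d \<le> D" "0 < D" using dle[of t] d by (auto simp: D_def)
      have "cis t - z = (of_real r * cis t - z) + of_real (1 - r) * cis t" by (simp add: algebra_simps)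
      then have "D \<le> cmod (of_real r * cis t - z) + cmod (of_real (1 - r) * cis t)"
        unfolding D_def by (metis norm_triangle_ineq)
      also have "cmod (of_real (1 - r) * cis t) = 1 - r" using r by (simp only: norm_mult norm_cis norm_of_real) simp
      finally have half: "D / 2 \<le> cmod (of_real r * cis t - z)" using r D by simp
      have tri: "cmod (h (of_real r * cis t)) \<le> cmod (g (cis t) - c) + cmod (f (of_real r * cis t) - g (cis t))"
        using norm_triangle_ineq[of "g (cis t) - c" "f (of_real r * cis t) - g (cis t)"] by (simp add: h_def)
      have "norm (h (of_real r * cis t) * (of_real r * cis t) / (of_real r * cis t - z) ^ 2)
         = cmod (h (of_real r * cis t)) * r / (cmod (of_real r * cis t - z))\<^sup>2"
        using r by (simp add: norm_mult norm_divide norm_power)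
      also have "\<dots> \<le> cmod (h (of_real r * cis t)) * 1 / (D / 2)\<^sup>2"
        using half D r by (intro frac_le mult_left_mono power_mono) auto
      also have "\<dots> = 4 / D\<^sup>2 * cmod (h (of_real r * cis t))" by (simp add: power_divide)
      also have "\<dots> \<le> 4 / D\<^sup>2 * (cmod (g (cis t) - c) + cmod (f (of_real r * cis t) - g (cis t)))"
        by (intro mult_left_mono tri) auto
      also have "\<dots> = 4 / D\<^sup>2 * cmod (g (cis t) - c) + 4 / D\<^sup>2 * cmod (f (of_real r * cis t) - g (cis t))"
        by (rule distrib_left)
      also have "\<dots> \<le> 4 / D\<^sup>2 * cmod (g (cis t) - c) + 4 / d\<^sup>2 * cmod (f (of_real r * cis t) - g (cis t))"
        using D d by (intro add_left_mono mult_right_mono frac_le power_mono) auto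
      finally show "norm (h (of_real r * cis t) * (of_real r * cis t) / (of_real r * cis t - z) ^ 2) \<le> R t"
        by (simp add: R_def D_def)
    qed
    also have "integral {0..2*pi} R = 4 * I + 4 / d\<^sup>2 * integral {0..2*pi} (\<lambda>t. cmod (f (of_real r * cis t) - g (cis t)))"
      unfolding R_def I_def
      using integral_add[OF integrable_on_mult_right[OF gint, of 4] integrable_on_mult_right[OF fint, of "4 / d\<^sup>2"]]
      by (simp only: integral_mult_right)
    also have "\<dots> \<le> 4 * I + 4 / d\<^sup>2 * e"
      using r0(3)[OF r(1,3)] d by (intro add_left_mono mult_left_mono) auto
    finally have "2*pi * cmod (deriv f z) \<le> 4 * I + 4 / d\<^sup>2 * e" by (simp add: norm_mult)
    moreover have "1 * cmod (deriv f z) \<le> 2*pi * cmod (deriv f z)"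
      using pi_gt3 by (intro mult_right_mono) auto
    ultimately show ?thesis by linarith
  qed
  have "cmod (deriv f z) \<le> 4 * I + 0"
  proof (rule field_le_epsilon)
    fix e :: real assume "0 < e"
    then show "cmod (deriv f z) \<le> 4 * I + 0 + e" using le[of "e * d\<^sup>2 / 4"] d by simp
  qed
  then show ?thesis by (simp add: I_def)
qed

section \<open>Dyadic arcs and the kernel \<open>1 / (cmod (cis t - z))\<^sup>2\<close>\<close>

lemma abs_sin_ge:
  assumes "\<bar>y\<bar> \<le> pi / 2"
  shows "\<bar>y\<bar> / 3 \<le> \<bar>sin y\<bar>"
proof -
  have "\<bar>sin y - (\<Sum>m<3. sin_coeff m * y ^ m)\<bar> \<le> inverse (fact 3) * \<bar>y\<bar> ^ 3"
    by (rule Maclaurin_sin_bound)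
  also have "(\<Sum>m<3. sin_coeff m * y ^ m) = y" by (simp add: numeral_3_eq_3 sin_coeff_def)
  finally have "\<bar>sin y - y\<bar> \<le> \<bar>y\<bar> ^ 3 / 6" by (simp add: fact_numeral)
  \<comment> \<open>The cubic error is then at most two thirds of \<open>\<bar>y\<bar>\<close>,
    which leaves the third claimed.\<close>
  moreover have "\<bar>y\<bar> ^ 3 \<le> 4 * \<bar>y\<bar>"
  proof -
    have "\<bar>y\<bar> \<le> 2" using assms pi_less_4 by linarith
    then have "\<bar>y\<bar> * \<bar>y\<bar> \<le> 2 * 2" by (intro mult_mono) auto
    then have "\<bar>y\<bar> * \<bar>y\<bar> * \<bar>y\<bar> \<le> 4 * \<bar>y\<bar>" by (intro mult_right_mono) auto
    then show ?thesis by (simp add: power3_eq_cube)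
  qed
  ultimately show ?thesis by linarith
qed

lemma norm_cis_minus_ge_arc:
  assumes z: "z \<in> ball 0 1" "z = of_real (cmod z) * cis \<tau>" and t: "\<bar>t - \<tau>\<bar> \<le> pi"
  shows "\<bar>t - \<tau>\<bar> / 6 \<le> cmod (cis t - z)"
proof -
  define x where "x = t - \<tau>"
  have "cis t - z = cis \<tau> * (cis x - of_real (cmod z))"
    by (subst z(2)) (simp add: x_def algebra_simps cis_mult)
  then have eq: "cmod (cis t - z) = cmod (cis x - of_real (cmod z))"
    by (simp only: norm_mult norm_cis mult_1)
  have "cmod (cis x - 1) \<le> cmod (cis x - of_real (cmod z)) + cmod (of_real (cmod z) - 1)"
    using norm_triangle_ineq[of "cis x - of_real (cmod z)" "of_real (cmod z) - 1"] by simp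
  also have "cmod (of_real (cmod z) - 1) = 1 - cmod z"
    using z(1) norm_of_real[of "cmod z - 1", where ?'a=complex] by simp
  also have "\<dots> \<le> cmod (cis x - of_real (cmod z))"
    using norm_triangle_ineq2[of "cis x" "of_real (cmod z)"] by simp
  finally have 1: "cmod (cis x - 1) \<le> 2 * cmod (cis t - z)" using eq by simp
  have "(cmod (cis x - 1))\<^sup>2 = (2 * \<bar>sin (x/2)\<bar>)\<^sup>2"
  proof -
    have "(cmod (cis x - 1))\<^sup>2 = (cos x - 1)\<^sup>2 + (sin x)\<^sup>2" by (simp add: cmod_power2)
    also have "\<dots> = ((sin x)\<^sup>2 + (cos x)\<^sup>2) + 1 - 2 * cos x" by (simp add: power2_eq_square algebra_simps)
    also have "\<dots> = 2 - 2 * cos (2 * (x/2))" by simp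
    also have "\<dots> = 4 * (sin (x/2))\<^sup>2" unfolding cos_double_sin by simp
    finally show ?thesis by (simp add: power_mult_distrib)
  qed
  then have "cmod (cis x - 1) = 2 * \<bar>sin (x/2)\<bar>" by (rule power2_eq_imp_eq) auto
  moreover have "\<bar>x/2\<bar> / 3 \<le> \<bar>sin (x/2)\<bar>" by (rule abs_sin_ge) (use t in \<open>simp add: x_def\<close>)
  ultimately show ?thesis using 1 by (simp add: x_def)
qed

text \<open>With half-length \<open>pi / 2 ^ j\<close>, arc 0 is exactly one period centred at
  \<tau>, and each arc has half the length of the preceding one.\<close>

definition darc :: "real \<Rightarrow> nat \<Rightarrow> real set"
  where "darc \<tau> j = {\<tau> - pi / 2 ^ j..\<tau> + pi / 2 ^ j}"

lemma darc_antimono: "i \<le> j \<Longrightarrow> darc \<tau> j \<subseteq> darc \<tau> i"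
proof -
  assume "i \<le> j"
  then have "pi / 2 ^ j \<le> pi / (2::real) ^ i"
    by (intro divide_left_mono power_increasing) auto
  then show ?thesis by (auto simp: darc_def)
qed

text \<open>The kernel is dominated pointwise, using the smallest of the arcs 0 to \<open>n\<close>
  that contains \<open>t\<close>. On arc \<open>n\<close> itself,
  \<open>1 / (1 - cmod z) \<le> 2 ^ n\<close> is used. Otherwise \<open>t\<close> misses arc
  \<open>j + 1\<close>, so \<open>\<bar>t - \<tau>\<bar> > 3 / 2 ^ (j + 1)\<close>, the distance
  from \<open>cis t\<close> to \<open>z\<close> is at least \<open>1 / (4 * 2 ^ j)\<close>, and the
  weight \<open>16 * 4 ^ j\<close> results.\<close>

lemma integral_kernel_le_dyadic:
  fixes \<phi> :: "real \<Rightarrow> real"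
  assumes \<phi>: "\<phi> integrable_on darc (\<tau>) 0" "\<And>t. 0 \<le> \<phi> t"
    and z: "z \<in> ball 0 1" and z\<tau>: "z = of_real (cmod z) * cis \<tau>" and n: "1 / (1 - cmod z) \<le> 2 ^ n"
  shows "integral (darc (\<tau>) 0) (\<lambda>t. \<phi> t / (cmod (cis t - z))\<^sup>2)
      \<le> (\<Sum>j\<le>n. 16 * 4 ^ j * integral (darc (\<tau>) j) \<phi>)"
proof -
  define d where "d = 1 - cmod z"
  have d: "0 < d" using z by (simp add: d_def)
  have abs: "\<phi> absolutely_integrable_on darc \<tau> 0"
    using \<phi> by (intro nonnegative_absolutely_integrable_1) auto
  have i1: "(\<lambda>t. \<phi> t / (cmod (cis t - z))\<^sup>2) integrable_on darc \<tau> 0"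
    using absolutely_integrable_kernel_mult[OF abs[unfolded darc_def] z]
    by (auto simp: darc_def intro: set_lebesgue_integral_eq_integral(1))
  have i2: "((\<lambda>t. if t \<in> darc \<tau> j then \<phi> t else 0) has_integral integral (darc \<tau> j) \<phi>) (darc \<tau> 0)" for j
  proof -
    have "\<phi> integrable_on darc \<tau> j"
      using integrable_on_subinterval[OF \<phi>(1), of "\<tau> - pi / 2 ^ j" "\<tau> + pi / 2 ^ j"] darc_antimono[of 0 j \<tau>]
      by (simp add: darc_def)
    then show ?thesis using darc_antimono[of 0 j \<tau>] by (simp add: integrable_integral)
  qed
  have i3: "((\<lambda>t. \<Sum>j\<le>n. 16 * 4 ^ j * (if t \<in> darc \<tau> j then \<phi> t else 0)) has_integral
      (\<Sum>j\<le>n. 16 * 4 ^ j * integral (darc \<tau> j) \<phi>)) (darc \<tau> 0)"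
    by (intro has_integral_sum has_integral_mult_right i2) auto
  have "integral (darc \<tau> 0) (\<lambda>t. \<phi> t / (cmod (cis t - z))\<^sup>2)
     \<le> integral (darc \<tau> 0) (\<lambda>t. \<Sum>j\<le>n. 16 * 4 ^ j * (if t \<in> darc \<tau> j then \<phi> t else 0))"
  proof (rule integral_le[OF i1])
    show "(\<lambda>t. \<Sum>j\<le>n. 16 * 4 ^ j * (if t \<in> darc \<tau> j then \<phi> t else 0)) integrable_on darc \<tau> 0"
      using i3 by blast
    fix t assume t: "t \<in> darc \<tau> 0"
    define D where "D = cmod (cis t - z)"
    have D: "d \<le> D" using norm_cis_minus_ge[OF z, of t] by (simp add: D_def d_def)
    have "\<exists>j\<le>n. t \<in> darc \<tau> j \<and> 1 / D\<^sup>2 \<le> 16 * 4 ^ j"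
    proof (cases "t \<in> darc \<tau> n")
      case True
      have "1 / D \<le> 1 / d" using D d by (intro frac_le) auto
      also have "\<dots> \<le> 2 ^ n" using n by (simp add: d_def)
      finally have "(1 / D)\<^sup>2 \<le> (2 ^ n)\<^sup>2" using D d by (intro power_mono) auto
      also have "((2::real) ^ n)\<^sup>2 = 4 ^ n" by (simp add: power_mult_distrib power2_eq_square flip: power_mult_distrib)
      also have "(4::real) ^ n \<le> 16 * 4 ^ n" by simp
      finally show ?thesis using True by (intro exI[of _ n]) (simp add: power_divide)
    next
      case False
      define J where "J = (LEAST j. t \<notin> darc \<tau> j)"
      have J: "t \<notin> darc \<tau> J" unfolding J_def by (rule LeastI[of _ n]) (rule False)
      have "J \<le> n" unfolding J_def by (rule Least_le) (rule False)
      have "J \<noteq> 0" using J t by metis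
      then obtain j where j: "J = Suc j" using not0_implies_Suc by blast
      have tj: "t \<in> darc \<tau> j" using not_less_Least[of j "\<lambda>j. t \<notin> darc \<tau> j"] j by (auto simp: J_def)
      have "pi / 2 ^ Suc j < \<bar>t - \<tau>\<bar>" using J by (auto simp: j darc_def)
      moreover have "\<bar>t - \<tau>\<bar> / 6 \<le> D"
        unfolding D_def by (rule norm_cis_minus_ge_arc[OF z z\<tau>]) (use t in \<open>auto simp: darc_def\<close>)
      moreover have "3 / 2 ^ Suc j \<le> pi / 2 ^ Suc j" using pi_gt3 by (intro divide_right_mono) auto
      ultimately have ge: "1 / (4 * 2 ^ j) \<le> D" by simp
      have "1 / D \<le> 1 / (1 / (4 * 2 ^ j))" using ge by (intro frac_le) auto
      then have "(1 / D)\<^sup>2 \<le> (4 * 2 ^ j)\<^sup>2" using D d by (intro power_mono) auto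
      also have "(4 * (2::real) ^ j)\<^sup>2 = 16 * 4 ^ j"
        by (simp add: power_mult_distrib power2_eq_square flip: power_mult_distrib)
      finally show ?thesis using tj \<open>J \<le> n\<close> j by (intro exI[of _ j]) (simp add: power_divide)
    qed
    then obtain j where j: "j \<le> n" "t \<in> darc \<tau> j" "1 / D\<^sup>2 \<le> 16 * 4 ^ j" by blast
    have "\<phi> t / D\<^sup>2 \<le> 16 * 4 ^ j * \<phi> t" using mult_right_mono[OF j(3) \<phi>(2)[of t]] by simp
    also have "\<dots> = 16 * 4 ^ j * (if t \<in> darc \<tau> j then \<phi> t else 0)" using j by simp
    also have "\<dots> \<le> (\<Sum>j\<le>n. 16 * 4 ^ j * (if t \<in> darc \<tau> j then \<phi> t else 0))"
      using j(1) \<phi>(2) by (intro member_le_sum[of j "{..n}" "\<lambda>j. 16 * 4 ^ j * (if t \<in> darc \<tau> j then \<phi> t else 0)"]) auto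
    finally show "\<phi> t / (cmod (cis t - z))\<^sup>2 \<le> (\<Sum>j\<le>n. 16 * 4 ^ j * (if t \<in> darc \<tau> j then \<phi> t else 0))"
      by (simp add: D_def)
  qed
  then show ?thesis unfolding integral_unique[OF i3] .
qed

lemma dyadic_scale:
  fixes d :: real
  assumes "0 < d" "d \<le> 1"
  shows "\<exists>n. 1 / d \<le> 2 ^ n \<and> 2 ^ n \<le> 2 / d"
proof -
  define n where "n = (LEAST n. 1 / d \<le> 2 ^ n)"
  have "\<exists>n. 1 / d < 2 ^ n" by (rule real_arch_pow) simp
  then obtain n0 where "1 / d \<le> 2 ^ n0" using less_imp_le by blast
  then have 1: "1 / d \<le> 2 ^ n" unfolding n_def by (rule LeastI)
  have "2 ^ n \<le> 2 / d"
  proof (cases n)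
    case 0
    then show ?thesis using assms by (simp add: le_divide_eq)
  next
    case (Suc k)
    then have "\<not> 1 / d \<le> 2 ^ k" using not_less_Least[of k "\<lambda>n. 1 / d \<le> 2 ^ n"] by (simp add: n_def)
    then show ?thesis using Suc by simp
  qed
  with 1 show ?thesis by blast
qed

lemma absolutely_integrable_period:
  fixes F :: "real \<Rightarrow> complex"
  assumes per: "\<And>t. F (t + 2*pi) = F t" and F: "F absolutely_integrable_on {0..2*pi}"
  shows "F absolutely_integrable_on {a..a + 2*pi}"
proof -
  have "F integrable_on {a..a + 2*pi}"
    using has_integral_period[of F, OF per] F unfolding absolutely_integrable_on_def by (meson integrable_on_def)
  moreover have "(\<lambda>t. norm (F t)) integrable_on {a..a + 2*pi}"
    using has_integral_period[of "\<lambda>t. norm (F t)"] per F unfolding absolutely_integrable_on_def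
    by (metis integrable_on_def)
  ultimately show ?thesis unfolding absolutely_integrable_on_def by blast
qed

text \<open>The induction closes exactly: raising \<open>n\<close> by one adds at most
  \<open>2 * 2 ^ Suc n\<close> to the old terms and \<open>2 ^ Suc n\<close> for the new one,
  together \<open>6 * 2 ^ n\<close>.\<close>

lemma sum_dyadic_le: "(\<Sum>j\<le>n. 2 ^ j * (1 + 2 * real (n - j))) \<le> 6 * 2 ^ n"
proof (induction n)
  case (Suc n)
  have geo: "(\<Sum>j\<le>n. (2::real) ^ j) \<le> 2 ^ Suc n" by (induction n) auto
  have "(\<Sum>j\<le>Suc n. 2 ^ j * (1 + 2 * real (Suc n - j))) = (\<Sum>j\<le>n. 2 ^ j * (1 + 2 * real (Suc n - j))) + 2 ^ Suc n"
    by simp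
  also have "(\<Sum>j\<le>n. 2 ^ j * (1 + 2 * real (Suc n - j))) = (\<Sum>j\<le>n. 2 ^ j * (1 + 2 * real (n - j)) + 2 * 2 ^ j)"
    by (rule sum.cong) (auto simp: Suc_diff_le algebra_simps)
  also have "\<dots> = (\<Sum>j\<le>n. 2 ^ j * (1 + 2 * real (n - j))) + 2 * (\<Sum>j\<le>n. 2 ^ j)"
    by (simp add: sum.distrib sum_distrib_left)
  finally show ?case using Suc geo by simp
qed simp

text \<open>The constant \<open>c\<close> is the mean over arc \<open>n\<close>, of length
  comparable with \<open>1 - cmod z\<close>. Consecutive dyadic means differ by at most
  \<open>2 * C\<close>, so replacing the mean of arc \<open>j\<close> by \<open>c\<close> costs a
  term linear in \<open>n - j\<close>, and the weighted sum remains \<open>O(2 ^ n)\<close>. The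
  product \<open>32 * 6 * 2 = 384\<close> is rounded up to 400.\<close>

lemma BMO_kernel_bound:
  fixes g :: "complex \<Rightarrow> complex"
  assumes g: "(\<lambda>t. g (cis t)) absolutely_integrable_on {0..2*pi}"
    and osc: "\<And>a b. a < b \<Longrightarrow> b \<le> a + 2*pi \<Longrightarrow>
      (LINT t:{a..b}|lebesgue. cmod (g (cis t) - arc_mean g a b)) / (b - a) \<le> C"
    and z: "z \<in> ball 0 1"
  shows "\<exists>c. integral {0..2*pi} (\<lambda>t. cmod (g (cis t) - c) / (cmod (cis t - z))\<^sup>2) \<le> 400 * pi * C / (1 - cmod z)"
proof -
  define d where "d = 1 - cmod z"
  have d: "0 < d" "d \<le> 1" using z by (auto simp: d_def)
  define \<tau> where "\<tau> = Arg z"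
  obtain n where n: "1 / d \<le> 2 ^ n" "2 ^ n \<le> 2 / d" using dyadic_scale[OF d] by blast
  have per: "g (cis (t + 2*pi)) = g (cis t)" for t by (simp flip: cis_mult)
  have gd: "(\<lambda>t. g (cis t)) absolutely_integrable_on darc \<tau> j" for j
  proof -
    have "(\<lambda>t. g (cis t)) absolutely_integrable_on {\<tau> - pi..\<tau> - pi + 2*pi}"
      by (rule absolutely_integrable_period[OF _ g]) (rule per)
    then have "(\<lambda>t. g (cis t)) absolutely_integrable_on darc \<tau> 0" by (simp add: darc_def algebra_simps)
    then show ?thesis
      using absolutely_integrable_on_subinterval darc_antimono[of 0 j \<tau>] unfolding darc_def by blast
  qed
  have gc: "(\<lambda>t. g (cis t) - c) absolutely_integrable_on darc \<tau> j" for c j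
    by (intro set_integral_diff(1) gd) (auto simp: darc_def)
  have gn: "(\<lambda>t. cmod (g (cis t) - c)) absolutely_integrable_on darc \<tau> j" for c j
    using absolutely_integrable_norm[OF gc] by (simp add: o_def)
  have gi: "(\<lambda>t. cmod (g (cis t) - c)) integrable_on darc \<tau> j" for c j
    by (rule set_lebesgue_integral_eq_integral(1)[OF gn])
  define L where "L = (\<lambda>j::nat. 2 * pi / 2 ^ j)"
  have L: "0 < L j" for j by (simp add: L_def)
  define m where "m = (\<lambda>j. arc_mean g (\<tau> - pi / 2 ^ j) (\<tau> + pi / 2 ^ j))"
  have I1: "integral (darc \<tau> j) (\<lambda>t. cmod (g (cis t) - m j)) \<le> C * L j" for j
  proof -
    have len: "(\<tau> + pi / 2 ^ j) - (\<tau> - pi / 2 ^ j) = L j" by (simp add: L_def)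
    have "L j \<le> 2 * pi / 1" unfolding L_def by (intro divide_left_mono) auto
    then have "(LINT t:darc \<tau> j|lebesgue. cmod (g (cis t) - m j)) / L j \<le> C"
      using osc[of "\<tau> - pi / 2 ^ j" "\<tau> + pi / 2 ^ j"] L[of j] len by (simp add: darc_def m_def)
    then show ?thesis using set_lebesgue_integral_eq_integral(2)[OF gn] L[of j] by (simp add: divide_le_eq)
  qed
  have step: "cmod (m (Suc j) - m j) \<le> 2 * C" for j
  proof -
    have mm: "(m (Suc j) - m j) * L (Suc j) = integral (darc \<tau> (Suc j)) (\<lambda>t. g (cis t) - m j)"
    proof -
      have "integral (darc \<tau> (Suc j)) (\<lambda>t. g (cis t) - m j)
          = integral (darc \<tau> (Suc j)) (\<lambda>t. g (cis t)) - integral (darc \<tau> (Suc j)) (\<lambda>t. m j)"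
        by (intro integral_diff set_lebesgue_integral_eq_integral(1)[OF gd]) (auto simp: darc_def)
      also have "integral (darc \<tau> (Suc j)) (\<lambda>t. m j) = m j * L (Suc j)"
        by (simp add: darc_def L_def scaleR_conv_of_real)
      also have "integral (darc \<tau> (Suc j)) (\<lambda>t. g (cis t)) = m (Suc j) * L (Suc j)"
      proof -
        have len: "(\<tau> + pi / 2 ^ j') - (\<tau> - pi / 2 ^ j') = L j'" for j' by (simp add: L_def)
        show ?thesis using L[of "Suc j"] set_lebesgue_integral_eq_integral(2)[OF gd[of "Suc j"]]
          unfolding m_def arc_mean_def len by (simp add: darc_def)
      qed
      finally show ?thesis by (simp add: algebra_simps)
    qed
    have "cmod (m (Suc j) - m j) * L (Suc j) = cmod ((m (Suc j) - m j) * L (Suc j))"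
      using L[of "Suc j"] by (simp add: norm_mult)
    also have "\<dots> \<le> integral (darc \<tau> (Suc j)) (\<lambda>t. cmod (g (cis t) - m j))"
      unfolding mm by (intro integral_norm_bound_integral set_lebesgue_integral_eq_integral(1)[OF gc] gi) auto
    also have "\<dots> \<le> integral (darc \<tau> j) (\<lambda>t. cmod (g (cis t) - m j))"
      by (intro integral_subset_le darc_antimono gi) auto
    also have "\<dots> \<le> C * L j" by (rule I1)
    \<comment> \<open>The shorter arc has half the length of the longer one, which is the origin of
      the factor 2.\<close>
    also have "\<dots> = (2 * C) * L (Suc j)" by (simp add: L_def)
    finally show ?thesis using L[of "Suc j"] by simp
  qed
  have mdiff: "cmod (m n - m j) \<le> 2 * C * real (n - j)" if "j \<le> n" for j
    using that
  proof (induction n rule: dec_induct)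
    case (step i)
    have "cmod (m (Suc i) - m j) \<le> cmod (m (Suc i) - m i) + cmod (m i - m j)"
      using norm_triangle_ineq[of "m (Suc i) - m i" "m i - m j"] by simp
    then show ?case using step \<open>\<And>j. cmod (m (Suc j) - m j) \<le> 2 * C\<close>[of i] by (simp add: Suc_diff_le algebra_simps)
  qed simp
  have I2: "integral (darc \<tau> j) (\<lambda>t. cmod (g (cis t) - m n)) \<le> C * L j * (1 + 2 * real (n - j))" if "j \<le> n" for j
  proof -
    have "integral (darc \<tau> j) (\<lambda>t. cmod (g (cis t) - m n)) \<le> integral (darc \<tau> j) (\<lambda>t. cmod (g (cis t) - m j) + 2 * C * real (n - j))"
    proof (rule integral_le[OF gi])
      show "(\<lambda>t. cmod (g (cis t) - m j) + 2 * C * real (n - j)) integrable_on darc \<tau> j"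
        by (intro integrable_add gi) (auto simp: darc_def)
      fix t
      show "cmod (g (cis t) - m n) \<le> cmod (g (cis t) - m j) + 2 * C * real (n - j)"
        using norm_triangle_ineq[of "g (cis t) - m j" "m j - m n"] mdiff[OF that] by (simp add: norm_minus_commute)
    qed
    also have "\<dots> = integral (darc \<tau> j) (\<lambda>t. cmod (g (cis t) - m j)) + integral (darc \<tau> j) (\<lambda>t. 2 * C * real (n - j))"
      by (intro integral_add gi) (auto simp: darc_def)
    also have "integral (darc \<tau> j) (\<lambda>t. 2 * C * real (n - j)) = L j * (2 * C * real (n - j))"
      by (simp add: darc_def L_def)
    finally show ?thesis using I1[of j] by (simp add: algebra_simps)
  qed
  have "0 \<le> C"
  proof -
    have "0 \<le> cmod (m 1 - m 0)" by simp
    also have "\<dots> \<le> 2 * C" using step[of 0] by simp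
    finally show ?thesis by simp
  qed
  have "integral {0..2*pi} (\<lambda>t. cmod (g (cis t) - m n) / (cmod (cis t - z))\<^sup>2)
      = integral (darc \<tau> 0) (\<lambda>t. cmod (g (cis t) - m n) / (cmod (cis t - z))\<^sup>2)"
  proof -
    have "(\<lambda>t. cmod (g (cis t) - m n)) absolutely_integrable_on {0..2*pi}"
      using absolutely_integrable_norm[OF set_integral_diff(1)[OF g, of "\<lambda>_. m n"]] by (auto simp: o_def)
    from absolutely_integrable_kernel_mult[OF this z]
    have "((\<lambda>t. cmod (g (cis t) - m n) / (cmod (cis t - z))\<^sup>2) has_integral
        integral {0..2*pi} (\<lambda>t. cmod (g (cis t) - m n) / (cmod (cis t - z))\<^sup>2)) {0..2*pi}"
      using set_lebesgue_integral_eq_integral(1) by blast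
    then have "((\<lambda>t. cmod (g (cis t) - m n) / (cmod (cis t - z))\<^sup>2) has_integral
        integral {0..2*pi} (\<lambda>t. cmod (g (cis t) - m n) / (cmod (cis t - z))\<^sup>2)) {\<tau> - pi..\<tau> - pi + 2*pi}"
      by (rule has_integral_period[rotated]) (simp flip: cis_mult)
    then show ?thesis by (simp add: darc_def algebra_simps integral_unique)
  qed
  also have "\<dots> \<le> (\<Sum>j\<le>n. 16 * 4 ^ j * integral (darc \<tau> j) (\<lambda>t. cmod (g (cis t) - m n)))"
    by (rule integral_kernel_le_dyadic) (use gi z n in \<open>auto simp: \<tau>_def d_def rcis_cmod_Arg simp flip: rcis_def\<close>)
  also have "\<dots> \<le> (\<Sum>j\<le>n. 16 * 4 ^ j * (C * L j * (1 + 2 * real (n - j))))"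
    by (intro sum_mono mult_left_mono I2) auto
  also have "\<dots> = (\<Sum>j\<le>n. 32 * pi * C * (2 ^ j * (1 + 2 * real (n - j))))"
  proof (rule sum.cong[OF refl])
    fix j
    have "(4::real) ^ j = 2 ^ j * 2 ^ j" by (simp flip: power_mult_distrib)
    then show "16 * 4 ^ j * (C * L j * (1 + 2 * real (n - j))) = 32 * pi * C * (2 ^ j * (1 + 2 * real (n - j)))"
      by (simp add: L_def)
  qed
  also have "\<dots> \<le> 32 * pi * C * (6 * 2 ^ n)"
    unfolding sum_distrib_left[symmetric] using \<open>0 \<le> C\<close> by (intro mult_left_mono sum_dyadic_le) auto
  also have "\<dots> \<le> 32 * pi * C * (6 * (2 / d))"
    using \<open>0 \<le> C\<close> n by (intro mult_left_mono) auto
  also have "\<dots> \<le> 400 * pi * C / d" using \<open>0 \<le> C\<close> d by (simp add: divide_right_mono)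
  finally show ?thesis unfolding d_def by blast
qed

theorem BMOA_imp_Bloch:
  assumes "h \<in> BMOA"
  shows "\<exists>A. \<forall>z\<in>ball 0 1. cmod (deriv h z) \<le> A / (1 - cmod z)"
proof -
  have H: "h \<in> Hardy1" using assms by (simp add: BMOA_def)
  obtain g where g: "g \<in> BMO_circle" "has_boundary_values h g" using assms by (auto simp: BMOA_def)
  have hol: "h holomorphic_on ball 0 1" using H by (simp add: Hardy1_def)
  obtain C where C: "\<And>r. r \<in> {0..<1::real} \<Longrightarrow>
      1 / (2*pi) * (LINT t:{0..2*pi}|lebesgue. cmod (h (of_real r * cis t))) \<le> C"
    using H unfolding Hardy1_def by blast
  have bd: "integral {0..2*pi} (\<lambda>t. cmod (h (of_real r * cis t))) \<le> 2*pi*C" if r: "r \<in> {0<..<1}" for r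
  proof -
    have "(\<lambda>t. cmod (h (of_real r * cis t))) absolutely_integrable_on {0..2*pi}"
      by (intro absolutely_integrable_continuous_real continuous_intros continuous_on_circle[OF hol]) (use r in auto)
    from set_lebesgue_integral_eq_integral(2)[OF this] C[of r] r show ?thesis
      by (simp add: divide_le_eq mult_ac)
  qed
  have gi: "(\<lambda>t. g (cis t)) absolutely_integrable_on {0..2*pi}" using g(1) by (simp add: BMO_circle_def)
  obtain C' where C': "\<And>a b. a < b \<Longrightarrow> b \<le> a + 2*pi \<Longrightarrow>
      (LINT t:{a..b}|lebesgue. cmod (g (cis t) - arc_mean g a b)) / (b - a) \<le> C'"
    using g(1) unfolding BMO_circle_def by blast
  have bv: "AE t in lebesgue. ((\<lambda>r::real. h (of_real r * cis t)) \<longlongrightarrow> g (cis t)) (at_left 1)"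
    using AE_circle_imp_AE_line[OF g(2)[unfolded has_boundary_values_def], of 0] by simp
  have "cmod (deriv h z) \<le> (1600 * pi * C') / (1 - cmod z)" if z: "z \<in> ball 0 1" for z
  proof -
    obtain c where c: "integral {0..2*pi} (\<lambda>t. cmod (g (cis t) - c) / (cmod (cis t - z))\<^sup>2) \<le> 400 * pi * C' / (1 - cmod z)"
      using BMO_kernel_bound[OF gi C' z] by blast
    have "cmod (deriv h z) \<le> 4 * integral {0..2*pi} (\<lambda>t. cmod (g (cis t) - c) / (cmod (cis t - z))\<^sup>2)"
      by (rule H1_deriv_bound[OF hol bd gi bv z])
    also have "\<dots> \<le> 4 * (400 * pi * C' / (1 - cmod z))" by (intro mult_left_mono c) auto
    finally show ?thesis by simp
  qed
  then show ?thesis by blast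
qed

section \<open>Radial limits\<close>

text \<open>Vitali's lemma selects disjoint intervals whose fivefold enlargements cover
  \<open>S\<close>. Each enlargement has length \<open>5 * (2 * \<rho>)\<close>, at most
  \<open>5 / \<kappa>\<close> times the integral of \<open>\<phi>\<close> over its interval, and
  these integrals add up by disjointness. As \<open>S\<close> is an arbitrary set, the bound is
  stated for a measurable cover.\<close>

lemma maximal_weak_type:
  fixes \<phi> :: "real \<Rightarrow> real"
  assumes \<phi>: "\<phi> integrable_on {A..B}" "\<And>t. 0 \<le> \<phi> t" and "0 < \<kappa>"
    and S: "\<And>x. x \<in> S \<Longrightarrow> \<exists>\<rho>. 0 < \<rho> \<and> \<rho> \<le> R \<and> {x - \<rho>..x + \<rho>} \<subseteq> {A..B} \<and>
              \<kappa> * (2 * \<rho>) \<le> integral {x - \<rho>..x + \<rho>} \<phi>"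
  shows "\<exists>T. S \<subseteq> T \<and> T \<in> lmeasurable \<and> measure lebesgue T \<le> 5 / \<kappa> * integral {A..B} \<phi>"
proof -
  obtain \<rho> where \<rho>: "\<And>x. x \<in> S \<Longrightarrow> 0 < \<rho> x \<and> \<rho> x \<le> R \<and> {x - \<rho> x..x + \<rho> x} \<subseteq> {A..B} \<and>
              \<kappa> * (2 * \<rho> x) \<le> integral {x - \<rho> x..x + \<rho> x} \<phi>"
    using S by metis
  have cover: "S \<subseteq> (\<Union>x\<in>S. cball x (\<rho> x))" using \<rho> by (force intro: less_imp_le)
  obtain C where C: "countable C" "C \<subseteq> S"
     "pairwise (\<lambda>i j. disjnt (cball i (\<rho> i)) (cball j (\<rho> j))) C"
     "S \<subseteq> (\<Union>i\<in>C. cball i (5 * \<rho> i))"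
    by (rule Vitali_covering_lemma_cballs[OF cover, of R]) (use \<rho> in auto)
  \<comment> \<open>Finite subfamilies first: the bound does not depend on \<open>F\<close>, so it
    passes to the increasing countable union.\<close>
  have fin: "measure lebesgue (\<Union>x\<in>F. cball x (5 * \<rho> x)) \<le> 5 / \<kappa> * integral {A..B} \<phi>"
    if F: "finite F" "F \<subseteq> C" for F
  proof -
    have int: "\<phi> integrable_on cball x (\<rho> x)" if "x \<in> F" for x
      using integrable_on_subinterval[OF \<phi>(1), of "x - \<rho> x" "x + \<rho> x"] \<rho>[of x] that F C(2)
      by (auto simp: cball_eq_atLeastAtMost)
    have "measure lebesgue (\<Union>x\<in>F. cball x (5 * \<rho> x)) \<le> (\<Sum>x\<in>F. measure lebesgue (cball x (5 * \<rho> x)))"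
      by (rule measure_UNION_le[OF F(1)]) auto
    also have "\<dots> \<le> (\<Sum>x\<in>F. 5 / \<kappa> * integral (cball x (\<rho> x)) \<phi>)"
    proof (rule sum_mono)
      fix x assume "x \<in> F"
      then have x: "0 < \<rho> x" "\<kappa> * (2 * \<rho> x) \<le> integral (cball x (\<rho> x)) \<phi>"
        using \<rho>[of x] F C(2) by (auto simp: cball_eq_atLeastAtMost)
      have "measure lebesgue (cball x (5 * \<rho> x)) = 10 * \<rho> x"
        using x(1) by (simp add: cball_eq_atLeastAtMost)
      also have "\<dots> = 5 / \<kappa> * (\<kappa> * (2 * \<rho> x))" using \<open>0 < \<kappa>\<close> by simp
      also have "\<dots> \<le> 5 / \<kappa> * integral (cball x (\<rho> x)) \<phi>"
        using x(2) \<open>0 < \<kappa>\<close> by (intro mult_left_mono) auto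
      finally show "measure lebesgue (cball x (5 * \<rho> x)) \<le> 5 / \<kappa> * integral (cball x (\<rho> x)) \<phi>" .
    qed
    also have "\<dots> = 5 / \<kappa> * (\<Sum>x\<in>F. integral (cball x (\<rho> x)) \<phi>)" by (simp add: sum_distrib_left)
    also have "\<dots> \<le> 5 / \<kappa> * integral {A..B} \<phi>"
    proof (intro mult_left_mono)
      have "pairwise (\<lambda>i j. negligible (cball i (\<rho> i) \<inter> cball j (\<rho> j))) F"
        using C(3) F(2) by (auto simp: pairwise_def disjnt_def) (metis negligible_empty subsetD)
      then have U: "(\<phi> has_integral (\<Sum>x\<in>F. integral (cball x (\<rho> x)) \<phi>)) (\<Union>x\<in>F. cball x (\<rho> x))"
        by (intro has_integral_UN F(1)) (use int in auto)
      show "(\<Sum>x\<in>F. integral (cball x (\<rho> x)) \<phi>) \<le> integral {A..B} \<phi>"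
      proof (rule has_integral_subset_le[OF _ U])
        show "(\<Union>x\<in>F. cball x (\<rho> x)) \<subseteq> {A..B}"
          using \<rho> F(2) C(2) by (force simp: cball_eq_atLeastAtMost)
      qed (use \<phi> in auto)
    qed (use \<open>0 < \<kappa>\<close> in auto)
    finally show ?thesis .
  qed
  show ?thesis
  proof (cases "C = {}")
    case True
    have "0 \<le> integral {A..B} \<phi>" by (rule integral_nonneg) (use \<phi> in auto)
    then show ?thesis using C(4) True \<open>0 < \<kappa>\<close> by (intro exI[of _ "{}"]) auto
  next
    case False
    define c where "c = from_nat_into C"
    have c: "range c = C" unfolding c_def by (rule range_from_nat_into[OF False C(1)])
    define T where "T = (\<Union>n. cball (c n) (5 * \<rho> (c n)))"
    have bd: "measure lebesgue (\<Union>i\<le>n. cball (c i) (5 * \<rho> (c i))) \<le> 5 / \<kappa> * integral {A..B} \<phi>" for n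
      using fin[of "c ` {..n}"] c by auto
    have "T \<in> lmeasurable" unfolding T_def by (rule fmeasurable_countable_Union[OF _ bd]) auto
    moreover have "measure lebesgue T \<le> 5 / \<kappa> * integral {A..B} \<phi>"
      unfolding T_def by (rule measure_countable_Union_le[OF _ bd]) auto
    moreover have "S \<subseteq> T" using C(4) c unfolding T_def by blast
    ultimately show ?thesis by blast
  qed
qed

text \<open>Cauchy's formula for \<open>W w / (1 - cnj z * w)\<close> at \<open>w = z\<close>
  produces \<open>W z / (1 - (cmod z)\<^sup>2)\<close>, while on the circle the new denominator has
  modulus \<open>cmod (cis t - z)\<close>; so the Poisson kernel appears. Then
  \<open>1 - (cmod z)\<^sup>2 \<le> 2 * (1 - cmod z)\<close> turns \<open>1 / (2*pi)\<close> into
  \<open>1 / pi\<close>.\<close>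

lemma Poisson_type_bound:
  fixes W :: "complex \<Rightarrow> complex"
  assumes cont: "continuous_on (cball 0 1) W" and hol: "W holomorphic_on ball 0 1" and z: "z \<in> ball 0 1"
  shows "cmod (W z) \<le> (1 - cmod z) / pi * integral {0..2*pi} (\<lambda>t. cmod (W (cis t)) / (cmod (cis t - z))\<^sup>2)"
proof -
  have nz: "1 - cnj z * x \<noteq> 0" if "x \<in> cball 0 1" for x
  proof
    assume "1 - cnj z * x = 0"
    then have "cnj z * x = 1" by simp
    then have "cmod z * cmod x = 1" by (metis complex_mod_cnj norm_mult norm_one)
    moreover have "cmod z * cmod x \<le> cmod z * 1" using that by (intro mult_left_mono) auto
    ultimately show False using z by simp
  qed
  define H where "H = (\<lambda>w. W w / (1 - cnj z * w))"
  have "((\<lambda>t. H (of_real 1 * cis t) * (of_real 1 * cis t) / (of_real 1 * cis t - z) ^ Suc 0)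
     has_integral (2*pi / fact 0 * (deriv ^^ 0) H z)) {0..2*pi}"
  proof (rule Cauchy_circle)
    show "continuous_on (cball 0 1) H" unfolding H_def using cont nz by (intro continuous_intros) auto
    show "H holomorphic_on ball 0 1" unfolding H_def using hol nz by (intro holomorphic_intros) auto
  qed (rule z)
  then have I: "((\<lambda>t. H (cis t) * cis t / (cis t - z)) has_integral (2*pi * H z)) {0..2*pi}" by simp
  have contc: "continuous_on {0..2*pi} (\<lambda>t. cmod (W (cis t)))"
    by (intro continuous_intros continuous_on_compose2[OF cont]) auto
  have "norm (2*pi * H z) \<le> integral {0..2*pi} (\<lambda>t. cmod (W (cis t)) / (cmod (cis t - z))\<^sup>2)"
    unfolding integral_unique[OF I, symmetric]
  proof (rule integral_norm_bound_integral)
    show "(\<lambda>t. H (cis t) * cis t / (cis t - z)) integrable_on {0..2*pi}" using I by blast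
    show "(\<lambda>t. cmod (W (cis t)) / (cmod (cis t - z))\<^sup>2) integrable_on {0..2*pi}"
      by (intro set_lebesgue_integral_eq_integral(1)[OF absolutely_integrable_kernel_mult[OF _ z]]
          absolutely_integrable_continuous_real contc)
    fix t :: real
    have "1 - cnj z * cis t = cis t * cnj (cis t - z)"
      using complex_norm_square[of "cis t"] by (simp add: algebra_simps)
    then have "cmod (1 - cnj z * cis t) = cmod (cis t - z)" by (metis norm_cis complex_mod_cnj mult_1 norm_mult)
    then show "norm (H (cis t) * cis t / (cis t - z)) \<le> cmod (W (cis t)) / (cmod (cis t - z))\<^sup>2"
      by (simp add: H_def norm_mult norm_divide power2_eq_square)
  qed
  also have "norm (2*pi * H z) = 2*pi * cmod (W z) / cmod (1 - cnj z * z)" by (simp add: H_def norm_mult norm_divide)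
  also have "1 - cnj z * z = of_real (1 - (cmod z)\<^sup>2)" using complex_norm_square[of z] by (simp add: mult.commute)
  also have "cmod (of_real (1 - (cmod z)\<^sup>2)) = 1 - (cmod z)\<^sup>2"
    using z by (simp only: norm_of_real) (simp add: abs_square_le_1)
  finally have le: "2*pi * cmod (W z) / (1 - (cmod z)\<^sup>2)
      \<le> integral {0..2*pi} (\<lambda>t. cmod (W (cis t)) / (cmod (cis t - z))\<^sup>2)" (is "_ \<le> ?I") .
  have "(cmod z)\<^sup>2 < 1" using z by (simp add: power_less_one_iff)
  then have "2*pi * cmod (W z) \<le> ?I * (1 - (cmod z)\<^sup>2)" using le by (simp add: divide_le_eq)
  also have "\<dots> \<le> ?I * (2 * (1 - cmod z))"
  proof (rule mult_left_mono)
    have "0 \<le> (1 - cmod z)\<^sup>2" by simp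
    then show "1 - (cmod z)\<^sup>2 \<le> 2 * (1 - cmod z)" by (simp add: power2_eq_square algebra_simps)
    show "0 \<le> ?I" using order_trans[OF _ le] \<open>(cmod z)\<^sup>2 < 1\<close> by simp
  qed
  finally show ?thesis by (simp add: field_simps)
qed

text \<open>By contraposition: if all dyadic arcs around \<open>t\<close> had small averages of
  \<open>cmod w\<close> at radius \<open>\<rho>\<close>, the Poisson bound would keep
  \<open>cmod w\<close> at most \<open>\<kappa>\<close> along the ray up to \<open>\<rho>\<close>.
  Arcs around points of \<open>{0..2*pi}\<close> reach into \<open>{-pi..3*pi}\<close>, which is two
  periods; hence \<open>1280 = 5 * 128 * 2\<close>.\<close>

lemma radial_maximal_at_radius:
  fixes w :: "complex \<Rightarrow> complex"
  assumes hol: "w holomorphic_on ball 0 1" and "0 < \<kappa>" and \<rho>: "0 < \<rho>" "\<rho> < 1"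
  defines "S \<equiv> {t \<in> {0..2*pi}. \<exists>r\<in>{0<..<\<rho>}. \<kappa> < cmod (w (of_real r * cis t))}"
  shows "S \<in> lmeasurable \<and> measure lebesgue S \<le> 1280 / \<kappa> * integral {0..2*pi} (\<lambda>t. cmod (w (of_real \<rho> * cis t)))"
proof -
  define \<phi> where "\<phi> = (\<lambda>t. cmod (w (of_real \<rho> * cis t)))"
  have c\<phi>: "continuous_on A \<phi>" for A
    unfolding \<phi>_def by (intro continuous_intros continuous_on_circle[OF hol]) (use \<rho> in auto)
  have i\<phi>: "\<phi> integrable_on {a..b}" for a b by (rule integrable_continuous_real[OF c\<phi>])
  have per: "\<phi> (t + 2*pi) = \<phi> t" for t unfolding \<phi>_def by (simp flip: cis_mult)
  have P: "(\<phi> has_integral integral {0..2*pi} \<phi>) {a..a + 2*pi}" for a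
    by (rule has_integral_period[of \<phi>, OF per]) (use i\<phi> in blast)
  have I2: "integral {-pi..3*pi} \<phi> = 2 * integral {0..2*pi} \<phi>"
  proof -
    have "(\<phi> has_integral integral {0..2*pi} \<phi>) {-pi..pi}" using P[of "-pi"] by simp
    moreover have "(\<phi> has_integral integral {0..2*pi} \<phi>) {pi..3*pi}" using P[of pi] by simp
    ultimately have "(\<phi> has_integral integral {0..2*pi} \<phi> + integral {0..2*pi} \<phi>) {-pi..3*pi}"
      by (rule has_integral_combine[rotated 2]) auto
    then show ?thesis by (simp add: integral_unique)
  qed
  have "\<exists>T. S \<subseteq> T \<and> T \<in> lmeasurable \<and> measure lebesgue T \<le> 5 / (\<kappa> / 128) * integral {-pi..3*pi} \<phi>"
  proof (rule maximal_weak_type[OF i\<phi>, of _ _ pi])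
    fix t assume "t \<in> S"
    then obtain r where r: "0 < r" "r < \<rho>" "\<kappa> < cmod (w (of_real r * cis t))" and t: "t \<in> {0..2*pi}"
      by (auto simp: S_def)
    \<comment> \<open>The choice of 128 makes the dyadic sum at most
      \<open>\<kappa> * pi / d\<close>, which the factor \<open>d / pi\<close> before the Poisson
      integral reduces to \<open>\<kappa>\<close>.\<close>
    have "\<exists>j. \<kappa> / 128 * (2 * (pi / 2 ^ j)) \<le> integral (darc t j) \<phi>"
    proof (rule ccontr)
      assume "\<not> ?thesis"
      then have small: "integral (darc t j) \<phi> \<le> \<kappa> / 128 * (2 * (pi / 2 ^ j))" for j
        by (meson not_le_imp_less less_imp_le)
      define W where "W = (\<lambda>z. w (of_real \<rho> * z))"
      define z where "z = of_real (r / \<rho>) * cis t"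
      have nz: "cmod z = r / \<rho>" using r \<rho> by (simp add: z_def norm_mult norm_divide)
      have z: "z \<in> ball 0 1" using r \<rho> nz by simp
      have zt: "z = of_real (cmod z) * cis t" unfolding nz by (simp add: z_def)
      have cW: "continuous_on (cball 0 1) W"
      proof -
        have "continuous_on (ball 0 1) w" using hol by (rule holomorphic_on_imp_continuous_on)
        then show ?thesis unfolding W_def
        proof (rule continuous_on_compose2)
          show "(*) (complex_of_real \<rho>) ` cball 0 1 \<subseteq> ball 0 1"
          proof clarsimp
            fix x :: complex assume "cmod x \<le> 1"
            then have "\<rho> * cmod x \<le> \<rho> * 1" using \<rho> by (intro mult_left_mono) auto
            then have "\<rho> * cmod x < 1" using \<rho> by linarith
            then show "cmod (of_real \<rho> * x) < 1" using \<rho> by (simp add: norm_mult)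
          qed
        qed (intro continuous_intros)
      qed
      have hW: "W holomorphic_on ball 0 1"
      proof -
        have "(w \<circ> (\<lambda>z. of_real \<rho> * z)) holomorphic_on ball 0 1"
        proof (rule holomorphic_on_compose_gen[OF _ hol])
          show "(*) (complex_of_real \<rho>) ` ball 0 1 \<subseteq> ball 0 1"
          proof clarsimp
            fix x :: complex assume "cmod x < 1"
            moreover have "\<rho> * cmod x \<le> 1 * cmod x" using \<rho> by (intro mult_right_mono) auto
            ultimately show "cmod (of_real \<rho> * x) < 1" using \<rho> by (simp add: norm_mult)
          qed
        qed (intro holomorphic_intros)
        then show ?thesis by (simp add: W_def o_def)
      qed
      define d where "d = 1 - cmod z"
      have d: "0 < d" "d \<le> 1" using z by (auto simp: d_def)
      obtain n where n: "1 / d \<le> 2 ^ n" "2 ^ n \<le> 2 / d" using dyadic_scale[OF d] by blast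
      have W\<phi>: "cmod (W (cis s)) = \<phi> s" for s by (simp add: W_def \<phi>_def)
      have "integral {0..2*pi} (\<lambda>s. \<phi> s / (cmod (cis s - z))\<^sup>2) = integral (darc t 0) (\<lambda>s. \<phi> s / (cmod (cis s - z))\<^sup>2)"
      proof -
        have "(\<lambda>s. \<phi> s / (cmod (cis s - z))\<^sup>2) integrable_on {0..2*pi}"
          by (intro set_lebesgue_integral_eq_integral(1)[OF absolutely_integrable_kernel_mult[OF _ z]]
              absolutely_integrable_continuous_real c\<phi>)
        then have "((\<lambda>s. \<phi> s / (cmod (cis s - z))\<^sup>2) has_integral
            integral {0..2*pi} (\<lambda>s. \<phi> s / (cmod (cis s - z))\<^sup>2)) {t - pi..t - pi + 2*pi}"
          by (intro has_integral_period) (auto simp: per simp flip: cis_mult)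
        then show ?thesis by (simp add: darc_def algebra_simps integral_unique)
      qed
      also have "\<dots> \<le> (\<Sum>j\<le>n. 16 * 4 ^ j * integral (darc t j) \<phi>)"
        by (rule integral_kernel_le_dyadic[OF _ _ z zt]) (use i\<phi> n in \<open>auto simp: darc_def d_def \<phi>_def\<close>)
      also have "\<dots> \<le> (\<Sum>j\<le>n. 16 * 4 ^ j * (\<kappa> / 128 * (2 * (pi / 2 ^ j))))"
        by (intro sum_mono mult_left_mono small) auto
      also have "\<dots> = (\<Sum>j\<le>n. \<kappa> * pi / 4 * 2 ^ j)"
      proof (rule sum.cong[OF refl])
        fix j
        have "(4::real) ^ j = 2 ^ j * 2 ^ j" by (simp flip: power_mult_distrib)
        then show "16 * 4 ^ j * (\<kappa> / 128 * (2 * (pi / 2 ^ j))) = \<kappa> * pi / 4 * 2 ^ j" by simp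
      qed
      also have "\<dots> \<le> \<kappa> * pi / 4 * 2 ^ Suc n"
      proof -
        have "(\<Sum>j\<le>n. (2::real) ^ j) \<le> 2 ^ Suc n" by (induction n) auto
        then show ?thesis unfolding sum_distrib_left[symmetric] using \<open>0 < \<kappa>\<close> by (intro mult_left_mono) auto
      qed
      also have "\<dots> \<le> \<kappa> * pi / 4 * (2 * (2 / d))" using n(2) \<open>0 < \<kappa>\<close> by (intro mult_left_mono) auto
      finally have I: "integral {0..2*pi} (\<lambda>s. \<phi> s / (cmod (cis s - z))\<^sup>2) \<le> \<kappa> * pi / d" using d by simp
      have "cmod (W z) \<le> d / pi * integral {0..2*pi} (\<lambda>s. \<phi> s / (cmod (cis s - z))\<^sup>2)"
        using Poisson_type_bound[OF cW hW z] by (simp add: W\<phi> d_def)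
      also have "\<dots> \<le> d / pi * (\<kappa> * pi / d)" using I d by (intro mult_left_mono) auto
      also have "\<dots> = \<kappa>" using d by simp
      finally show False using r \<rho> by (simp add: W_def z_def)
    qed
    then obtain j where j: "\<kappa> / 128 * (2 * (pi / 2 ^ j)) \<le> integral (darc t j) \<phi>" by blast
    have le: "pi / 2 ^ j \<le> pi" by (simp add: divide_le_eq)
    show "\<exists>\<rho>>0. \<rho> \<le> pi \<and> {t - \<rho>..t + \<rho>} \<subseteq> {-pi..3*pi} \<and> \<kappa> / 128 * (2 * \<rho>) \<le> integral {t - \<rho>..t + \<rho>} \<phi>"
      by (rule exI[of _ "pi / 2 ^ j"]) (use j le t in \<open>auto simp: darc_def\<close>)
  qed (use \<open>0 < \<kappa>\<close> in \<open>auto simp: \<phi>_def\<close>)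
  then obtain T where T: "S \<subseteq> T" "T \<in> lmeasurable" "measure lebesgue T \<le> 640 / \<kappa> * integral {-pi..3*pi} \<phi>"
    by (auto simp: field_simps)
  have "S \<in> sets lebesgue"
  proof -
    have "open (\<Union>r\<in>{0<..<\<rho>}. {t. \<kappa> < cmod (w (of_real r * cis t))})"
    proof (intro open_UN ballI open_Collect_less continuous_intros)
      fix r assume "r \<in> {0<..<\<rho>}"
      then show "continuous_on UNIV (\<lambda>t. w (of_real r * cis t))"
        by (intro continuous_on_circle[OF hol]) (use \<rho> in auto)
    qed
    then have "(\<Union>r\<in>{0<..<\<rho>}. {t. \<kappa> < cmod (w (of_real r * cis t))}) \<in> sets lebesgue"
      by (simp add: borel_open)
    moreover have "S = {0..2*pi} \<inter> (\<Union>r\<in>{0<..<\<rho>}. {t. \<kappa> < cmod (w (of_real r * cis t))})"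
      by (auto simp: S_def)
    ultimately show ?thesis by auto
  qed
  then have "S \<in> lmeasurable" "measure lebesgue S \<le> measure lebesgue T"
    using T fmeasurableI2 measure_mono_fmeasurable by blast+
  then show ?thesis using T(3) I2 by (simp add: \<phi>_def)
qed

text \<open>Exhaustion by radii increasing to 1, with increasing bad sets. The integral bound is
  asked only near radius 1, where smallness in mean is available.\<close>

lemma radial_maximal_weak_type:
  fixes w :: "complex \<Rightarrow> complex"
  assumes hol: "w holomorphic_on ball 0 1" and "0 < \<kappa>" and \<rho>0: "\<rho>0 < 1"
    and \<eta>: "\<And>\<rho>. 0 < \<rho> \<Longrightarrow> \<rho>0 < \<rho> \<Longrightarrow> \<rho> < 1 \<Longrightarrow> integral {0..2*pi} (\<lambda>t. cmod (w (of_real \<rho> * cis t))) \<le> \<eta>"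
  defines "S \<equiv> {t \<in> {0..2*pi}. \<exists>r\<in>{0<..<1}. \<kappa> < cmod (w (of_real r * cis t))}"
  shows "S \<in> lmeasurable \<and> measure lebesgue S \<le> 1280 / \<kappa> * \<eta>"
proof -
  define \<rho>1 where "\<rho>1 = max \<rho>0 0"
  define \<rho> where "\<rho> = (\<lambda>n::nat. 1 - (1 - \<rho>1) / (real n + 2))"
  have \<rho>1: "0 \<le> \<rho>1" "\<rho>1 < 1" "\<rho>0 \<le> \<rho>1" using \<rho>0 by (auto simp: \<rho>1_def)
  have \<rho>: "\<rho>1 < \<rho> n" "\<rho> n < 1" for n
  proof -
    have "(1 - \<rho>1) / (real n + 2) < 1 - \<rho>1" using \<rho>1 by (simp add: divide_less_eq)
    then show "\<rho>1 < \<rho> n" by (simp add: \<rho>_def)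
    show "\<rho> n < 1" using \<rho>1 by (simp add: \<rho>_def)
  qed
  have mono: "\<rho> m \<le> \<rho> n" if "m \<le> n" for m n
    unfolding \<rho>_def using that \<rho>1 by (auto intro!: divide_left_mono)
  have lim: "\<rho> \<longlonglongrightarrow> 1" unfolding \<rho>_def by real_asymp
  define Sn where "Sn = (\<lambda>n. {t \<in> {0..2*pi}. \<exists>r\<in>{0<..<\<rho> n}. \<kappa> < cmod (w (of_real r * cis t))})"
  have Sn: "Sn n \<in> lmeasurable" "measure lebesgue (Sn n) \<le> 1280 / \<kappa> * \<eta>" for n
  proof -
    have *: "0 < \<rho> n" "\<rho>0 < \<rho> n" "\<rho> n < 1" using \<rho>[of n] \<rho>1 by auto
    have "Sn n \<in> lmeasurable \<and> measure lebesgue (Sn n) \<le> 1280 / \<kappa> * integral {0..2*pi} (\<lambda>t. cmod (w (of_real (\<rho> n) * cis t)))"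
      unfolding Sn_def by (rule radial_maximal_at_radius[OF hol \<open>0 < \<kappa>\<close>]) (use * in auto)
    moreover have "1280 / \<kappa> * integral {0..2*pi} (\<lambda>t. cmod (w (of_real (\<rho> n) * cis t))) \<le> 1280 / \<kappa> * \<eta>"
      using \<open>0 < \<kappa>\<close> by (intro mult_left_mono \<eta> *) auto
    ultimately show "Sn n \<in> lmeasurable" "measure lebesgue (Sn n) \<le> 1280 / \<kappa> * \<eta>" by auto
  qed
  have SU: "S = (\<Union>n. Sn n)"
  proof
    show "S \<subseteq> (\<Union>n. Sn n)"
    proof
      fix t assume "t \<in> S"
      then obtain r where r: "t \<in> {0..2*pi}" "0 < r" "r < 1" "\<kappa> < cmod (w (of_real r * cis t))" by (auto simp: S_def)
      obtain n where "r < \<rho> n" using order_tendstoD(1)[OF lim r(3)] by (auto simp: eventually_sequentially)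
      then have "t \<in> Sn n" using r by (auto simp: Sn_def)
      then show "t \<in> (\<Union>n. Sn n)" by blast
    qed
    show "(\<Union>n. Sn n) \<subseteq> S"
    proof
      fix t assume "t \<in> (\<Union>n. Sn n)"
      then obtain n r where "t \<in> {0..2*pi}" "0 < r" "r < \<rho> n" "\<kappa> < cmod (w (of_real r * cis t))" by (auto simp: Sn_def)
      then show "t \<in> S" using \<rho>(2)[of n] unfolding S_def by (intro CollectI conjI bexI[of _ r]) auto
    qed
  qed
  have "(\<Union>i\<le>n. Sn i) = Sn n" for n
  proof
    show "(\<Union>i\<le>n. Sn i) \<subseteq> Sn n"
    proof
      fix t assume "t \<in> (\<Union>i\<le>n. Sn i)"
      then obtain i r where "i \<le> n" "t \<in> {0..2*pi}" "0 < r" "r < \<rho> i" "\<kappa> < cmod (w (of_real r * cis t))" by (auto simp: Sn_def)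
      then show "t \<in> Sn n" using mono[of i n] unfolding Sn_def by (intro CollectI conjI bexI[of _ r]) auto
    qed
  qed auto
  then have bd: "measure lebesgue (\<Union>i\<le>n. Sn i) \<le> 1280 / \<kappa> * \<eta>" for n using Sn(2) by simp
  show ?thesis unfolding SU
    using fmeasurable_countable_Union[OF Sn(1) bd] measure_countable_Union_le[OF Sn(1) bd] by blast
qed

text \<open>The difference \<open>f z - f (s * z)\<close> is small in mean near the circle, so by
  the weak type inequality it is at most \<open>\<kappa>\<close> along all rays outside a set of
  measure at most \<open>e\<close>. The dilate is continuous up to the circle and eventually
  oscillates by less than \<open>\<kappa>\<close>; two differences and one oscillation make
  \<open>3 * \<kappa>\<close>.\<close>

lemma radial_oscillation_negligible:
  fixes f :: "complex \<Rightarrow> complex"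
  assumes hol: "f holomorphic_on ball 0 1"
    and C: "\<And>r. r\<in>{0<..<1} \<Longrightarrow> integral {0..2*pi} (\<lambda>t. cmod (f (of_real r * cis t))) \<le> C"
    and "0 < \<kappa>"
  shows "negligible {t \<in> {0..2*pi}. \<not> (\<exists>r0. 0 < r0 \<and> r0 < 1 \<and> (\<forall>r s. r0 < r \<longrightarrow> r < 1 \<longrightarrow> r0 < s \<longrightarrow> s < 1 \<longrightarrow>
            cmod (f (of_real r * cis t) - f (of_real s * cis t)) \<le> 3 * \<kappa>))}" (is "negligible ?Bad")
  unfolding negligible_outer_le
proof (intro allI impI)
  fix e :: real assume "0 < e"
  define \<eta> where "\<eta> = e * \<kappa> / 1280"
  have "0 < \<eta>" using \<open>0 < e\<close> \<open>0 < \<kappa>\<close> by (simp add: \<eta>_def)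
  obtain r0 where r0: "0 < r0" "r0 < 1" and L1: "\<And>r s. r0 < r \<Longrightarrow> r < 1 \<Longrightarrow> r0 < s \<Longrightarrow> s < 1 \<Longrightarrow>
     integral {0..2*pi} (\<lambda>t. cmod (f (of_real r * cis t) - f (of_real s * cis t))) \<le> \<eta>"
    using H1_imp_L1_Cauchy[OF hol C \<open>0 < \<eta>\<close>] by blast
  define s where "s = (1 + r0) / 2"
  have s: "0 < s" "s < 1" "r0 < s" using r0 by (auto simp: s_def)
  define w where "w = (\<lambda>z. f z - f (of_real s * z))"
  have sb: "of_real s * z \<in> ball 0 1" if "z \<in> ball 0 1" for z :: complex
  proof -
    have "s * cmod z \<le> 1 * cmod z" using s by (intro mult_right_mono) auto
    then show ?thesis using that s by (simp add: norm_mult)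
  qed
  have holw: "w holomorphic_on ball 0 1"
  proof -
    have "(f \<circ> (\<lambda>z. of_real s * z)) holomorphic_on ball 0 1"
      by (rule holomorphic_on_compose_gen[OF _ hol]) (use sb in \<open>auto intro!: holomorphic_intros\<close>)
    then show ?thesis unfolding w_def using hol by (auto simp: o_def intro!: holomorphic_intros)
  qed
  define S where "S = {t \<in> {0..2*pi}. \<exists>r\<in>{0<..<1}. \<kappa> < cmod (w (of_real r * cis t))}"
  have S: "S \<in> lmeasurable \<and> measure lebesgue S \<le> 1280 / \<kappa> * \<eta>"
    unfolding S_def
  \<comment> \<open>Beyond \<open>r0 / s\<close> both radii \<open>\<rho>\<close> and
    \<open>\<rho> * s\<close> exceed \<open>r0\<close>, so the mean Cauchy condition applies to the
    pair.\<close>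
  proof (rule radial_maximal_weak_type[OF holw \<open>0 < \<kappa>\<close>, of "r0 / s"])
    show "r0 / s < 1" using s by simp
    fix \<rho> assume \<rho>: "0 < \<rho>" "r0 / s < \<rho>" "\<rho> < 1"
    have 1: "r0 < \<rho> * s" using \<rho>(2) s by (simp add: divide_less_eq)
    also have "\<rho> * s \<le> \<rho> * 1" using \<rho> s by (intro mult_left_mono) auto
    finally have 2: "r0 < \<rho>" by simp
    have "\<rho> * s < 1" using \<open>\<rho> * s \<le> \<rho> * 1\<close> \<rho>(3) by linarith
    from L1[OF 2 \<rho>(3) 1 this]
    show "integral {0..2*pi} (\<lambda>t. cmod (w (of_real \<rho> * cis t))) \<le> \<eta>"
      by (simp add: w_def mult_ac)
  qed
  have "?Bad \<subseteq> S"
  proof (rule ccontr)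
    assume "\<not> ?Bad \<subseteq> S"
    then obtain t where t: "t \<in> ?Bad" "t \<notin> S" by blast
    then have le: "cmod (w (of_real r * cis t)) \<le> \<kappa>" if "0 < r" "r < 1" for r
      using that by (auto simp: S_def not_less)
    have "continuous_on (ball 0 1) f" using hol by (rule holomorphic_on_imp_continuous_on)
    moreover have "((\<lambda>r::real. of_real s * (of_real r * cis t)) \<longlongrightarrow> of_real s * (of_real 1 * cis t)) (at_left 1)"
      by (intro tendsto_intros)
    moreover have "of_real s * (of_real 1 * cis t) \<in> ball 0 1" using s by (simp add: norm_mult)
    moreover have "\<forall>\<^sub>F r in at_left 1. of_real s * (of_real r * cis t) \<in> ball 0 1"
      using eventually_at_left_real[of 0 "1::real", OF zero_less_one]
      by eventually_elim (intro sb, auto simp: norm_mult)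
    ultimately have "((\<lambda>r::real. f (of_real s * (of_real r * cis t))) \<longlongrightarrow> f (of_real s * (of_real 1 * cis t))) (at_left 1)"
      by (rule continuous_on_tendsto_compose)
    then have "\<forall>\<^sub>F r in at_left 1. dist (f (of_real s * (of_real r * cis t))) (f (of_real s * (of_real 1 * cis t))) < \<kappa> / 2"
      by (rule tendstoD) (use \<open>0 < \<kappa>\<close> in simp)
    then obtain r1 where r1: "r1 < 1" "\<And>r. r1 < r \<Longrightarrow> r < 1 \<Longrightarrow>
       dist (f (of_real s * (of_real r * cis t))) (f (of_real s * (of_real 1 * cis t))) < \<kappa> / 2"
      unfolding eventually_at_left_field by auto
    define r2 where "r2 = max r1 (1/2)"
    have r2: "0 < r2" "r2 < 1" "r1 \<le> r2" using r1 by (auto simp: r2_def)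
    have "cmod (f (of_real r * cis t) - f (of_real r' * cis t)) \<le> 3 * \<kappa>"
      if r: "r2 < r" "r < 1" and r': "r2 < r'" "r' < 1" for r r'
    proof -
      let ?a = "f (of_real s * (of_real r * cis t))" and ?b = "f (of_real s * (of_real r' * cis t))"
      have "dist ?a ?b < \<kappa>"
        by (rule dist_triangle_half_l[OF r1(2) r1(2)]) (use r r' r2 in auto)
      moreover have "cmod (f (of_real r * cis t) - ?a) \<le> \<kappa>"
        using le[of r] r r2 by (simp add: w_def)
      moreover have "cmod (?b - f (of_real r' * cis t)) \<le> \<kappa>"
        using le[of r'] r' r2 by (simp add: w_def norm_minus_commute)
      moreover have "f (of_real r * cis t) - f (of_real r' * cis t)
          = (f (of_real r * cis t) - ?a) + (?a - ?b) + (?b - f (of_real r' * cis t))" by simp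
      then have "cmod (f (of_real r * cis t) - f (of_real r' * cis t))
          \<le> cmod (f (of_real r * cis t) - ?a) + cmod (?a - ?b) + cmod (?b - f (of_real r' * cis t))"
        by (metis norm_triangle_ineq norm_triangle_le add_mono order_refl)
      ultimately show ?thesis by (simp add: dist_norm)
    qed
    then show False using t(1) r2 by blast
  qed
  moreover have "measure lebesgue S \<le> e" using S \<open>0 < \<kappa>\<close> by (simp add: \<eta>_def)
  ultimately show "\<exists>T. ?Bad \<subseteq> T \<and> T \<in> lmeasurable \<and> measure lebesgue T \<le> e" using S by blast
qed

text \<open>Cauchy's criterion with countably many tolerances, so that the exceptional sets of rays
  can be united.\<close>

lemma tendsto_at_left_1_Cauchy:
  fixes p :: "real \<Rightarrow> complex"
  assumes Cau: "\<And>n::nat. \<exists>r0. 0 < r0 \<and> r0 < 1 \<and> (\<forall>r s. r0 < r \<longrightarrow> r < 1 \<longrightarrow> r0 < s \<longrightarrow> s < 1 \<longrightarrow>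
            cmod (p r - p s) \<le> 3 * (1 / (real n + 1)))"
  shows "\<exists>l. (p \<longlongrightarrow> l) (at_left 1)"
proof -
  have eps: "\<exists>r0. 0 < r0 \<and> r0 < 1 \<and> (\<forall>r s. r0 < r \<longrightarrow> r < 1 \<longrightarrow> r0 < s \<longrightarrow> s < 1 \<longrightarrow> cmod (p r - p s) \<le> e)"
    if "0 < e" for e
  proof -
    have "0 < e / 3" using that by simp
    then obtain n :: nat where "inverse (real (Suc n)) < e / 3" using reals_Archimedean by blast
    then have "3 * (1 / (real n + 1)) \<le> e" by (simp add: field_simps)
    then show ?thesis using Cau[of n] by (meson order_trans)
  qed
  define q where "q = (\<lambda>n::nat. 1 - 1 / (real n + 2))"
  have q: "q n < 1" for n by (simp add: q_def)
  have qlim: "q \<longlonglongrightarrow> 1" unfolding q_def by real_asymp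
  have "Cauchy (\<lambda>n. p (q n))"
  proof (rule metric_CauchyI)
    fix e :: real assume "0 < e"
    then obtain r0 where r0: "r0 < 1" "\<And>r s. r0 < r \<Longrightarrow> r < 1 \<Longrightarrow> r0 < s \<Longrightarrow> s < 1 \<Longrightarrow> cmod (p r - p s) \<le> e/2"
      using eps[of "e/2"] by auto
    obtain M where "\<And>n. n \<ge> M \<Longrightarrow> r0 < q n"
      using order_tendstoD(1)[OF qlim r0(1)] by (auto simp: eventually_sequentially)
    then have "dist (p (q m)) (p (q n)) < e" if "m \<ge> M" "n \<ge> M" for m n
      using r0(2)[of "q m" "q n"] q that \<open>0 < e\<close> by (fastforce simp: dist_norm)
    then show "\<exists>M. \<forall>m\<ge>M. \<forall>n\<ge>M. dist (p (q m)) (p (q n)) < e" by blast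
  qed
  then obtain l where l: "(\<lambda>n. p (q n)) \<longlonglongrightarrow> l" using Cauchy_convergent convergent_def by blast
  have "(p \<longlongrightarrow> l) (at_left 1)"
  proof (rule tendstoI)
    fix e :: real assume "0 < e"
    then obtain r0 where r0: "r0 < 1" "\<And>r s. r0 < r \<Longrightarrow> r < 1 \<Longrightarrow> r0 < s \<Longrightarrow> s < 1 \<Longrightarrow> cmod (p r - p s) \<le> e/2"
      using eps[of "e/2"] by auto
    have "dist (p r) l < e" if r: "r0 < r" "r < 1" for r
    proof -
      have "cmod (p r - l) \<le> e/2"
      proof (rule tendsto_upperbound)
        show "(\<lambda>n. cmod (p r - p (q n))) \<longlonglongrightarrow> cmod (p r - l)" by (intro tendsto_intros l)
        show "\<forall>\<^sub>F n in sequentially. cmod (p r - p (q n)) \<le> e/2"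
          using order_tendstoD(1)[OF qlim r0(1)] by eventually_elim (use r0(2) r q in auto)
      qed auto
      then show ?thesis using \<open>0 < e\<close> by (simp add: dist_norm)
    qed
    moreover have "\<forall>\<^sub>F r in at_left 1. r \<in> {r0<..<1}" by (rule eventually_at_left_real[OF r0(1)])
    ultimately show "\<forall>\<^sub>F r in at_left 1. dist (p r) l < e" by (auto elim: eventually_mono)
  qed
  then show ?thesis by blast
qed

theorem H1_radial_limits:
  fixes f :: "complex \<Rightarrow> complex"
  assumes hol: "f holomorphic_on ball 0 1"
    and C: "\<And>r. r\<in>{0<..<1} \<Longrightarrow> integral {0..2*pi} (\<lambda>t. cmod (f (of_real r * cis t))) \<le> C"
  shows "negligible {t \<in> {0..2*pi}. \<not> (\<exists>l. ((\<lambda>r::real. f (of_real r * cis t)) \<longlongrightarrow> l) (at_left 1))}"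
proof -
  define Bad where "Bad = (\<lambda>n::nat. {t \<in> {0..2*pi}. \<not> (\<exists>r0. 0 < r0 \<and> r0 < 1 \<and> (\<forall>r s. r0 < r \<longrightarrow> r < 1 \<longrightarrow> r0 < s \<longrightarrow> s < 1 \<longrightarrow>
            cmod (f (of_real r * cis t) - f (of_real s * cis t)) \<le> 3 * (1 / (real n + 1))))})"
  have "negligible (Bad n)" for n
    unfolding Bad_def by (rule radial_oscillation_negligible[OF hol C]) auto
  then have "negligible (\<Union>n. Bad n)" by (intro negligible_countable_Union) auto
  then show ?thesis
  proof (rule negligible_subset)
    show "{t \<in> {0..2*pi}. \<not> (\<exists>l. ((\<lambda>r::real. f (of_real r * cis t)) \<longlongrightarrow> l) (at_left 1))} \<subseteq> (\<Union>n. Bad n)"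
    proof
      fix t assume t: "t \<in> {t \<in> {0..2*pi}. \<not> (\<exists>l. ((\<lambda>r::real. f (of_real r * cis t)) \<longlongrightarrow> l) (at_left 1))}"
      show "t \<in> (\<Union>n. Bad n)"
      proof (rule ccontr)
        assume "t \<notin> (\<Union>n. Bad n)"
        then have "\<exists>r0. 0 < r0 \<and> r0 < 1 \<and> (\<forall>r s. r0 < r \<longrightarrow> r < 1 \<longrightarrow> r0 < s \<longrightarrow> s < 1 \<longrightarrow>
            cmod (f (of_real r * cis t) - f (of_real s * cis t)) \<le> 3 * (1 / (real n + 1)))" for n
        proof -
          have "t \<notin> Bad n" using \<open>t \<notin> (\<Union>n. Bad n)\<close> by blast
          moreover have "t \<in> {0..2*pi}" using t by blast
          ultimately show ?thesis unfolding Bad_def by blast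
        qed
        from tendsto_at_left_1_Cauchy[of "\<lambda>r. f (of_real r * cis t)", OF this] show False using t by blast
      qed
    qed
  qed
qed

section \<open>Inclusion of bounded analytic functions in BMOA\<close>

lemma LINT_norm_le:
  fixes F :: "real \<Rightarrow> 'a::euclidean_space"
  assumes "a \<le> b" "0 \<le> M" "\<And>t. norm (F t) \<le> M"
  shows "norm (LINT t:{a..b}|lebesgue. F t) \<le> M * (b - a)"
proof (cases "set_integrable lebesgue {a..b} F")
  case True
  have "norm (integral {a..b} F) \<le> M * measure lborel (cbox a b)"
    by (rule has_integral_bound[OF assms(2), of F])
       (use set_lebesgue_integral_eq_integral(1)[OF True] assms in \<open>auto simp: integrable_integral\<close>)
  then show ?thesis using assms(1) by (simp add: set_lebesgue_integral_eq_integral(2)[OF True])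
next
  case False
  \<comment> \<open>By convention the integral of a non-integrable function is 0, so the bound holds
    for every bounded \<open>F\<close>.\<close>
  then have "(LINT t:{a..b}|lebesgue. F t) = 0"
    unfolding set_lebesgue_integral_def set_integrable_def by (rule not_integrable_integral_eq)
  then show ?thesis using assms by simp
qed

theorem Hinf_subset_BMOA: "Hinf \<subseteq> BMOA"
proof
  fix f assume "f \<in> Hinf"
  then obtain B where hol: "f holomorphic_on ball 0 1" and B: "0 < B" "\<forall>z\<in>ball 0 1. cmod (f z) \<le> B"
    by (auto simp: Hinf_def bounded_pos)
  have fb: "cmod (f (of_real r * cis t)) \<le> B" if "0 \<le> r" "r < 1" for r t
    using B(2) that by (auto simp: norm_mult)
  have C: "integral {0..2*pi} (\<lambda>t. cmod (f (of_real r * cis t))) \<le> B * (2*pi)" if r: "0 \<le> r" "r < 1" for r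
  proof -
    have "integral {0..2*pi} (\<lambda>t. cmod (f (of_real r * cis t))) \<le> integral {0..2*pi} (\<lambda>t. B)"
      by (intro integral_le integrable_continuous_real continuous_intros continuous_on_circle[OF hol] fb)
         (use r in auto)
    then show ?thesis by (simp add: mult.commute)
  qed
  have H1: "f \<in> Hardy1"
    unfolding Hardy1_def
  proof (intro CollectI conjI hol exI[of _ B] ballI)
    fix r :: real assume r: "r \<in> {0..<1}"
    have "(\<lambda>t. cmod (f (of_real r * cis t))) absolutely_integrable_on {0..2*pi}"
      by (intro absolutely_integrable_continuous_real continuous_intros continuous_on_circle[OF hol]) (use r in auto)
    from set_lebesgue_integral_eq_integral(2)[OF this] C[of r] r
    show "1 / (2*pi) * (LINT t:{0..2*pi}|lebesgue. cmod (f (of_real r * cis t))) \<le> B"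
      by (simp add: divide_le_eq mult_ac)
  qed
  define L where "L = (\<lambda>w l. ((\<lambda>r::real. f (of_real r * w)) \<longlongrightarrow> l) (at_left 1))"
  \<comment> \<open>The boundary function depends on the point of the circle, not on the parameter,
    so it is automatically periodic. The default 0 keeps the bound \<open>B\<close> where no radial
    limit exists.\<close>
  define g where "g = (\<lambda>w. if cmod w = 1 \<and> (\<exists>l. L w l) then (SOME l. L w l) else 0)"
  have gL: "L (cis t) (g (cis t))" if "\<exists>l. L (cis t) l" for t
    using that unfolding g_def by (simp add: someI_ex)
  have gb: "cmod (g (cis t)) \<le> B" for t
  proof (cases "\<exists>l. L (cis t) l")
    case True
    have "\<forall>\<^sub>F r in at_left 1. cmod (f (of_real r * cis t)) \<le> B"
      using eventually_at_left_real[of 0 "1::real", OF zero_less_one] by eventually_elim (auto intro: fb)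
    then show ?thesis
      by (rule Lim_norm_ubound[rotated 2]) (use gL[OF True] in \<open>auto simp: L_def\<close>)
  qed (use B in \<open>auto simp: g_def\<close>)
  define Z where "Z = {t \<in> {0..2*pi}. \<not> (\<exists>l. L (cis t) l)}"
  have negZ: "negligible Z"
    unfolding Z_def L_def by (rule H1_radial_limits[OF hol C]) auto
  have bv: "has_boundary_values f g"
  proof -
    have "AE t in lebesgue. t \<in> {0..2*pi} \<longrightarrow> L (cis t) (g (cis t))"
      unfolding AE_lebesgue_iff_negligible
      by (rule negligible_subset[OF negZ]) (use gL in \<open>auto simp: Z_def\<close>)
    then show ?thesis
      unfolding has_boundary_values_def L_def by (subst AE_restrict_space_iff) auto
  qed
  have gint: "(\<lambda>t. g (cis t)) absolutely_integrable_on {0..2*pi}"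
  proof (rule absolutely_integrable_integrable_bound[of _ _ "\<lambda>_. B"])
    define q where "q = (\<lambda>n::nat. 1 - 1 / (real n + 2))"
    have q: "0 < q n" "q n < 1" for n by (auto simp: q_def)
    have qlim: "filterlim q (at_left 1) sequentially"
      unfolding filterlim_at using less_imp_neq[OF q(2)] q by (auto simp: q_def) real_asymp
    \<comment> \<open>On the negligible set the approximants equal the limit, so they converge at
      every point and dominated convergence yields the integrability of \<open>g\<close>.\<close>
    define F where "F = (\<lambda>n t. if t \<in> Z then g (cis t) else f (of_real (q n) * cis t))"
    show "(\<lambda>t. g (cis t)) integrable_on {0..2*pi}"
    proof (rule dominated_convergence(1)[of F _ "\<lambda>_. B"])
      show "F n integrable_on {0..2*pi}" for n
      proof (rule integrable_spike[OF _ negZ])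
        show "(\<lambda>t. f (of_real (q n) * cis t)) integrable_on {0..2*pi}"
          by (intro integrable_continuous_real continuous_on_circle[OF hol]) (use q[of n] in auto)
      qed (simp add: F_def)
      show "norm (F n t) \<le> B" for n t using gb fb[of "q n" t] q[of n] by (auto simp: F_def)
      show "(\<lambda>n. F n t) \<longlonglongrightarrow> g (cis t)" if "t \<in> {0..2*pi}" for t
      proof (cases "t \<in> Z")
        case False
        then have "L (cis t) (g (cis t))" using gL that by (auto simp: Z_def)
        from filterlim_compose[OF this[unfolded L_def] qlim] show ?thesis using False by (simp add: F_def)
      qed (simp add: F_def)
    qed auto
  qed (use gb in auto)
  have "g \<in> BMO_circle"
    unfolding BMO_circle_def
  proof (intro CollectI conjI gint exI[of _ "2 * B"] allI impI)
    fix a b :: real assume ab: "a < b \<and> b \<le> a + 2*pi"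
    have "norm (LINT t:{a..b}|lebesgue. g (cis t)) \<le> B * (b - a)"
      by (rule LINT_norm_le) (use ab B gb in auto)
    then have m: "cmod (arc_mean g a b) \<le> B"
      using ab unfolding arc_mean_def by (simp add: norm_divide divide_le_eq del: of_real_diff)
    have "norm (LINT t:{a..b}|lebesgue. cmod (g (cis t) - arc_mean g a b)) \<le> (2 * B) * (b - a)"
    proof (rule LINT_norm_le)
      fix t
      have "cmod (g (cis t) - arc_mean g a b) \<le> cmod (g (cis t)) + cmod (arc_mean g a b)" by (rule norm_triangle_ineq4)
      then show "norm (cmod (g (cis t) - arc_mean g a b)) \<le> 2 * B" using m gb[of t] by simp
    qed (use ab B in auto)
    then show "(LINT t:{a..b}|lebesgue. cmod (g (cis t) - arc_mean g a b)) / (b - a) \<le> 2 * B"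
      using ab by (simp add: divide_le_eq)
  qed
  then show "f \<in> BMOA" unfolding BMOA_def using H1 bv by blast
qed

section \<open>The equivalence\<close>

lemma inner_function_power:
  assumes "inner_function \<theta>"
  shows "inner_function (\<lambda>z. \<theta> z ^ k)"
proof -
  have "AE t in lebesgue_on {0..2*pi}. ((\<lambda>r::real. cmod (\<theta> (of_real r * cis t) ^ k)) \<longlongrightarrow> 1) (at_left 1)"
    using assms[unfolded inner_function_def, THEN conjunct2]
  proof eventually_elim
    case (elim t)
    from tendsto_power[OF this, of k] show ?case by (simp add: norm_power)
  qed
  then show ?thesis using assms by (auto simp: inner_function_def intro: Hinf_power)
qed

lemma decay_imp_mult_inner_power_in_Hinf_N:
  assumes f: "f \<in> Hinf_N N" and \<theta>: "inner_function \<theta>" and "0 < \<epsilon>"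
    and dec: "\<And>z. z \<in> Omega \<theta> \<epsilon> \<Longrightarrow> cmod (f z) \<le> C * (1 - cmod z) ^ N"
  shows "(\<lambda>z. f z * \<theta> z ^ k) \<in> Hinf_N N"
proof (rule decay_imp_mult_inner_in_Hinf_N[OF f inner_function_power[OF \<theta>]])
  \<comment> \<open>At level \<open>\<epsilon> ^ k\<close> the sublevel set of the power lies in
    \<open>Omega \<theta> \<epsilon>\<close>; for \<open>k = 0\<close> it is empty.\<close>
  show "0 < \<epsilon> ^ k" using \<open>0 < \<epsilon>\<close> by simp
  fix z assume "z \<in> Omega (\<lambda>z. \<theta> z ^ k) (\<epsilon> ^ k)"
  then have "z \<in> ball 0 1" "cmod (\<theta> z) ^ k < \<epsilon> ^ k" by (auto simp: Omega_def norm_power)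
  then have "z \<in> Omega \<theta> \<epsilon>"
    using power_less_imp_less_base[of "cmod (\<theta> z)" k \<epsilon>] \<open>0 < \<epsilon>\<close> by (auto simp: Omega_def)
  then show "cmod (f z) \<le> C * (1 - cmod z) ^ N" by (rule dec)
qed

lemma mult_inner_power_in_Hinf_N_imp_decay:
  assumes f: "f \<in> Hinf_N N" and "0 < N" and \<theta>: "inner_function \<theta>" and "N \<le> m"
    and g: "(\<lambda>z. f z * \<theta> z ^ m) \<in> Hinf_N N"
  shows "\<exists>\<epsilon>. 0 < \<epsilon> \<and> \<epsilon> < 1 \<and> (\<exists>C. \<forall>z \<in> Omega \<theta> \<epsilon>. cmod (f z) \<le> C * (1 - cmod z) ^ N)"
proof -
  have holf: "f holomorphic_on ball 0 1" using f by (simp add: Hinf_N_def Hinf_def)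
  obtain L where L: "L-lipschitz_on (ball 0 1) f" using Hinf_N_lipschitz[OF f \<open>0 < N\<close>] by blast
  have hol\<theta>: "\<theta> holomorphic_on ball 0 1" and rad: "AE t in lebesgue_on {0..2*pi}.
        ((\<lambda>r::real. cmod (\<theta> (of_real r * cis t))) \<longlongrightarrow> 1) (at_left 1)"
    using \<theta> by (auto simp: inner_function_def Hinf_def)
  obtain B where B: "\<forall>w\<in>ball 0 1. cmod (\<theta> w) \<le> B"
    using \<theta> by (auto simp: inner_function_def Hinf_def bounded_pos)
  define h where "h = (\<lambda>z. f z * \<theta> z ^ m)"
  have holh: "h holomorphic_on ball 0 1" using g by (simp add: h_def Hinf_N_def Hinf_def)
  obtain A where A: "\<forall>w\<in>ball 0 1. cmod ((deriv ^^ N) h w) \<le> A"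
    using g by (auto simp: h_def Hinf_N_def Hinf_def bounded_pos)
  show ?thesis
  proof (rule decay_on_sublevel_set[OF holf L hol\<theta> _ rad \<open>N \<le> m\<close>])
    fix z w :: complex assume zw: "z \<in> ball 0 1" "w \<in> ball 0 1"
    have "cmod (h w - (\<Sum>j<N. (deriv ^^ j) h z / fact j * (w - z) ^ j)) \<le> A * cmod (w - z) ^ N"
      by (rule taylor_remainder_bounded[OF holh _ zw]) (use A in auto)
    also have "\<dots> = A * (1 - cmod z) ^ N * (cmod (w - z) / (1 - cmod z)) ^ N"
      using zw by (simp add: power_divide)
    finally show "cmod (f w * \<theta> w ^ m - (\<Sum>j<N. (deriv ^^ j) (\<lambda>w. f w * \<theta> w ^ m) z / fact j * (w - z) ^ j))
        \<le> A * (1 - cmod z) ^ N * (cmod (w - z) / (1 - cmod z)) ^ N"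
      by (simp add: h_def)
  qed (use B in auto)
qed

text \<open>The Bloch bound concerns the derivative of order \<open>N + 1\<close> of the product, so
  the Taylor polynomial has \<open>N + 1\<close> coefficients, all of which must be small; hence the
  exponent has to exceed \<open>N\<close>. Condition (iii) offers every exponent and is used with
  \<open>N + 1\<close>.\<close>

lemma mult_inner_power_in_BMOA_N_imp_decay:
  assumes f: "f \<in> Hinf_N N" and "0 < N" and \<theta>: "inner_function \<theta>" and "N < m"
    and g: "(\<lambda>z. f z * \<theta> z ^ m) \<in> BMOA_N N"
  shows "\<exists>\<epsilon>. 0 < \<epsilon> \<and> \<epsilon> < 1 \<and> (\<exists>C. \<forall>z \<in> Omega \<theta> \<epsilon>. cmod (f z) \<le> C * (1 - cmod z) ^ N)"
proof -
  have holf: "f holomorphic_on ball 0 1" using f by (simp add: Hinf_N_def Hinf_def)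
  obtain L where L: "L-lipschitz_on (ball 0 1) f" using Hinf_N_lipschitz[OF f \<open>0 < N\<close>] by blast
  have hol\<theta>: "\<theta> holomorphic_on ball 0 1" and rad: "AE t in lebesgue_on {0..2*pi}.
        ((\<lambda>r::real. cmod (\<theta> (of_real r * cis t))) \<longlongrightarrow> 1) (at_left 1)"
    using \<theta> by (auto simp: inner_function_def Hinf_def)
  obtain B where B: "\<forall>w\<in>ball 0 1. cmod (\<theta> w) \<le> B"
    using \<theta> by (auto simp: inner_function_def Hinf_def bounded_pos)
  define h where "h = (\<lambda>z. f z * \<theta> z ^ m)"
  have holh: "h holomorphic_on ball 0 1" unfolding h_def by (intro holomorphic_intros holf hol\<theta>)
  obtain A where A: "\<forall>w\<in>ball 0 1. cmod (deriv ((deriv ^^ N) h) w) \<le> A / (1 - cmod w)"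
    using BMOA_imp_Bloch g by (auto simp: h_def BMOA_N_def)
  show ?thesis
  proof (rule decay_on_sublevel_set[OF holf L hol\<theta> _ rad, of B "Suc N"])
    fix z w :: complex assume zw: "z \<in> ball 0 1" "w \<in> ball 0 1"
    have "cmod (h w - (\<Sum>j<Suc N. (deriv ^^ j) h z / fact j * (w - z) ^ j)) \<le> A * cmod (w - z) ^ Suc N / (1 - cmod z)"
      by (rule taylor_remainder_bloch[OF holh _ zw]) (use A \<open>0 < N\<close> in auto)
    also have "\<dots> = A * (1 - cmod z) ^ N * (cmod (w - z) / (1 - cmod z)) ^ Suc N"
      using zw by (simp add: power_divide)
    finally show "cmod (f w * \<theta> w ^ m - (\<Sum>j<Suc N. (deriv ^^ j) (\<lambda>w. f w * \<theta> w ^ m) z / fact j * (w - z) ^ j))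
        \<le> A * (1 - cmod z) ^ N * (cmod (w - z) / (1 - cmod z)) ^ Suc N"
      by (simp add: h_def)
  qed (use B \<open>N < m\<close> in auto)
qed

theorem theorem1p3:
  fixes m N :: nat and f \<theta> :: "complex \<Rightarrow> complex"
  assumes "0 < N" and "0 < m" and "N \<le> m"
    and "f \<in> Hinf_N N" and "inner_function \<theta>"
  defines "i \<equiv> (\<lambda>z. f z * \<theta> z ^ m) \<in> Hinf_N N"
    and "ii \<equiv> \<forall>k::nat. 1 \<le> k \<longrightarrow> (\<lambda>z. f z * \<theta> z ^ k) \<in> Hinf_N N"
    and "iii \<equiv> \<forall>k::nat. 1 \<le> k \<longrightarrow> (\<lambda>z. f z * \<theta> z ^ k) \<in> BMOA_N N"
    and "iv \<equiv> \<exists>\<epsilon>::real. 0 < \<epsilon> \<and> \<epsilon> < 1 \<and>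
                (\<exists>C::real. \<forall>z \<in> Omega \<theta> \<epsilon>. cmod (f z) \<le> C * (1 - cmod z) ^ N)"
  shows "(i \<longleftrightarrow> ii) \<and> (ii \<longleftrightarrow> iii) \<and> (iii \<longleftrightarrow> iv)"
proof -
  have "i" if "ii" using that \<open>0 < m\<close> unfolding i_def ii_def by simp
  moreover have "iv" if "i"
    using that mult_inner_power_in_Hinf_N_imp_decay[OF \<open>f \<in> Hinf_N N\<close> \<open>0 < N\<close> \<open>inner_function \<theta>\<close> \<open>N \<le> m\<close>]
    unfolding i_def iv_def by blast
  moreover have "ii" if "iv"
    using that decay_imp_mult_inner_power_in_Hinf_N[OF \<open>f \<in> Hinf_N N\<close> \<open>inner_function \<theta>\<close>]
    unfolding ii_def iv_def by blast
  moreover have "iii" if "ii"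
    using that Hinf_subset_BMOA unfolding ii_def iii_def Hinf_N_def BMOA_N_def by blast
  moreover have "iv" if "iii"
  proof -
    have "1 \<le> Suc N" by simp
    then have "(\<lambda>z. f z * \<theta> z ^ Suc N) \<in> BMOA_N N" using that unfolding iii_def by blast
    from mult_inner_power_in_BMOA_N_imp_decay[OF \<open>f \<in> Hinf_N N\<close> \<open>0 < N\<close> \<open>inner_function \<theta>\<close> lessI this]
    show ?thesis unfolding iv_def .
  qed
  ultimately show ?thesis by blast
qed

end
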